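(* Consider the control system $\dot x = f(x)+g(x)u$ on $\mathcal D$, the high order control barrier function $h$ of relative degree $k$ with associated safe set $\mathbf C$, the safety constraint $C_s(x,u)\ge 0$, and the optimal control problem of minimizing $J(x_0,u)=\int_0^\infty\big(\mathbf Q(x)+\tfrac12 u^{T}Ru\big)\,dt$ subject to the dynamics and the safety constraint, all as specified in the context and satisfying the standing assumptions listed there. Assume that there exists a Lyapunov-like smooth solution $V^*_{\rm safe}:\mathcal D\to\mathbb R$ of this constrained optimal control problem; that is, $V^*_{\rm safe}$ is smooth, $V^*_{\rm safe}(0)=0$, $V^*_{\rm safe}(x)>0$ for $x\ne 0$, it is the value function of the constrained problem (for every $x_0\in\mathbf C$ the minimum of $J(x_0,\cdot)$ over admissible controls is attained and equals $V^*_{\rm safe}(x_0)$), and it solves the constrained Hamilton-Jacobi-Bellman equation $$0=\min_{u\in\mathbb R^m,\ C_s(x,u)\ge 0}\Big\{L_fV^*_{\rm safe}(x)+L_gV^*_{\rm safe}(x)\,u+\tfrac12u^{T}Ru+\mathbf Q(x)\Big\},\qquad x\in\mathcal D .$$ Define the feedback $$u^*_{\rm safe}(x)=-R^{-1}\Big(L_gV^*_{\rm safe}(x)-\lambda(x)\,L_gL_f^{k-1}h(x)\Big)^{T},$$ where $$\lambda(x)=-\frac{L_f^kh(x)-L_gL_f^{k-1}h(x)\,R^{-1}L_gV^*_{\rm safe}(x)^{T}+\alpha(x)}{L_gL_f^{k-1}h(x)\,R^{-1}\,L_gL_f^{k-1}h(x)^{T}}$$ if $C_s\big(x,-R^{-1}L_gV^*_{\rm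 safe}(x)^{T}\big)<0$, and $\lambda(x)=0$ otherwise. Then: (i) $u^*_{\rm safe}(x)\in K_{\rm cbf}(x)$ for every $x$, and $u^*_{\rm safe}$ renders $\mathbf C$ forward invariant; (ii) $u^*_{\rm safe}$ is locally Lipschitz continuous; (iii) among the controls that take values in $K_{\rm cbf}$ along their trajectories, $u^*_{\rm safe}$ is the one that minimizes the cost: for every initial state $x_0\in\operatorname{Int}\mathbf C$, the closed-loop control generated by $u^*_{\rm safe}$ minimizes $J(x_0,\cdot)$ over admissible controls; (iv) the origin of the closed-loop system $\dot x=f(x)+g(x)u^*_{\rm safe}(x)$ is asymptotically stable.
   Context: System: $\dot x=f(x)+g(x)u$ with $x\in\mathcal D\subset\mathbb R^n$, $\mathcal D$ open, $u\in\mathbb R^m$, and $f:\mathbb R^n\to\mathbb R^n$, $g:\mathbb R^n\to\mathbb R^{n\times m}$ locally Lipschitz. Gradients are row vectors: for scalar $W$, $L_fW=\frac{\partial W}{\partial x}f\in\mathbb R$ and $L_gW=\frac{\partial W}{\partial x}g\in\mathbb R^{1\times m}$; $L_f^i$ is the iterated Lie derivative. Class $\mathcal K$ function (in this setting): a continuous strictly increasing function $\alpha:(-a,b)\to(-\infty,\infty)$, $a,b>0$, with $\alpha(0)=0$. High order control barrier function: $h:\mathbb R^n\to\mathbb R$ is $k$ times differentiable along the system, has relative degree $k\ge1$ (so $L_gL_f^{i}h\equiv0$ for $0\le i<k-1$), and $L_gL_f^{k-1}h(x)\neq0$ for all $x\in\mathcal D$. Given differentiable class $\mathcal K$ functions $\alpha_1,\dots,\alpha_k$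 (regular enough that the following is defined), put $\psi_0=h$ and $\psi_i=\dot\psi_{i-1}+\alpha_i(\psi_{i-1})$ for $i=1,\dots,k$, where the dot is the derivative along the system; because of the relative degree, $\psi_i$ for $i<k$ depends only on $x$, while $\psi_k$ depends on $(x,u)$. Put $\mathcal C_i=\{x:\psi_{i-1}(x)\ge0\}$ for $i=1,\dots,k$ and $\mathbf C=\mathcal C_1\cap\dots\cap\mathcal C_k\subseteq\mathcal D$. The safety constraint is $$C_s(x,u):=\psi_k(x,u)=L_f^kh(x)+L_gL_f^{k-1}h(x)\,u+\alpha(x)\ge0,$$ where $\alpha(x):=L_f\psi_{k-1}(x)-L_f^kh(x)+\alpha_k(\psi_{k-1}(x))$ collects all terms not involving $L_f^k h$ or $u$ (for $k=1$, $\alpha(x)=\alpha_1(h(x))$). Let $K_{\rm cbf}(x)=\{u\in\mathbb R^m: C_s(x,u)\ge0\}$. Standing assumptions: the functions involved in the safety constraint ($L_f^kh$, $L_gL_f^{k-1}h$, the $\psi_i$, the $\alpha_i$ and $\alpha(\cdot)$) are locally Lipschitz; the origin lies in $\mathbf C$; initial states of interest lie in $\operatorname{Int}\mathbf C$; $\mathbf Q:\mathbb R^n\to\mathbb R$ is continuously differentiable with $\mathbf Q(x)>0$ for $x\neq0$; $R\in\mathbb R^{m\times m}$ is constant, symmetric, positive definite. Admissible control for $x_0\in\mathbf C$: a measurable, locally essentially bounded $u:[0,\infty)\to\mathbb R^m$ whose trajectory $x(\cdot)$ from $x(0)=x_0$ exists in $\mathcal D$ for all $t\ge0$ and satisfies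 $u(t)\in K_{\rm cbf}(x(t))$ for almost every $t\ge 0$ (the trajectory then being in $\mathbf C$). A set is forward invariant under a feedback if every closed-loop trajectory starting in it stays in it on its whole forward interval of existence. *)

theory Defs
  imports "HOL-Analysis.Analysis"
begin

abbreviation locally_lipschitz_on ::
  "'a::metric_space set \<Rightarrow> ('a \<Rightarrow> 'b::metric_space) \<Rightarrow> bool" where
  "locally_lipschitz_on S F \<equiv> local_lipschitz (UNIV :: real set) S (\<lambda>_. F)"

definition gradient :: "(real^'n \<Rightarrow> real) \<Rightarrow> real^'n \<Rightarrow> real^'n" where
  "gradient W x = (\<chi> i. frechet_derivative W (at x) (axis i 1))"

text \<open>Continuous differentiability of order \<open>r\<close> through partial derivatives; the predicate is
  only used for open \<open>S\<close>.\<close>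

primrec Ck_on :: "nat \<Rightarrow> (real^'n) set \<Rightarrow> (real^'n \<Rightarrow> real) \<Rightarrow> bool" where
  "Ck_on 0 S W = continuous_on S W"
| "Ck_on (Suc r) S W =
     ((\<forall>x\<in>S. W differentiable (at x)) \<and> (\<forall>i. Ck_on r S (\<lambda>x. gradient W x $ i)))"

definition smooth_on :: "(real^'n) set \<Rightarrow> (real^'n \<Rightarrow> real) \<Rightarrow> bool" where
  "smooth_on S W \<longleftrightarrow> (\<forall>r. Ck_on r S W)"

definition Lie_f :: "(real^'n \<Rightarrow> real^'n) \<Rightarrow> (real^'n \<Rightarrow> real) \<Rightarrow> real^'n \<Rightarrow> real" where
  "Lie_f f W x = gradient W x \<bullet> f x"

definition Lie_g :: "(real^'n \<Rightarrow> real^'m^'n) \<Rightarrow> (real^'n \<Rightarrow> real) \<Rightarrow> real^'n \<Rightarrow> real^'m" where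
  "Lie_g g W x = gradient W x v* g x"

abbreviation Lie_f_iter ::
  "(real^'n \<Rightarrow> real^'n) \<Rightarrow> nat \<Rightarrow> (real^'n \<Rightarrow> real) \<Rightarrow> real^'n \<Rightarrow> real" where
  "Lie_f_iter f i W \<equiv> (Lie_f f ^^ i) W"

definition system_deriv :: "(real^'n \<Rightarrow> real^'n) \<Rightarrow> (real^'n \<Rightarrow> real^'m^'n) \<Rightarrow>
    (real^'n \<Rightarrow> real) \<Rightarrow> real^'n \<Rightarrow> real^'m \<Rightarrow> real" where
  "system_deriv f g W x u = Lie_f f W x + Lie_g g W x \<bullet> u"

definition K_domain :: "ereal \<Rightarrow> ereal \<Rightarrow> real set" where
  "K_domain a b = {s. - a < ereal s \<and> ereal s < b}"

definition class_K :: "ereal \<Rightarrow> ereal \<Rightarrow> (real \<Rightarrow> real) \<Rightarrow> bool" where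
  "class_K a b \<kappa> \<longleftrightarrow> 0 < a \<and> 0 < b \<and>
     continuous_on (K_domain a b) \<kappa> \<and> strict_mono_on (K_domain a b) \<kappa> \<and> \<kappa> 0 = 0"

text \<open>\<open>psi f h \<alpha> i\<close> is used for \<open>i < k\<close> only. There the derivative along the system has
  no control term, because the relative degree is \<open>k\<close>, and so reduces to \<open>Lie_f\<close>. The last
  function of the chain, which depends on the control as well, is \<open>C_s\<close>.\<close>

primrec psi :: "(real^'n \<Rightarrow> real^'n) \<Rightarrow> (real^'n \<Rightarrow> real) \<Rightarrow> (nat \<Rightarrow> real \<Rightarrow> real) \<Rightarrow>
    nat \<Rightarrow> real^'n \<Rightarrow> real" where
  "psi f h \<alpha> 0 = h"
| "psi f h \<alpha> (Suc i) = (\<lambda>x. Lie_f f (psi f h \<alpha> i) x + \<alpha> (Suc i) (psi f h \<alpha> i x))"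

definition C_s :: "(real^'n \<Rightarrow> real^'n) \<Rightarrow> (real^'n \<Rightarrow> real^'m^'n) \<Rightarrow> (real^'n \<Rightarrow> real) \<Rightarrow>
    (nat \<Rightarrow> real \<Rightarrow> real) \<Rightarrow> nat \<Rightarrow> real^'n \<Rightarrow> real^'m \<Rightarrow> real" where
  "C_s f g h \<alpha> k x u =
     system_deriv f g (psi f h \<alpha> (k - 1)) x u + \<alpha> k (psi f h \<alpha> (k - 1) x)"

definition K_cbf :: "(real^'n \<Rightarrow> real^'n) \<Rightarrow> (real^'n \<Rightarrow> real^'m^'n) \<Rightarrow> (real^'n \<Rightarrow> real) \<Rightarrow>
    (nat \<Rightarrow> real \<Rightarrow> real) \<Rightarrow> nat \<Rightarrow> real^'n \<Rightarrow> (real^'m) set" where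
  "K_cbf f g h \<alpha> k x = {u. C_s f g h \<alpha> k x u \<ge> 0}"

text \<open>The function written \<open>\<alpha>(x)\<close> in the constraint
  \<open>L\<^sub>f\<^sup>k h(x) + L\<^sub>g L\<^sub>f\<^sup>k\<^sup>-\<^sup>1 h(x) u + \<alpha>(x) \<ge> 0\<close>.\<close>

definition alpha_rest :: "(real^'n \<Rightarrow> real^'n) \<Rightarrow> (real^'n \<Rightarrow> real) \<Rightarrow>
    (nat \<Rightarrow> real \<Rightarrow> real) \<Rightarrow> nat \<Rightarrow> real^'n \<Rightarrow> real" where
  "alpha_rest f h \<alpha> k x =
     Lie_f f (psi f h \<alpha> (k - 1)) x - Lie_f_iter f k h x + \<alpha> k (psi f h \<alpha> (k - 1) x)"

definition safe_set :: "(real^'n) set \<Rightarrow> (real^'n \<Rightarrow> real^'n) \<Rightarrow> (real^'n \<Rightarrow> real) \<Rightarrow>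
    (nat \<Rightarrow> real \<Rightarrow> real) \<Rightarrow> nat \<Rightarrow> (real^'n) set" where
  "safe_set D f h \<alpha> k = (\<Inter>i\<in>{1..k}. {x\<in>D. psi f h \<alpha> (i - 1) x \<ge> 0})"

text \<open>\<open>\<alpha> i\<close> is defined on \<open>(-a i, b i)\<close>, where infinite end points are allowed. Forming the
  chain up to \<open>C_s\<close> takes derivatives of \<open>\<alpha> i\<close> up to order \<open>k - i\<close>; in addition every
  \<open>\<alpha> i\<close>, including \<open>\<alpha> k\<close>, is differentiable.\<close>

definition hocbf :: "(real^'n) set \<Rightarrow> (real^'n \<Rightarrow> real^'n) \<Rightarrow> (real^'n \<Rightarrow> real^'m^'n) \<Rightarrow>
    (real^'n \<Rightarrow> real) \<Rightarrow> nat \<Rightarrow> (nat \<Rightarrow> ereal) \<Rightarrow> (nat \<Rightarrow> ereal) \<Rightarrow> (nat \<Rightarrow> real \<Rightarrow> real) \<Rightarrow> bool" where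
  "hocbf D f g h k a b \<alpha> \<longleftrightarrow>
     1 \<le> k \<and>
     (\<forall>i<k. \<forall>x\<in>D. Lie_f_iter f i h differentiable (at x)) \<and>
     (\<forall>i<k-1. \<forall>x\<in>D. Lie_g g (Lie_f_iter f i h) x = 0) \<and>
     (\<forall>x\<in>D. Lie_g g (Lie_f_iter f (k - 1) h) x \<noteq> 0) \<and>
     (\<forall>i\<in>{1..k}. class_K (a i) (b i) (\<alpha> i) \<and>
        (\<forall>j<max 1 (k - i). \<forall>s\<in>K_domain (a i) (b i). (deriv ^^ j) (\<alpha> i) differentiable (at s)) \<and>
        (\<forall>x\<in>D. psi f h \<alpha> (i - 1) x \<in> K_domain (a i) (b i)))"

text \<open>Caratheodory solutions of \<open>x' = f x + g x u\<close> on \<open>[0, \<infinity>)\<close>. Functions of time are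
  total, but only their restriction to nonnegative times matters.\<close>

definition trajectory :: "(real^'n) set \<Rightarrow> (real^'n \<Rightarrow> real^'n) \<Rightarrow> (real^'n \<Rightarrow> real^'m^'n) \<Rightarrow>
    real^'n \<Rightarrow> (real \<Rightarrow> real^'m) \<Rightarrow> (real \<Rightarrow> real^'n) \<Rightarrow> bool" where
  "trajectory D f g x0 u x \<longleftrightarrow>
     (\<forall>t\<ge>0. x t \<in> D \<and>
        (\<lambda>s. f (x s) + g (x s) *v u s) absolutely_integrable_on {0..t} \<and>
        x t = x0 + integral {0..t} (\<lambda>s. f (x s) + g (x s) *v u s))"

text \<open>For locally Lipschitz \<open>f\<close>, \<open>g\<close> and locally essentially bounded \<open>u\<close> the trajectory is
  unique on \<open>[0, \<infinity>)\<close>, so that the choice below is immaterial.\<close>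

definition state :: "(real^'n) set \<Rightarrow> (real^'n \<Rightarrow> real^'n) \<Rightarrow> (real^'n \<Rightarrow> real^'m^'n) \<Rightarrow>
    real^'n \<Rightarrow> (real \<Rightarrow> real^'m) \<Rightarrow> real \<Rightarrow> real^'n" where
  "state D f g x0 u = (SOME x. trajectory D f g x0 u x)"

definition admissible :: "(real^'n) set \<Rightarrow> (real^'n \<Rightarrow> real^'n) \<Rightarrow> (real^'n \<Rightarrow> real^'m^'n) \<Rightarrow>
    (real^'n \<Rightarrow> (real^'m) set) \<Rightarrow> real^'n \<Rightarrow> (real \<Rightarrow> real^'m) \<Rightarrow> bool" where
  "admissible D f g K x0 u \<longleftrightarrow>
     u \<in> borel_measurable (lebesgue_on {0..}) \<and>
     (\<forall>T>0. \<exists>B. AE t in lebesgue_on {0..T}. norm (u t) \<le> B) \<and>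
     (\<exists>x. trajectory D f g x0 u x) \<and>
     (AE t in lebesgue_on {0..}. u t \<in> K (state D f g x0 u t))"

text \<open>The integrand is nonnegative in the intended use, so the cost is an extended nonnegative
  real.\<close>

definition J :: "(real^'n) set \<Rightarrow> (real^'n \<Rightarrow> real^'n) \<Rightarrow> (real^'n \<Rightarrow> real^'m^'n) \<Rightarrow>
    (real^'n \<Rightarrow> real) \<Rightarrow> real^'m^'m \<Rightarrow> real^'n \<Rightarrow> (real \<Rightarrow> real^'m) \<Rightarrow> ennreal" where
  "J D f g Q R x0 u =
     (\<integral>\<^sup>+ t. ennreal (Q (state D f g x0 u t) + 1/2 * (u t \<bullet> (R *v u t))) \<partial>lebesgue_on {0..})"

definition multiplier :: "(real^'n \<Rightarrow> real^'n) \<Rightarrow> (real^'n \<Rightarrow> real^'m^'n) \<Rightarrow> (real^'n \<Rightarrow> real) \<Rightarrow>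
    (nat \<Rightarrow> real \<Rightarrow> real) \<Rightarrow> nat \<Rightarrow> real^'m^'m \<Rightarrow> (real^'n \<Rightarrow> real) \<Rightarrow> real^'n \<Rightarrow> real" where
  "multiplier f g h \<alpha> k R V x =
     (let c = Lie_g g (Lie_f_iter f (k - 1) h) x in
      if C_s f g h \<alpha> k x (- (matrix_inv R *v Lie_g g V x)) < 0
      then - ((Lie_f_iter f k h x - c \<bullet> (matrix_inv R *v Lie_g g V x) + alpha_rest f h \<alpha> k x)
              / (c \<bullet> (matrix_inv R *v c)))
      else 0)"

definition u_safe :: "(real^'n \<Rightarrow> real^'n) \<Rightarrow> (real^'n \<Rightarrow> real^'m^'n) \<Rightarrow> (real^'n \<Rightarrow> real) \<Rightarrow>
    (nat \<Rightarrow> real \<Rightarrow> real) \<Rightarrow> nat \<Rightarrow> real^'m^'m \<Rightarrow> (real^'n \<Rightarrow> real) \<Rightarrow> real^'n \<Rightarrow> real^'m" where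
  "u_safe f g h \<alpha> k R V x =
     - (matrix_inv R *v
          (Lie_g g V x - multiplier f g h \<alpha> k R V x *\<^sub>R Lie_g g (Lie_f_iter f (k - 1) h) x))"

definition closed_loop :: "(real^'n \<Rightarrow> real^'n) \<Rightarrow> (real^'n \<Rightarrow> real^'m^'n) \<Rightarrow>
    (real^'n \<Rightarrow> real^'m) \<Rightarrow> real^'n \<Rightarrow> real^'n" where
  "closed_loop f g \<phi> x = f x + g x *v \<phi> x"

definition solution_on :: "(real^'n) set \<Rightarrow> (real^'n \<Rightarrow> real^'n) \<Rightarrow> real set \<Rightarrow>
    (real \<Rightarrow> real^'n) \<Rightarrow> bool" where
  "solution_on D F I x \<longleftrightarrow>
     (\<forall>t\<in>I. x t \<in> D \<and> (x has_vector_derivative F (x t)) (at t within I))"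

definition forward_invariant :: "(real^'n) set \<Rightarrow> (real^'n \<Rightarrow> real^'n) \<Rightarrow> (real^'n) set \<Rightarrow> bool" where
  "forward_invariant D F S \<longleftrightarrow>
     (\<forall>I x. is_interval I \<and> 0 \<in> I \<and> I \<subseteq> {0..} \<and> solution_on D F I x \<and> x 0 \<in> S
        \<longrightarrow> (\<forall>t\<in>I. x t \<in> S))"

text \<open>Existence of solutions for all nonnegative times is part of the notion.\<close>

definition asymptotically_stable_origin :: "(real^'n) set \<Rightarrow> (real^'n \<Rightarrow> real^'n) \<Rightarrow> bool" where
  "asymptotically_stable_origin D F \<longleftrightarrow>
     0 \<in> D \<and> F 0 = 0 \<and>
     (\<exists>\<delta>>0. \<forall>x0. norm x0 < \<delta> \<longrightarrow> (\<exists>x. solution_on D F {0..} x \<and> x 0 = x0)) \<and>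
     (\<forall>\<epsilon>>0. \<exists>\<delta>>0. \<forall>x. solution_on D F {0..} x \<and> norm (x 0) < \<delta> \<longrightarrow> (\<forall>t\<ge>0. norm (x t) < \<epsilon>)) \<and>
     (\<exists>\<delta>>0. \<forall>x. solution_on D F {0..} x \<and> norm (x 0) < \<delta> \<longrightarrow> (x \<longlongrightarrow> 0) at_top)"

end

(*
  For fixed x the Hamilton-Jacobi-Bellman problem is a strictly convex quadratic program with one
  affine constraint, and u_safe is its solution: lambda is the Lagrange multiplier, equal to the
  positive part of a locally Lipschitz function. Hence the Hamiltonian is nonnegative on K_cbf and
  vanishes only at u_safe, so V decreases along the closed loop at exactly the rate of the running
  cost. This gives cost at most V(x0) for closed-loop solutions and makes V a Lyapunov function.

  Since V need not be proper, global solutions from the safe set do not come from V but from the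
  optimal controls: by dynamic programming the Hamiltonian vanishes almost everywhere along an
  optimal trajectory, which is therefore driven by u_safe and is a classical solution. Started at
  the origin, such a trajectory has value 0 forever, which shows that the origin is an equilibrium.

  The functions psi_i are differentiable but not continuously so; the chain rule along
  trajectories uses only the continuity of their Lie derivatives.
*)
theory Submission
  imports Defs
begin

subsection \<open>Lie derivatives and the relative degree\<close>

text \<open>Only \<open>h\<close> and its first iterated Lie derivatives are differentiable, so
  partial derivatives of the chain need not be differentiable again. Hence the calculus of
  \<open>lie_reg\<close>, which counts Lie derivatives along \<open>f\<close> and records where a
  control term may appear. Its purpose is to identify \<open>L_g psi_(k-1)\<close> with
  \<open>L_g L_f^(k-1) h\<close>; without this, the multiplier would not fit \<open>C_s\<close>.

  Invariance asks nothing of the boundary of the safe set. Where a chain member is negative, so is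
  its class K image, and the chain equation then forces the member to grow. The argument runs from
  \<open>psi_(k-1)\<close> down to \<open>h\<close>.

  Stability demands solutions from a full neighbourhood of the origin, but the origin may lie on the
  boundary of the safe set, and optimal controls exist only for safe initial states. Near the
  origin, solutions are therefore built for the field composed with the projection onto a ball, and
  \<open>V\<close> then shows that the ball is never left. This is possible because the
  Hamilton-Jacobi-Bellman equation holds on all of \<open>D\<close>.\<close>

lemma frechet_derivative_eq_gradient:
  assumes "W differentiable (at x)"
  shows "frechet_derivative W (at x) v = gradient W x \<bullet> v"
proof -
  interpret bounded_linear "frechet_derivative W (at x)"
    using assms frechet_derivative_works has_derivative_bounded_linear by blast
  have "frechet_derivative W (at x) v = frechet_derivative W (at x) (\<Sum>i\<in>UNIV. v $ i *\<^sub>R axis i 1)"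
    by (simp add: basis_expansion scalar_mult_eq_scaleR[symmetric])
  also have "\<dots> = gradient W x \<bullet> v"
    by (simp add: sum scaleR gradient_def inner_vec_def mult.commute)
  finally show ?thesis .
qed

lemma has_derivative_gradient:
  assumes "W differentiable (at x)"
  shows "(W has_derivative (\<lambda>v. gradient W x \<bullet> v)) (at x)"
  using assms frechet_derivative_works[of W "at x"] frechet_derivative_eq_gradient[OF assms]
  by (metis (no_types, lifting) ext)

lemma gradient_eqI:
  assumes "(W has_derivative (\<lambda>v. w \<bullet> v)) (at x)"
  shows "gradient W x = w"
  using frechet_derivative_at[OF assms, symmetric]
  by (simp add: gradient_def vec_eq_iff inner_axis)

text \<open>No differentiability is assumed: locally equal functions have the same set of
  derivatives, so \<open>frechet_derivative\<close> makes the same choice for both, even from an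
  empty set.\<close>

lemma gradient_cong:
  assumes "open D" "x \<in> D" "\<And>y. y \<in> D \<Longrightarrow> W y = U y"
  shows "gradient W x = gradient U x"
proof -
  have "(W has_derivative F) (at x) \<longleftrightarrow> (U has_derivative F) (at x)" for F
    using assms by (metis has_derivative_transform_within_open)
  then show ?thesis
    by (simp add: gradient_def frechet_derivative_def)
qed

lemma differentiable_cong_open:
  assumes "open D" "x \<in> D" "\<And>y. y \<in> D \<Longrightarrow> W y = U y"
  shows "W differentiable (at x) \<longleftrightarrow> U differentiable (at x)"
  unfolding differentiable_def using assms by (metis has_derivative_transform_within_open)

lemma Lie_f_cong:
  assumes "open D" "x \<in> D" "\<And>y. y \<in> D \<Longrightarrow> W y = U y"
  shows "Lie_f f W x = Lie_f f U x"
  unfolding Lie_f_def using gradient_cong[OF assms] by simp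

lemma Lie_g_cong:
  assumes "open D" "x \<in> D" "\<And>y. y \<in> D \<Longrightarrow> W y = U y"
  shows "Lie_g g W x = Lie_g g U x"
  unfolding Lie_g_def using gradient_cong[OF assms] by simp

lemma gradient_add:
  assumes "W differentiable (at x)" "U differentiable (at x)"
  shows "gradient (\<lambda>x. W x + U x) x = gradient W x + gradient U x"
  by (rule gradient_eqI)
    (auto intro!: derivative_eq_intros has_derivative_gradient assms simp: inner_add_left)

lemma gradient_diff:
  assumes "W differentiable (at x)" "U differentiable (at x)"
  shows "gradient (\<lambda>x. W x - U x) x = gradient W x - gradient U x"
  by (rule gradient_eqI)
    (auto intro!: derivative_eq_intros has_derivative_gradient assms simp: inner_diff_left)

lemma gradient_mult:
  assumes "W differentiable (at x)" "U differentiable (at x)"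
  shows "gradient (\<lambda>x. W x * U x) x = U x *\<^sub>R gradient W x + W x *\<^sub>R gradient U x"
  by (rule gradient_eqI)
    (auto intro!: derivative_eq_intros has_derivative_gradient assms
      simp: inner_add_left algebra_simps)

lemma has_derivative_comp_gradient:
  assumes "W differentiable (at x)" "\<kappa> differentiable (at (W x))"
  shows "((\<lambda>x. \<kappa> (W x)) has_derivative (\<lambda>v. (deriv \<kappa> (W x) *\<^sub>R gradient W x) \<bullet> v)) (at x)"
proof -
  have "(\<kappa> has_real_derivative deriv \<kappa> (W x)) (at (W x))"
    using assms(2) by (simp add: DERIV_deriv_iff_real_differentiable)
  then have "(\<kappa> has_derivative (\<lambda>t. deriv \<kappa> (W x) * t)) (at (W x))"
    by (simp add: has_field_derivative_def)
  from has_derivative_compose[OF has_derivative_gradient[OF assms(1)] this]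
  show ?thesis by simp
qed

lemma Lie_g_inner: "Lie_g g W x \<bullet> u = gradient W x \<bullet> (g x *v u)"
  by (simp add: Lie_g_def dot_lmul_matrix)

text \<open>For \<open>c = 0\<close> the function has \<open>n\<close> Lie derivatives along \<open>f\<close>, all of them without control
  term; for \<open>c = 1\<close> the last one may have a control term.\<close>

primrec lie_reg :: "(real^'n) set \<Rightarrow> (real^'n \<Rightarrow> real^'n) \<Rightarrow> (real^'n \<Rightarrow> real^'m^'n) \<Rightarrow> nat \<Rightarrow>
    nat \<Rightarrow> (real^'n \<Rightarrow> real) \<Rightarrow> bool" where
  "lie_reg D f g c 0 W = True"
| "lie_reg D f g c (Suc n) W \<longleftrightarrow> (\<forall>x\<in>D. W differentiable (at x)) \<and>
     (c \<le> n \<longrightarrow> (\<forall>x\<in>D. Lie_g g W x = 0)) \<and> lie_reg D f g c n (Lie_f f W)"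

lemma lie_reg_cong:
  assumes "open D" "\<And>x. x \<in> D \<Longrightarrow> W x = U x"
  shows "lie_reg D f g c n W \<longleftrightarrow> lie_reg D f g c n U"
  using assms(2)
proof (induction n arbitrary: W U)
  case (Suc n)
  have "lie_reg D f g c n (Lie_f f W) \<longleftrightarrow> lie_reg D f g c n (Lie_f f U)"
    by (rule Suc.IH) (rule Lie_f_cong[OF assms(1) _ Suc.prems])
  moreover have "W differentiable (at x) \<longleftrightarrow> U differentiable (at x)" "Lie_g g W x = Lie_g g U x"
    if "x \<in> D" for x
    by (rule differentiable_cong_open[OF assms(1) that Suc.prems], assumption,
      rule Lie_g_cong[OF assms(1) that Suc.prems], assumption)
  ultimately show ?case by simp
qed simp

lemma lie_reg_SucD: "lie_reg D f g c (Suc n) W \<Longrightarrow> lie_reg D f g c n W"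
proof (induction n arbitrary: W)
  case (Suc n)
  then have "lie_reg D f g c n (Lie_f f W)"
    by (intro Suc.IH) (simp only: lie_reg.simps(2)[of D f g c "Suc n"])
  with Suc.prems show ?case by (simp only: lie_reg.simps) simp
qed simp

text \<open>Giving up the last order also gives up the step in which a control term was still
  allowed.\<close>

lemma lie_reg_Suc_SucD: "lie_reg D f g (Suc c) (Suc n) W \<Longrightarrow> lie_reg D f g c n W"
proof (induction n arbitrary: W)
  case (Suc n)
  then have "lie_reg D f g c n (Lie_f f W)"
    by (intro Suc.IH) (simp only: lie_reg.simps(2)[of D f g "Suc c" "Suc n"])
  with Suc.prems show ?case by (simp only: lie_reg.simps) simp
qed simp

lemma lie_reg_add:
  assumes "open D" "lie_reg D f g c n W" "lie_reg D f g c n U"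
  shows "lie_reg D f g c n (\<lambda>x. W x + U x)"
  using assms(2,3)
proof (induction n arbitrary: W U)
  case (Suc n)
  have grad: "gradient (\<lambda>x. W x + U x) x = gradient W x + gradient U x" if "x \<in> D" for x
    using Suc.prems that by (intro gradient_add) auto
  have "lie_reg D f g c n (Lie_f f (\<lambda>x. W x + U x)) \<longleftrightarrow>
      lie_reg D f g c n (\<lambda>x. Lie_f f W x + Lie_f f U x)"
    by (intro lie_reg_cong assms(1)) (simp add: Lie_f_def grad inner_add_left)
  then show ?case
    using Suc by (auto simp: Lie_g_def grad vector_matrix_left_distrib)
qed simp

text \<open>In the Leibniz rule each summand pairs an undifferentiated factor with a Lie derivative,
  which has one order less. The other factor is weakened to that order before the induction
  hypothesis applies.\<close>

lemma lie_reg_mult: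
  assumes "open D" "lie_reg D f g c n W" "lie_reg D f g c n U"
  shows "lie_reg D f g c n (\<lambda>x. W x * U x)"
  using assms(2,3)
proof (induction n arbitrary: W U)
  case (Suc n)
  have grad: "gradient (\<lambda>x. W x * U x) x = U x *\<^sub>R gradient W x + W x *\<^sub>R gradient U x" if "x \<in> D" for x
    using Suc.prems that by (intro gradient_mult) auto
  have "lie_reg D f g c n (Lie_f f (\<lambda>x. W x * U x)) \<longleftrightarrow>
      lie_reg D f g c n (\<lambda>x. U x * Lie_f f W x + W x * Lie_f f U x)"
    by (intro lie_reg_cong assms(1)) (simp add: Lie_f_def grad inner_add_left)
  moreover have "lie_reg D f g c n (\<lambda>x. U x * Lie_f f W x + W x * Lie_f f U x)"
    using Suc.prems by (intro lie_reg_add assms(1) Suc.IH lie_reg_SucD[OF Suc.prems(1)]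
      lie_reg_SucD[OF Suc.prems(2)]) simp_all
  ultimately show ?case
    using Suc.prems
    by (auto simp: Lie_g_def grad vector_matrix_left_distrib scaleR_vector_matrix_assoc)
qed simp

text \<open>By the chain rule the Lie derivative is the product of \<open>deriv \<kappa>\<close>
  along \<open>W\<close> with \<open>Lie_f f W\<close>. The first factor is again a composition, one
  order lower, so the induction must vary \<open>\<kappa>\<close>.\<close>

lemma lie_reg_comp:
  assumes "open D" "lie_reg D f g c n W" "\<And>x. x \<in> D \<Longrightarrow> W x \<in> S"
    and "\<And>j s. j < n \<Longrightarrow> s \<in> S \<Longrightarrow> (deriv ^^ j) \<kappa> differentiable (at s)"
  shows "lie_reg D f g c n (\<lambda>x. \<kappa> (W x))"
  using assms(2,4)
proof (induction n arbitrary: \<kappa>)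
  case (Suc n)
  have der: "((\<lambda>x. \<kappa> (W x)) has_derivative (\<lambda>v. (deriv \<kappa> (W x) *\<^sub>R gradient W x) \<bullet> v)) (at x)"
    if "x \<in> D" for x
    using Suc.prems(1) Suc.prems(2)[of 0] that assms(3) by (intro has_derivative_comp_gradient) auto
  have grad: "gradient (\<lambda>x. \<kappa> (W x)) x = deriv \<kappa> (W x) *\<^sub>R gradient W x" if "x \<in> D" for x
    by (rule gradient_eqI[OF der[OF that]])
  have "(deriv ^^ j) (deriv \<kappa>) differentiable (at s)" if "j < n" "s \<in> S" for j s
    using Suc.prems(2)[of "Suc j" s] that by (simp add: funpow_swap1)
  then have "lie_reg D f g c n (\<lambda>x. deriv \<kappa> (W x))"
    by (rule Suc.IH[OF lie_reg_SucD[OF Suc.prems(1)]])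
  then have "lie_reg D f g c n (\<lambda>x. deriv \<kappa> (W x) * Lie_f f W x)"
    using Suc.prems(1) by (intro lie_reg_mult assms(1)) auto
  moreover have "lie_reg D f g c n (Lie_f f (\<lambda>x. \<kappa> (W x))) \<longleftrightarrow>
      lie_reg D f g c n (\<lambda>x. deriv \<kappa> (W x) * Lie_f f W x)"
    by (intro lie_reg_cong assms(1)) (simp add: Lie_f_def grad)
  ultimately show ?case
    using Suc.prems(1) der
    by (auto simp: Lie_g_def grad differentiable_def scaleR_vector_matrix_assoc)
qed simp

lemma lie_reg_iterI:
  assumes "\<And>i x. i < n \<Longrightarrow> x \<in> D \<Longrightarrow> Lie_f_iter f i W differentiable (at x)"
    and "\<And>i x. i + c < n \<Longrightarrow> x \<in> D \<Longrightarrow> Lie_g g (Lie_f_iter f i W) x = 0"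
  shows "lie_reg D f g c n W"
  using assms
proof (induction n arbitrary: W)
  case (Suc n)
  have "lie_reg D f g c n (Lie_f f W)"
  proof (rule Suc.IH)
    show "Lie_f_iter f i (Lie_f f W) differentiable (at x)" if "i < n" "x \<in> D" for i x
      using Suc.prems(1)[of "Suc i" x] that by (simp add: funpow_swap1)
    show "Lie_g g (Lie_f_iter f i (Lie_f f W)) x = 0" if "i + c < n" "x \<in> D" for i x
      using Suc.prems(2)[of "Suc i" x] that by (simp add: funpow_swap1)
  qed
  then show ?case
    using Suc.prems(1)[of 0] Suc.prems(2)[of 0] by simp
qed simp

lemma lie_reg_zero:
  shows "lie_reg D f g c n (\<lambda>_. 0)"
proof (induction n)
  case (Suc n)
  have "gradient (\<lambda>_::real^'a. 0) x = 0" for x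
    by (rule gradient_eqI) simp
  then have "Lie_f f (\<lambda>_. 0) = (\<lambda>_. 0)" "Lie_g g (\<lambda>_. 0) = (\<lambda>_. 0)"
    by (auto simp: Lie_f_def Lie_g_def)
  with Suc show ?case by simp
qed simp

section \<open>The chain of a high order control barrier function\<close>

lemma hocbf_pos: "hocbf D f g h k a b \<alpha> \<Longrightarrow> 0 < k"
  by (simp add: hocbf_def)

lemma hocbf_Lie_f_iter_differentiable:
  "hocbf D f g h k a b \<alpha> \<Longrightarrow> i < k \<Longrightarrow> x \<in> D \<Longrightarrow> Lie_f_iter f i h differentiable (at x)"
  unfolding hocbf_def by blast

lemma hocbf_Lie_g_iter_eq_0:
  "hocbf D f g h k a b \<alpha> \<Longrightarrow> i < k - 1 \<Longrightarrow> x \<in> D \<Longrightarrow> Lie_g g (Lie_f_iter f i h) x = 0"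
  unfolding hocbf_def by blast

lemma hocbf_Lie_g_iter_neq_0:
  "hocbf D f g h k a b \<alpha> \<Longrightarrow> x \<in> D \<Longrightarrow> Lie_g g (Lie_f_iter f (k - 1) h) x \<noteq> 0"
  unfolding hocbf_def by blast

lemma hocbf_chainD:
  assumes "hocbf D f g h k a b \<alpha>" "i < k"
  shows "class_K (a (Suc i)) (b (Suc i)) (\<alpha> (Suc i))"
    and "\<forall>j<max 1 (k - Suc i). \<forall>s\<in>K_domain (a (Suc i)) (b (Suc i)).
      (deriv ^^ j) (\<alpha> (Suc i)) differentiable (at s)"
    and "\<forall>x\<in>D. psi f h \<alpha> i x \<in> K_domain (a (Suc i)) (b (Suc i))"
proof -
  have *: "\<forall>i\<in>{1..k}. class_K (a i) (b i) (\<alpha> i) \<and>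
      (\<forall>j<max 1 (k - i). \<forall>s\<in>K_domain (a i) (b i). (deriv ^^ j) (\<alpha> i) differentiable (at s)) \<and>
      (\<forall>x\<in>D. psi f h \<alpha> (i - 1) x \<in> K_domain (a i) (b i))"
    using assms(1) unfolding hocbf_def by (elim conjE)
  have "Suc i \<in> {1..k}" using assms(2) by simp
  from bspec[OF * this]
  show "class_K (a (Suc i)) (b (Suc i)) (\<alpha> (Suc i))"
    "\<forall>j<max 1 (k - Suc i). \<forall>s\<in>K_domain (a (Suc i)) (b (Suc i)).
      (deriv ^^ j) (\<alpha> (Suc i)) differentiable (at s)"
    "\<forall>x\<in>D. psi f h \<alpha> i x \<in> K_domain (a (Suc i)) (b (Suc i))"
    by simp_all
qed

lemma class_K_neg:
  assumes "class_K a b \<kappa>" "s \<in> K_domain a b" "s < 0"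
  shows "\<kappa> s < 0"
proof -
  have "0 \<in> K_domain a b"
  proof -
    have "0 < a" "0 < b" using assms(1) unfolding class_K_def by blast+
    moreover from this have "- a < 0" by (cases a) auto
    ultimately show ?thesis by (simp add: K_domain_def zero_ereal_def[symmetric])
  qed
  then have "\<kappa> s < \<kappa> 0"
    using assms unfolding class_K_def strict_mono_on_def by blast
  then show ?thesis using assms(1) unfolding class_K_def by simp
qed

text \<open>Passing to the next chain member costs one order through \<open>Lie_f\<close>. The
  composed term uses derivatives of \<open>\<alpha> (Suc i)\<close> up to order
  \<open>k - Suc i\<close>, which is the number that \<open>hocbf\<close> grants.\<close>

lemma lie_reg_psi:
  assumes "open D" "hocbf D f g h k a b \<alpha>" "i < k"
  shows "lie_reg D f g 1 (k - i) (psi f h \<alpha> i)"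
  using assms(3)
proof (induction i)
  case 0
  then show ?case
    using hocbf_Lie_f_iter_differentiable[OF assms(2)] hocbf_Lie_g_iter_eq_0[OF assms(2)]
    by (simp add: lie_reg_iterI)
next
  case (Suc i)
  have reg: "lie_reg D f g 1 (Suc (k - Suc i)) (psi f h \<alpha> i)"
    using Suc by (simp add: Suc_diff_Suc)
  have *: "psi f h \<alpha> i x \<in> K_domain (a (Suc i)) (b (Suc i))" if "x \<in> D" for x
    using hocbf_chainD(3)[OF assms(2), of i] Suc.prems that by simp
  have **: "(deriv ^^ j) (\<alpha> (Suc i)) differentiable (at s)"
    if "j < k - Suc i" "s \<in> K_domain (a (Suc i)) (b (Suc i))" for j s
    using hocbf_chainD(2)[OF assms(2), of i] Suc.prems that by (simp add: less_max_iff_disj)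
  have "lie_reg D f g 1 (k - Suc i) (\<lambda>x. \<alpha> (Suc i) (psi f h \<alpha> i x))"
    by (rule lie_reg_comp[OF assms(1) lie_reg_SucD[OF reg] * **])
  then show ?case
    using lie_reg_add[OF assms(1)] reg unfolding psi.simps lie_reg.simps by blast
qed

lemma psi_differentiable:
  assumes "open D" "hocbf D f g h k a b \<alpha>" "i < k" "x \<in> D"
  shows "psi f h \<alpha> i differentiable (at x)"
proof -
  have "k - i = Suc (k - Suc i)" using assms(3) by simp
  then show ?thesis
    using lie_reg_psi[OF assms(1-3)] assms(4) by (simp only: lie_reg.simps)
qed

text \<open>The difference is built from the compositions with the \<open>\<alpha> j\<close> and
  their Lie derivatives. These lag one order behind \<open>Lie_f_iter f i h\<close>, so no control
  term appears even at the last order; hence the index 0 instead of 1.\<close>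

lemma lie_reg_psi_diff:
  assumes "open D" "hocbf D f g h k a b \<alpha>" "i < k"
  shows "lie_reg D f g 0 (k - i) (\<lambda>x. psi f h \<alpha> i x - Lie_f_iter f i h x)"
  using assms(3)
proof (induction i)
  case 0
  show ?case by (simp add: lie_reg_zero)
next
  case (Suc i)
  have reg: "lie_reg D f g 0 (Suc (k - Suc i)) (\<lambda>x. psi f h \<alpha> i x - Lie_f_iter f i h x)"
    using Suc by (simp add: Suc_diff_Suc)
  have reg': "lie_reg D f g 0 (k - Suc i) (psi f h \<alpha> i)"
    using lie_reg_psi[OF assms(1,2), of i] Suc.prems lie_reg_Suc_SucD[of D f g 0 "k - Suc i"]
    by (simp add: Suc_diff_Suc)
  have diff: "psi f h \<alpha> i differentiable (at x)" "Lie_f_iter f i h differentiable (at x)"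
    if "x \<in> D" for x
  proof -
    show "psi f h \<alpha> i differentiable (at x)"
      using psi_differentiable[OF assms(1,2) _ that, of i] Suc.prems by simp
    show "Lie_f_iter f i h differentiable (at x)"
      using hocbf_Lie_f_iter_differentiable[OF assms(2)] Suc.prems that by simp
  qed
  have *: "psi f h \<alpha> i x \<in> K_domain (a (Suc i)) (b (Suc i))" if "x \<in> D" for x
    using hocbf_chainD(3)[OF assms(2), of i] Suc.prems that by simp
  have **: "(deriv ^^ j) (\<alpha> (Suc i)) differentiable (at s)"
    if "j < k - Suc i" "s \<in> K_domain (a (Suc i)) (b (Suc i))" for j s
    using hocbf_chainD(2)[OF assms(2), of i] Suc.prems that by (simp add: less_max_iff_disj)
  have "lie_reg D f g 0 (k - Suc i) (\<lambda>x. \<alpha> (Suc i) (psi f h \<alpha> i x))"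
    by (rule lie_reg_comp[OF assms(1) reg' * **])
  then have "lie_reg D f g 0 (k - Suc i)
      (\<lambda>x. Lie_f f (\<lambda>x. psi f h \<alpha> i x - Lie_f_iter f i h x) x + \<alpha> (Suc i) (psi f h \<alpha> i x))"
    using lie_reg_add[OF assms(1)] reg unfolding lie_reg.simps by blast
  moreover have "lie_reg D f g 0 (k - Suc i)
      (\<lambda>x. Lie_f f (\<lambda>x. psi f h \<alpha> i x - Lie_f_iter f i h x) x + \<alpha> (Suc i) (psi f h \<alpha> i x)) \<longleftrightarrow>
    lie_reg D f g 0 (k - Suc i) (\<lambda>x. psi f h \<alpha> (Suc i) x - Lie_f_iter f (Suc i) h x)"
    by (intro lie_reg_cong assms(1)) (simp add: Lie_f_def gradient_diff[OF diff] inner_diff_left)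
  ultimately show ?case by simp
qed

lemma Lie_g_psi_eq_0:
  assumes "open D" "hocbf D f g h k a b \<alpha>" "Suc i < k" "x \<in> D"
  shows "Lie_g g (psi f h \<alpha> i) x = 0"
proof -
  have "k - i = Suc (Suc (k - Suc (Suc i)))" using assms(3) by simp
  then show ?thesis
    using lie_reg_psi[OF assms(1,2), of i] assms(3,4) by (simp only: lie_reg.simps)
qed

text \<open>At \<open>i = k - 1\<close> the difference from the preceding lemmas has exactly one
  order left, and at that order its control term vanishes.\<close>

lemma Lie_g_psi_last:
  assumes "open D" "hocbf D f g h k a b \<alpha>" "x \<in> D"
  shows "Lie_g g (psi f h \<alpha> (k - 1)) x = Lie_g g (Lie_f_iter f (k - 1) h) x"
proof -
  have k: "k - 1 < k" using hocbf_pos[OF assms(2)] by simp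
  have "Lie_g g (\<lambda>x. psi f h \<alpha> (k - 1) x - Lie_f_iter f (k - 1) h x) x = 0"
  proof -
    have "k - (k - 1) = Suc 0" using k by simp
    then show ?thesis
      using lie_reg_psi_diff[OF assms(1,2) k] assms(3) by (simp only: lie_reg.simps)
  qed
  moreover have "gradient (\<lambda>x. psi f h \<alpha> (k - 1) x - Lie_f_iter f (k - 1) h x) x =
      gradient (psi f h \<alpha> (k - 1)) x - gradient (Lie_f_iter f (k - 1) h) x"
    by (intro gradient_diff psi_differentiable[OF assms(1,2) k assms(3)]
      hocbf_Lie_f_iter_differentiable[OF assms(2) k assms(3)])
  ultimately show ?thesis
    unfolding Lie_g_def by (simp only: vector_matrix_mult_diff_distrib right_minus_eq)
qed

text \<open>Reconciles the constraint, defined as a derivative of the chain, with its explicit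
  affine form in the control. The quadratic program is posed in the latter.\<close>

lemma C_s_eq:
  assumes "open D" "hocbf D f g h k a b \<alpha>" "x \<in> D"
  shows "C_s f g h \<alpha> k x u = Lie_f_iter f k h x + alpha_rest f h \<alpha> k x +
    Lie_g g (Lie_f_iter f (k - 1) h) x \<bullet> u"
  unfolding C_s_def system_deriv_def alpha_rest_def Lie_g_psi_last[OF assms] by simp

subsection \<open>Locally Lipschitz maps\<close>

text \<open>Removes the dummy time parameter that the abbreviation carries.\<close>

lemma locally_lipschitz_on_iff:
  "locally_lipschitz_on S F \<longleftrightarrow> (\<forall>x\<in>S. \<exists>u>0. \<exists>L. L-lipschitz_on (cball x u \<inter> S) F)"
proof
  assume *: "locally_lipschitz_on S F"
  show "\<forall>x\<in>S. \<exists>u>0. \<exists>L. L-lipschitz_on (cball x u \<inter> S) F"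
  proof
    fix x assume "x \<in> S"
    then obtain u L where "u > 0" "\<And>t. t \<in> cball 0 u \<inter> (UNIV::real set) \<Longrightarrow> L-lipschitz_on (cball x u \<inter> S) F"
      using * by (meson local_lipschitzE UNIV_I)
    moreover have "0 \<in> cball 0 u \<inter> (UNIV::real set)" using \<open>u > 0\<close> by simp
    ultimately show "\<exists>u>0. \<exists>L. L-lipschitz_on (cball x u \<inter> S) F" by blast
  qed
next
  assume "\<forall>x\<in>S. \<exists>u>0. \<exists>L. L-lipschitz_on (cball x u \<inter> S) F"
  then show "locally_lipschitz_on S F" unfolding local_lipschitz_def by blast
qed

text \<open>The cap \<open>r\<close> on the radius lets two maps share one ball.\<close>

lemma locally_lipschitz_onE:
  assumes "locally_lipschitz_on S F" "x \<in> S" "0 < r"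
  obtains u L where "0 < u" "u \<le> r" "L-lipschitz_on (cball x u \<inter> S) F"
proof -
  obtain u L where u: "u > 0" "L-lipschitz_on (cball x u \<inter> S) F"
    using bspec[OF assms(1)[unfolded locally_lipschitz_on_iff] assms(2)] by blast
  show ?thesis
    using u assms(3) by (intro that[of "min u r" L]) (auto elim!: lipschitz_on_subset)
qed

lemma locally_lipschitz_on_imp_continuous_on:
  "locally_lipschitz_on S F \<Longrightarrow> continuous_on S F"
  by (rule local_lipschitz_continuous_on[of "UNIV :: real set" _ _ 0]) auto

lemma locally_lipschitz_on_subset:
  "locally_lipschitz_on S F \<Longrightarrow> T \<subseteq> S \<Longrightarrow> locally_lipschitz_on T F"
  by (rule local_lipschitz_subset[of UNIV _ _ UNIV]) auto

lemma locally_lipschitz_on_cong: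
  assumes "\<And>x. x \<in> S \<Longrightarrow> F x = G x"
  shows "locally_lipschitz_on S F \<longleftrightarrow> locally_lipschitz_on S G"
proof -
  have "L-lipschitz_on (cball x u \<inter> S) F \<longleftrightarrow> L-lipschitz_on (cball x u \<inter> S) G" for L x u
    using assms by (intro lipschitz_on_cong) auto
  then show ?thesis by (simp add: locally_lipschitz_on_iff)
qed

lemma locally_lipschitz_on_compactE:
  assumes "locally_lipschitz_on S F" "compact K" "K \<subseteq> S"
  obtains L where "L-lipschitz_on K F"
proof -
  have "local_lipschitz {0::real} K (\<lambda>_. F)"
    using assms(1,3) local_lipschitz_subset by blast
  then show ?thesis
  proof (rule local_lipschitz_compact_implies_lipschitz[where f = "\<lambda>_. F"])
    fix L assume "\<And>t. t \<in> {0::real} \<Longrightarrow> L-lipschitz_on K F"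
    then show ?thesis using that by blast
  qed (use assms(2) in auto)
qed

lemma locally_lipschitz_on_compose:
  assumes F: "locally_lipschitz_on S F" and G: "locally_lipschitz_on T G" and "F ` S \<subseteq> T"
  shows "locally_lipschitz_on S (\<lambda>x. G (F x))"
  unfolding locally_lipschitz_on_iff
proof
  fix x assume x: "x \<in> S"
  then obtain v M where v: "v > 0" "M-lipschitz_on (cball (F x) v \<inter> T) G"
    using bspec[OF G[unfolded locally_lipschitz_on_iff], of "F x"] assms(3) by blast
  obtain u L where u: "u > 0" "L-lipschitz_on (cball x u \<inter> S) F"
    using bspec[OF F[unfolded locally_lipschitz_on_iff] x] by blast
  have L: "L \<ge> 0" using u(2) lipschitz_on_nonneg by blast
  \<comment> \<open>Small enough for \<open>F\<close> to map the ball into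
    \<open>cball (F x) v\<close>; \<open>L + 1\<close> avoids division by zero.\<close>
  define w where "w = min u (v / (L + 1))"
  have w: "w > 0" "w \<le> u" "w \<le> v / (L + 1)" using u v L by (auto simp: w_def)
  have "F y \<in> cball (F x) v \<inter> T" if y: "y \<in> cball x w \<inter> S" for y
  proof -
    have "dist (F x) (F y) \<le> L * dist x y"
      using w y x by (intro lipschitz_onD[OF u(2)]) auto
    also have "\<dots> \<le> (L + 1) * w"
      using y L by (intro mult_mono) auto
    also have "\<dots> \<le> v" using w(3) L by (simp add: field_simps)
    finally show ?thesis using y assms(3) by auto
  qed
  then have "F ` (cball x w \<inter> S) \<subseteq> cball (F x) v \<inter> T" by blast
  then have "(M * L)-lipschitz_on (cball x w \<inter> S) (\<lambda>x. G (F x))"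
    using v(2) u(2) w(2)
    by (intro lipschitz_on_compose2 lipschitz_on_subset[OF u(2)] lipschitz_on_subset[OF v(2)]) auto
  with w(1) show "\<exists>u>0. \<exists>L. L-lipschitz_on (cball x u \<inter> S) (\<lambda>x. G (F x))" by blast
qed

lemma (in bounded_linear) locally_lipschitz_on_linear:
  assumes "locally_lipschitz_on S F"
  shows "locally_lipschitz_on S (\<lambda>x. f (F x))"
proof -
  have "locally_lipschitz_on UNIV f"
    by (rule local_lipschitz_subset[OF local_lipschitzI]) auto
  then show ?thesis using locally_lipschitz_on_compose[OF assms] by blast
qed

lemma (in bounded_bilinear) locally_lipschitz_on_bilinear:
  assumes F: "locally_lipschitz_on S F" and G: "locally_lipschitz_on S G"
  shows "locally_lipschitz_on S (\<lambda>x. prod (F x) (G x))"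
  unfolding locally_lipschitz_on_iff
proof
  fix x assume x: "x \<in> S"
  obtain u L where u: "0 < u" "u \<le> 1" "L-lipschitz_on (cball x u \<inter> S) F"
    by (rule locally_lipschitz_onE[OF F x zero_less_one])
  obtain v M where v: "0 < v" "v \<le> u" "M-lipschitz_on (cball x v \<inter> S) G"
    by (rule locally_lipschitz_onE[OF G x u(1)])
  have LM: "L \<ge> 0" "M \<ge> 0" using u(3) v(3) lipschitz_on_nonneg by blast+
  obtain K where K: "K \<ge> 0" "\<And>a b. norm (prod a b) \<le> norm a * norm b * K"
    using nonneg_bounded by blast
  \<comment> \<open>On a ball of radius at most 1 a Lipschitz map moves by at most its constant,
    which gives the bounds \<open>B\<close> for \<open>F\<close> and \<open>C\<close> for
    \<open>G\<close>.\<close>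
  define B where "B = norm (F x) + L"
  define C where "C = norm (G x) + M"
  have F_le: "norm (F y) \<le> B" if y: "y \<in> cball x v \<inter> S" for y
  proof -
    have "norm (F y - F x) \<le> L * dist y x"
      using lipschitz_onD[OF u(3), of y x] y x u v by (auto simp: dist_norm)
    also have "\<dots> \<le> L * 1"
      using y u v LM by (intro mult_left_mono) (auto simp: dist_commute)
    finally show ?thesis using norm_triangle_sub[of "F y" "F x"] by (simp add: B_def)
  qed
  have G_le: "norm (G y) \<le> C" if y: "y \<in> cball x v \<inter> S" for y
  proof -
    have "norm (G y - G x) \<le> M * dist y x"
      using lipschitz_onD[OF v(3), of y x] y x u v by (auto simp: dist_norm)
    also have "\<dots> \<le> M * 1"
      using y u v LM by (intro mult_left_mono) (auto simp: dist_commute)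
    finally show ?thesis using norm_triangle_sub[of "G y" "G x"] by (simp add: C_def)
  qed
  have "(L * C * K + B * M * K)-lipschitz_on (cball x v \<inter> S) (\<lambda>x. prod (F x) (G x))"
  proof (rule lipschitz_onI)
    fix y z assume y: "y \<in> cball x v \<inter> S" and z: "z \<in> cball x v \<inter> S"
    have "prod (F y) (G y) - prod (F z) (G z) = prod (F y - F z) (G y) + prod (F z) (G y - G z)"
      by (simp add: diff_left diff_right)
    then have "dist (prod (F y) (G y)) (prod (F z) (G z)) \<le>
        norm (prod (F y - F z) (G y)) + norm (prod (F z) (G y - G z))"
      by (metis dist_norm norm_triangle_ineq)
    also have "\<dots> \<le> norm (F y - F z) * norm (G y) * K + norm (F z) * norm (G y - G z) * K"
      by (intro add_mono K)
    also have "\<dots> \<le> (L * dist y z) * C * K + B * (M * dist y z) * K"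
    proof (intro add_mono mult_right_mono mult_mono K(1) G_le F_le y z)
      show "norm (F y - F z) \<le> L * dist y z"
        using lipschitz_onD[OF u(3), of y z] y z v by (auto simp: dist_norm)
      show "norm (G y - G z) \<le> M * dist y z"
        using lipschitz_onD[OF v(3), of y z] y z by (auto simp: dist_norm)
    qed (use LM in \<open>auto simp: B_def\<close>)
    finally show "dist (prod (F y) (G y)) (prod (F z) (G z)) \<le> (L * C * K + B * M * K) * dist y z"
      by (simp add: algebra_simps)
  qed (use LM K in \<open>auto simp: B_def C_def\<close>)
  with v(1) show "\<exists>u>0. \<exists>L. L-lipschitz_on (cball x u \<inter> S) (\<lambda>x. prod (F x) (G x))" by blast
qed

lemma locally_lipschitz_on_add:
  fixes F G :: "'a::metric_space \<Rightarrow> 'b::real_normed_vector"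
  assumes "locally_lipschitz_on S F" "locally_lipschitz_on S G"
  shows "locally_lipschitz_on S (\<lambda>x. F x + G x)"
  unfolding locally_lipschitz_on_iff
proof
  fix x assume x: "x \<in> S"
  obtain u L where u: "0 < u" "L-lipschitz_on (cball x u \<inter> S) F"
    by (rule locally_lipschitz_onE[OF assms(1) x zero_less_one])
  obtain v M where v: "0 < v" "v \<le> u" "M-lipschitz_on (cball x v \<inter> S) G"
    by (rule locally_lipschitz_onE[OF assms(2) x u(1)])
  have "(L + M)-lipschitz_on (cball x v \<inter> S) (\<lambda>x. F x + G x)"
    using v by (intro lipschitz_on_add lipschitz_on_subset[OF u(2)]) auto
  with v(1) show "\<exists>u>0. \<exists>L. L-lipschitz_on (cball x u \<inter> S) (\<lambda>x. F x + G x)" by blast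
qed

lemma locally_lipschitz_on_const: "locally_lipschitz_on S (\<lambda>_. c)"
  unfolding locally_lipschitz_on_iff
  by (intro ballI exI[of _ 1] exI[of _ 0] conjI lipschitz_on_constant) simp

lemmas locally_lipschitz_on_minus =
  bounded_linear.locally_lipschitz_on_linear[OF bounded_linear_minus[OF bounded_linear_ident]]

lemma locally_lipschitz_on_diff:
  fixes F G :: "'a::metric_space \<Rightarrow> 'b::real_normed_vector"
  assumes "locally_lipschitz_on S F" "locally_lipschitz_on S G"
  shows "locally_lipschitz_on S (\<lambda>x. F x - G x)"
  using locally_lipschitz_on_add[OF assms(1) locally_lipschitz_on_minus[OF assms(2)]] by simp

lemma locally_lipschitz_on_sum:
  fixes F :: "'i \<Rightarrow> 'a::metric_space \<Rightarrow> 'b::real_normed_vector"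
  assumes "\<And>i. i \<in> I \<Longrightarrow> locally_lipschitz_on S (F i)"
  shows "locally_lipschitz_on S (\<lambda>x. \<Sum>i\<in>I. F i x)"
  using assms
  by (induction I rule: infinite_finite_induct)
    (auto intro: locally_lipschitz_on_add locally_lipschitz_on_const)

lemma locally_lipschitz_on_max_0: "locally_lipschitz_on UNIV (\<lambda>t::real. max 0 t)"
proof -
  have "1-lipschitz_on T (\<lambda>t::real. max 0 t)" for T
    by (rule lipschitz_onI) (auto simp: dist_real_def max_def)
  then show ?thesis
    unfolding locally_lipschitz_on_iff by (intro ballI exI[of _ 1] conjI) auto
qed

lemma locally_lipschitz_on_inverse: "locally_lipschitz_on {0<..} (\<lambda>t::real. inverse t)"
  unfolding locally_lipschitz_on_iff
proof
  fix x :: real assume "x \<in> {0<..}"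
  then have x: "x > 0" by simp
  \<comment> \<open>Points of this ball are at least \<open>x / 2\<close>, so a product of two of
    them is at least \<open>x * x / 4\<close>.\<close>
  have "(4 / (x * x))-lipschitz_on (cball x (x / 2) \<inter> {0<..}) inverse"
  proof (rule lipschitz_onI)
    fix y z assume yz: "y \<in> cball x (x / 2) \<inter> {0<..}" "z \<in> cball x (x / 2) \<inter> {0<..}"
    then have *: "x / 2 \<le> y" "x / 2 \<le> z"
      by (auto simp: dist_real_def abs_if field_simps split: if_splits)
    have "dist (inverse y) (inverse z) = \<bar>y - z\<bar> / (y * z)"
    proof -
      have "inverse y - inverse z = (z - y) / (y * z)"
        using yz by (simp add: field_simps)
      then show ?thesis using yz by (simp add: dist_real_def abs_mult abs_minus_commute)
    qed
    also have "\<dots> \<le> \<bar>y - z\<bar> / (x / 2 * (x / 2))"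
      using * x by (intro divide_left_mono mult_mono) auto
    finally show "dist (inverse y) (inverse z) \<le> 4 / (x * x) * dist y z"
      by (simp add: dist_real_def mult.commute)
  qed (use x in simp)
  with x show "\<exists>u>0. \<exists>L. L-lipschitz_on (cball x u \<inter> {0<..}) inverse"
    by (intro exI[of _ "x / 2"]) auto
qed

lemma bounded_bilinear_matrix_vector_mult:
  "bounded_bilinear ((*v) :: real^'n^'m \<Rightarrow> real^'n \<Rightarrow> real^'m)"
  unfolding bilinear_conv_bounded_bilinear[symmetric] bilinear_def
  by (auto intro!: linearI simp: algebra_simps scaleR_matrix_vector_assoc)

lemma bounded_bilinear_vector_matrix_mult:
  "bounded_bilinear ((v*) :: real^'m \<Rightarrow> real^'n^'m \<Rightarrow> real^'n)"
  unfolding bilinear_conv_bounded_bilinear[symmetric] bilinear_def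
  by (auto intro!: linearI simp: algebra_simps scaleR_vector_matrix_assoc vector_scaleR_matrix_ac)

lemma locally_lipschitz_on_vecI:
  fixes F :: "'a::metric_space \<Rightarrow> real^'n"
  assumes "\<And>i. locally_lipschitz_on S (\<lambda>x. F x $ i)"
  shows "locally_lipschitz_on S F"
proof -
  have "locally_lipschitz_on S (\<lambda>x. \<Sum>i\<in>UNIV. F x $ i *\<^sub>R axis i (1::real))"
    by (intro locally_lipschitz_on_sum locally_lipschitz_on_const assms
        bounded_bilinear.locally_lipschitz_on_bilinear[OF bounded_bilinear_scaleR])
  moreover have "(\<Sum>i\<in>UNIV. F x $ i *\<^sub>R axis i (1::real)) = F x" for x
    by (simp add: basis_expansion scalar_mult_eq_scaleR[symmetric])
  ultimately show ?thesis by simp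
qed

section \<open>Continuously differentiable functions\<close>

lemma continuous_on_gradient:
  assumes "Ck_on (Suc 0) S W"
  shows "continuous_on S (gradient W)"
proof -
  have "continuous_on S (\<lambda>x. \<chi> i. gradient W x $ i)"
    using assms by (intro continuous_on_vec_lambda) simp
  then show ?thesis by (simp add: vec_lambda_eta)
qed

text \<open>Mean value inequality on a closed ball, which is convex and on which the continuous
  gradient is bounded.\<close>

lemma Ck_on_imp_locally_lipschitz_on:
  assumes "open S" "Ck_on (Suc 0) S W"
  shows "locally_lipschitz_on S W"
  unfolding locally_lipschitz_on_iff
proof
  fix x assume "x \<in> S"
  then obtain u where u: "u > 0" "cball x u \<subseteq> S"
    using assms(1) open_contains_cball by blast
  have "compact (gradient W ` cball x u)"
    using continuous_on_gradient[OF assms(2)] u(2) continuous_on_subset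
    by (intro compact_continuous_image) auto
  then obtain B where B: "\<And>y. y \<in> cball x u \<Longrightarrow> norm (gradient W y) \<le> B"
    using compact_imp_bounded bounded_iff by (metis imageI)
  have diff: "\<forall>x\<in>S. W differentiable (at x)" using assms(2) by simp
  have B0: "0 \<le> B" using B[of x] u(1) norm_ge_zero order_trans by (metis centre_in_cball less_imp_le)
  have "B-lipschitz_on (cball x u \<inter> S) W"
  proof (rule lipschitz_onI)
    fix y z assume yz: "y \<in> cball x u \<inter> S" "z \<in> cball x u \<inter> S"
    have "norm (W y - W z) \<le> B * norm (y - z)"
    proof (rule differentiable_bound[where S = "cball x u"])
      fix w assume w: "w \<in> cball x u"
      show "(W has_derivative (\<lambda>v. gradient W w \<bullet> v)) (at w within cball x u)"
        using diff u(2) w by (blast intro: has_derivative_at_withinI[OF has_derivative_gradient])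
      have "norm (gradient W w \<bullet> v) \<le> B * norm v" for v
        using Cauchy_Schwarz_ineq2[of "gradient W w" v] mult_right_mono[OF B[OF w], of "norm v"]
        by simp
      then show "onorm (\<lambda>v. gradient W w \<bullet> v) \<le> B" by (intro onorm_bound B0)
    qed (use yz in simp_all)
    then show "dist (W y) (W z) \<le> B * dist y z" by (simp add: dist_norm)
  qed (rule B0)
  with u(1) show "\<exists>u>0. \<exists>L. L-lipschitz_on (cball x u \<inter> S) W" by blast
qed

lemma Ck_on_imp_gradient_locally_lipschitz_on:
  assumes "open S" "Ck_on (Suc (Suc 0)) S W"
  shows "locally_lipschitz_on S (gradient W)"
  using assms by (intro locally_lipschitz_on_vecI Ck_on_imp_locally_lipschitz_on) simp_all

subsection \<open>The pointwise quadratic program\<close>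

text \<open>Definiteness makes the kernel of \<open>R\<close> trivial. For the second claim, the
  form of the inverse at \<open>c\<close> equals the form of \<open>R\<close> at
  \<open>matrix_inv R *v c\<close>.\<close>

lemma positive_definite_matrix_inv:
  fixes R :: "real^'m^'m"
  assumes "\<And>v. v \<noteq> 0 \<Longrightarrow> v \<bullet> (R *v v) > 0"
  shows "R *v (matrix_inv R *v w) = w"
    and "c \<noteq> 0 \<Longrightarrow> c \<bullet> (matrix_inv R *v c) > 0"
proof -
  have "v = 0" if "R *v v = 0" for v
    using assms[of v] that by force
  then have "invertible R"
    using matrix_left_invertible_ker invertible_left_inverse by blast
  then have "R ** matrix_inv R = mat 1"
    by (simp add: matrix_inv_def invertible_def) (metis (mono_tags, lifting) someI_ex)
  then have *: "R *v (matrix_inv R *v w) = w" for w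
    by (simp add: matrix_vector_mul_assoc)
  then show "R *v (matrix_inv R *v w) = w" .
  assume "c \<noteq> 0"
  with *[of c] have "matrix_inv R *v c \<noteq> 0" by auto
  with assms[of "matrix_inv R *v c"] * show "c \<bullet> (matrix_inv R *v c) > 0"
    by (simp add: inner_commute)
qed

text \<open>Feasibility of \<open>w\<close>, stationarity of the Lagrangian and complementary slackness
  suffice for optimality; strict convexity gives the quadratic gap.\<close>

lemma quadratic_program_gap:
  fixes R :: "real^'m^'m"
  assumes "transpose R = R" and stat: "p + R *v w = \<mu> *\<^sub>R c" and "0 \<le> \<mu>"
    and slack: "\<mu> = 0 \<or> c \<bullet> w + d = 0" and feas: "0 \<le> c \<bullet> u + d"
  shows "p \<bullet> w + 1/2 * (w \<bullet> (R *v w)) + 1/2 * ((u - w) \<bullet> (R *v (u - w)))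
    \<le> p \<bullet> u + 1/2 * (u \<bullet> (R *v u))"
proof -
  have sym: "w \<bullet> (R *v u) = u \<bullet> (R *v w)"
    by (metis assms(1) dot_lmul_matrix inner_commute transpose_matrix_vector)
  have "0 \<le> \<mu> * (c \<bullet> (u - w))"
    using slack
  proof
    assume "c \<bullet> w + d = 0"
    then have "0 \<le> c \<bullet> (u - w)" using feas by (simp add: inner_diff_right)
    with \<open>0 \<le> \<mu>\<close> show ?thesis by simp
  qed simp
  also have "\<dots> = (p + R *v w) \<bullet> (u - w)" by (simp add: stat)
  finally show ?thesis
    using sym by (simp add: inner_add_left inner_diff_right inner_diff_left
        matrix_vector_mult_diff_distrib inner_commute[of "R *v w"] algebra_simps)
qed

subsection \<open>Integrals over time intervals\<close>

text \<open>Bridge between the almost-everywhere conditions in the definitions and the spike rules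
  of the gauge integral, which speak of negligible sets.\<close>

lemma AE_lebesgue_on_iff_negligible:
  assumes "S \<in> sets lebesgue"
  shows "(AE t in lebesgue_on S. P t) \<longleftrightarrow> (\<exists>N. negligible N \<and> (\<forall>t\<in>S - N. P t))"
proof -
  have "(AE t in lebesgue_on S. P t) \<longleftrightarrow> (AE t in lebesgue. t \<in> S \<longrightarrow> P t)"
    using assms by (intro AE_restrict_space_iff) simp
  also have "\<dots> \<longleftrightarrow> (\<exists>N. negligible N \<and> (\<forall>t\<in>S - N. P t))"
    unfolding eventually_ae_filter negligible_iff_null_sets by auto
  finally show ?thesis .
qed

lemma integral_diff_Icc:
  fixes w :: "real \<Rightarrow> 'a::banach"
  assumes "w integrable_on {0..T}" "0 \<le> r" "r \<le> s" "s \<le> T"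
  shows "integral {0..s} w - integral {0..r} w = integral {r..s} w"
proof -
  have "w integrable_on {0..s}"
    using integrable_on_subinterval[OF assms(1)] assms by auto
  from Henstock_Kurzweil_Integration.integral_combine[OF assms(2,3) this]
  show ?thesis by (simp add: algebra_simps)
qed

text \<open>The bound is required only at times no farther from \<open>t\<close> than
  \<open>s\<close> is, on either side; continuity at \<open>t\<close> yields just that.\<close>

lemma norm_integral_diff_le:
  fixes w :: "real \<Rightarrow> 'a::euclidean_space"
  assumes w: "w integrable_on {0..T}" and "s \<in> {0..T}" "t \<in> {0..T}"
    and le: "\<And>\<tau>. \<tau> \<in> {0..T} \<Longrightarrow> \<bar>\<tau> - t\<bar> \<le> \<bar>s - t\<bar> \<Longrightarrow> norm (w \<tau>) \<le> c"
  shows "norm (integral {0..s} w - integral {0..t} w) \<le> c * \<bar>s - t\<bar>"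
proof -
  have *: "norm (integral {0..b} w - integral {0..a} w) \<le> c * (b - a)"
    if "0 \<le> a" "a \<le> b" "b \<le> T" and le: "\<And>\<tau>. a \<le> \<tau> \<Longrightarrow> \<tau> \<le> b \<Longrightarrow> norm (w \<tau>) \<le> c" for a b
  proof -
    have "w integrable_on {a..b}"
      using integrable_on_subinterval[OF w] that by auto
    then have "norm (integral {a..b} w) \<le> integral {a..b} (\<lambda>_. c)"
      using le by (intro integral_norm_bound_integral) auto
    then show ?thesis
      using integral_diff_Icc[OF w that(1-3)] that by (simp add: mult.commute)
  qed
  show ?thesis
  proof (cases "t \<le> s")
    case True
    then show ?thesis using *[of t s] assms(2,3) le by simp
  next
    case False
    then show ?thesis using *[of s t] assms(2,3) le by (simp add: norm_minus_commute)
  qed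
qed

text \<open>If \<open>y t\<close> were negative, take the last time \<open>r\<close> before
  \<open>t\<close> with \<open>y r\<close> nonnegative. After \<open>r\<close> the rate
  \<open>w\<close> is nonnegative almost everywhere, so \<open>y\<close> cannot have dropped from
  \<open>r\<close> to \<open>t\<close>.\<close>

lemma integral_comparison_nonneg:
  fixes y w :: "real \<Rightarrow> real"
  assumes cont: "continuous_on {0..T} y" and w: "w integrable_on {0..T}"
    and y: "\<And>t. t \<in> {0..T} \<Longrightarrow> y t = y 0 + integral {0..t} w"
    and "0 \<le> y 0" and N: "negligible N"
    and neg: "\<And>t. t \<in> {0..T} - N \<Longrightarrow> y t < 0 \<Longrightarrow> 0 \<le> w t"
    and t: "t \<in> {0..T}"
  shows "0 \<le> y t"
proof (rule ccontr)
  assume "\<not> 0 \<le> y t"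
  let ?A = "{s\<in>{0..t}. 0 \<le> y s}"
  have cont': "continuous_on {0..t} y" using cont t by (auto intro: continuous_on_subset)
  then have "closed ?A"
    using continuous_closed_preimage[OF cont' closed_real_atLeastAtMost closed_atLeast[of 0]]
    by (simp add: vimage_def Int_def)
  moreover have "?A \<subseteq> {0..t}" by auto
  ultimately have "compact ?A" using compact_Icc compact_Int_closed
    by (metis (no_types, lifting) Int_absorb1)
  moreover have "0 \<in> ?A" using t assms(4) by simp
  ultimately obtain r where r: "r \<in> ?A" "\<And>s. s \<in> ?A \<Longrightarrow> s \<le> r"
    using compact_attains_sup[of ?A] by blast
  have "r < t" using r(1) \<open>\<not> 0 \<le> y t\<close> by (auto simp: le_less)
  have "0 \<le> integral {r..t} w"
  proof -
    \<comment> \<open>Zeroed on \<open>N\<close> and at \<open>r\<close>, where nothing is known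
      about the sign of the rate, so that nonnegativity holds at every point.\<close>
    define w' where "w' = (\<lambda>s. if s \<in> insert r N then 0 else w s)"
    have N': "negligible (insert r N)" using N by simp
    have "integral {r..t} w = integral {r..t} w'"
      by (rule integral_spike[OF N']) (auto simp: w'_def)
    moreover have "w' integrable_on {r..t}"
    proof (rule integrable_spike[OF _ N'])
      show "w integrable_on {r..t}"
        using integrable_on_subinterval[OF w, of r t] r(1) t by auto
    qed (auto simp: w'_def)
    moreover have "0 \<le> w' s" if s: "s \<in> {r..t}" for s
    proof (cases "s \<in> insert r N")
      case False
      then have "s > r" "s \<in> {0..T} - N" using s r(1) t by auto
      moreover then have "y s < 0" using r(2)[of s] s r(1) by force
      ultimately show ?thesis using neg by (simp add: w'_def)
    qed (simp add: w'_def)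
    ultimately show ?thesis using integral_nonneg[of w' "{r..t}"] by simp
  qed
  then have "y r \<le> y t"
    using integral_diff_Icc[OF w, of r t] r(1) t \<open>r < t\<close> y[of r] y[of t] by simp
  with r(1) \<open>\<not> 0 \<le> y t\<close> show False by simp
qed

text \<open>With the integrating factor \<open>exp (- (C * s))\<close> the integral of
  \<open>e\<close> becomes nonincreasing, and it starts at 0.\<close>

lemma gronwall_zero:
  fixes e :: "real \<Rightarrow> real"
  assumes cont: "continuous_on {0..T} e"
    and le: "\<And>t. t \<in> {0..T} \<Longrightarrow> e t \<le> C * integral {0..t} e"
    and nonneg: "\<And>t. t \<in> {0..T} \<Longrightarrow> 0 \<le> e t" and t: "t \<in> {0..T}" and "0 \<le> C"
  shows "e t = 0"
proof -
  define \<phi> where "\<phi> = (\<lambda>s. exp (- (C * s)) * integral {0..s} e)"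
  have der: "(\<phi> has_real_derivative exp (- (C * s)) * (e s - C * integral {0..s} e)) (at s within {0..T})"
    if "s \<in> {0..T}" for s
    unfolding \<phi>_def
    by (rule derivative_eq_intros integral_has_real_derivative[OF cont that] refl)+
      (simp add: algebra_simps)
  have "\<phi> t \<le> \<phi> 0"
  proof (rule DERIV_nonpos_imp_decreasing_open[of 0 t \<phi>])
    show "0 \<le> t" using t by simp
    show "continuous_on {0..t} \<phi>"
      using DERIV_continuous_on[OF der] t by (auto intro: continuous_on_subset)
    fix s assume s: "0 < s" "s < t"
    then have "(\<phi> has_real_derivative exp (- (C * s)) * (e s - C * integral {0..s} e)) (at s)"
      using der[of s] t at_within_Icc_at[of 0 s T] by auto
    moreover have "exp (- (C * s)) * (e s - C * integral {0..s} e) \<le> 0"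
      using le[of s] s t by (intro mult_nonneg_nonpos) auto
    ultimately show "\<exists>y. (\<phi> has_real_derivative y) (at s) \<and> y \<le> 0" by blast
  qed
  then have "integral {0..t} e \<le> 0"
    by (simp add: \<phi>_def mult_le_0_iff)
  then have "e t \<le> 0"
    using le[OF t] \<open>0 \<le> C\<close> by (meson mult_nonneg_nonpos order_trans)
  then show ?thesis using nonneg[OF t] by simp
qed

lemma bounded_measurable_integrable_on:
  fixes w :: "real \<Rightarrow> 'a::euclidean_space"
  assumes "w \<in> borel_measurable (lebesgue_on {0..T})" "\<And>t. t \<in> {0..T} \<Longrightarrow> norm (w t) \<le> B"
  shows "w absolutely_integrable_on {0..T}"
  by (rule measurable_bounded_by_integrable_imp_absolutely_integrable[of _ _ "\<lambda>_. B"])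
    (use assms in auto)

subsection \<open>Trajectories under bounded controls\<close>

text \<open>A finite horizon and a control bounded at every time, not just almost everywhere: an
  essentially bounded control enters after a change on a null set.\<close>

locale bounded_trajectory =
  fixes D :: "(real^'n) set" and f :: "real^'n \<Rightarrow> real^'n" and g :: "real^'n \<Rightarrow> real^'m^'n"
    and u :: "real \<Rightarrow> real^'m" and x :: "real \<Rightarrow> real^'n" and T B :: real
  assumes open_D: "open D"
    and cont_f: "continuous_on D f" and cont_g: "continuous_on D g"
    and T: "0 \<le> T"
    and meas: "u \<in> borel_measurable (lebesgue_on {0..T})"
    and bound: "\<And>t. t \<in> {0..T} \<Longrightarrow> norm (u t) \<le> B"
    and cont_x: "continuous_on {0..T} x"
    and x_in: "\<And>t. t \<in> {0..T} \<Longrightarrow> x t \<in> D"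
    and x_eq: "\<And>t. t \<in> {0..T} \<Longrightarrow> x t = x 0 + integral {0..t} (\<lambda>s. f (x s) + g (x s) *v u s)"
begin

lemma B_nonneg: "0 \<le> B"
  using order_trans[OF norm_ge_zero bound[of 0]] T by simp

lemma continuous_on_comp:
  "continuous_on D p \<Longrightarrow> continuous_on {0..T} (\<lambda>s. p (x s))"
  using cont_x x_in by (auto intro: continuous_on_compose2)

lemma bilinear_integrable:
  fixes prod :: "'a::euclidean_space \<Rightarrow> real^'m \<Rightarrow> 'c::euclidean_space"
  assumes "bounded_bilinear prod" and q: "continuous_on {0..T} q"
  shows "(\<lambda>s. prod (q s) (u s)) absolutely_integrable_on {0..T}"
    and "\<exists>M. \<forall>s\<in>{0..T}. norm (prod (q s) (u s)) \<le> M"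
proof -
  interpret bounded_bilinear prod by fact
  have "bounded (q ` {0..T})"
    using q by (intro compact_imp_bounded compact_continuous_image) auto
  then obtain A where A: "\<And>s. s \<in> {0..T} \<Longrightarrow> norm (q s) \<le> A"
    unfolding bounded_iff by blast
  obtain K where K: "0 \<le> K" "\<And>a b. norm (prod a b) \<le> norm a * norm b * K"
    using nonneg_bounded by blast
  have M: "norm (prod (q s) (u s)) \<le> A * B * K" if "s \<in> {0..T}" for s
  proof -
    have "0 \<le> A" using A[OF that] norm_ge_zero order_trans by blast
    then have "norm (q s) * norm (u s) * K \<le> A * B * K"
      using A[OF that] bound[OF that] K(1) by (intro mult_right_mono mult_mono) auto
    then show ?thesis using K(2) order_trans by blast
  qed
  then show "\<exists>M. \<forall>s\<in>{0..T}. norm (prod (q s) (u s)) \<le> M" by blast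
  have q_meas: "q \<in> borel_measurable (lebesgue_on {0..T})"
    using q by (intro continuous_imp_measurable_on_sets_lebesgue) auto
  have prod_cont: "continuous_on UNIV (\<lambda>z. prod (fst z) (snd z))"
    by (intro continuous_on continuous_intros)
  have "(\<lambda>s. prod (q s) (u s)) \<in> borel_measurable (lebesgue_on {0..T})"
    by (rule borel_measurable_continuous_Pair[OF q_meas meas prod_cont])
  from bounded_measurable_integrable_on[OF this M]
  show "(\<lambda>s. prod (q s) (u s)) absolutely_integrable_on {0..T}" by blast
qed

lemma affine_integrable:
  assumes "continuous_on D p" "continuous_on D q"
  shows "(\<lambda>s. p (x s) + q (x s) \<bullet> u s) integrable_on {0..T}"
proof -
  have "(\<lambda>s. q (x s) \<bullet> u s) integrable_on {0..T}"
    using bilinear_integrable(1)[OF bounded_bilinear_inner continuous_on_comp[OF assms(2)]]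
    by (simp add: absolutely_integrable_on_def)
  moreover have "(\<lambda>s. p (x s)) integrable_on {0..T}"
    using continuous_on_comp[OF assms(1)] by (rule integrable_continuous_real)
  ultimately show ?thesis by (intro integrable_add)
qed

lemma velocity_integrable: "(\<lambda>s. f (x s) + g (x s) *v u s) integrable_on {0..T}"
proof -
  have "(\<lambda>s. g (x s) *v u s) integrable_on {0..T}"
    using bilinear_integrable(1)[OF bounded_bilinear_matrix_vector_mult continuous_on_comp[OF cont_g]]
    by (simp add: absolutely_integrable_on_def)
  moreover have "(\<lambda>s. f (x s)) integrable_on {0..T}"
    using continuous_on_comp[OF cont_f] by (rule integrable_continuous_real)
  ultimately show ?thesis by (intro integrable_add)
qed

lemma velocity_bounded:
  obtains M where "0 \<le> M" "\<And>s. s \<in> {0..T} \<Longrightarrow> norm (f (x s) + g (x s) *v u s) \<le> M"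
proof -
  obtain M where M: "\<forall>s\<in>{0..T}. norm (g (x s) *v u s) \<le> M"
    using bilinear_integrable(2)[OF bounded_bilinear_matrix_vector_mult continuous_on_comp[OF cont_g]]
    by blast
  have "bounded ((\<lambda>s. f (x s)) ` {0..T})"
    using continuous_on_comp[OF cont_f] by (intro compact_imp_bounded compact_continuous_image) auto
  then obtain A where A: "\<And>s. s \<in> {0..T} \<Longrightarrow> norm (f (x s)) \<le> A"
    unfolding bounded_iff by blast
  have le: "norm (f (x s) + g (x s) *v u s) \<le> A + M" if "s \<in> {0..T}" for s
    using norm_triangle_mono[OF A[OF that]] M that by blast
  moreover have "0 \<le> A + M" using order_trans[OF norm_ge_zero le[of 0]] T by simp
  ultimately show ?thesis using that by blast
qed

text \<open>Neither \<open>W\<close> is assumed continuously differentiable nor \<open>x\<close> differentiable anywhere. Since \<open>u\<close>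
  enters linearly, freezing the gradient of \<open>W\<close> at \<open>x t\<close> shows that
  the difference of both sides has derivative 0 at every single time \<open>t\<close>.\<close>

lemma chain_rule:
  assumes diff: "\<And>z. z \<in> D \<Longrightarrow> W differentiable (at z)"
    and p: "continuous_on D (Lie_f f W)" and q: "continuous_on D (Lie_g g W)"
    and "t \<in> {0..T}"
  shows "W (x t) = W (x 0) + integral {0..t} (\<lambda>s. Lie_f f W (x s) + Lie_g g W (x s) \<bullet> u s)"
proof -
  let ?w = "\<lambda>s. Lie_f f W (x s) + Lie_g g W (x s) \<bullet> u s"
  let ?v = "\<lambda>s. f (x s) + g (x s) *v u s"
  define G where "G = (\<lambda>t. W (x t) - integral {0..t} ?w)"
  have w_int: "?w integrable_on {0..T}" by (rule affine_integrable[OF p q])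
  obtain M where M: "0 \<le> M" "\<And>s. s \<in> {0..T} \<Longrightarrow> norm (?v s) \<le> M"
    using velocity_bounded by blast
  have x_lip: "norm (x s - x t) \<le> M * \<bar>s - t\<bar>" if "s \<in> {0..T}" "t \<in> {0..T}" for s t
    using norm_integral_diff_le[OF velocity_integrable that M(2)] x_eq[OF that(1)] x_eq[OF that(2)]
    by (metis (no_types, lifting) add_diff_cancel_left)
  have "(G has_derivative (\<lambda>h. 0)) (at t within {0..T})" if t: "t \<in> {0..T}" for t
    unfolding has_derivative_within_alt
  proof (intro conjI allI impI)
    fix e :: real assume e: "0 < e"
    define n where "n = gradient W (x t)"
    \<comment> \<open>The error budget is split evenly: \<open>\<epsilon>1\<close> controls the
      remainder in the differentiability of \<open>W\<close>, magnified by the speed bound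
      \<open>M\<close>; \<open>\<epsilon>2\<close> controls the effect of freezing the gradient,
      magnified by \<open>1 + B\<close>.\<close>
    define \<epsilon>1 where "\<epsilon>1 = e / 2 / (M + 1)"
    define \<epsilon>2 where "\<epsilon>2 = e / 2 / (1 + B)"
    have eps: "0 < \<epsilon>1" "0 < \<epsilon>2" using e M(1) B_nonneg by (auto simp: \<epsilon>1_def \<epsilon>2_def)
    have "(W has_derivative (\<lambda>v. n \<bullet> v)) (at (x t))"
      unfolding n_def by (rule has_derivative_gradient[OF diff[OF x_in[OF t]]])
    then obtain d0 where d0: "0 < d0"
      "\<And>z. norm (z - x t) < d0 \<Longrightarrow> norm (W z - W (x t) - n \<bullet> (z - x t)) \<le> \<epsilon>1 * norm (z - x t)"
      using eps(1) unfolding has_derivative_within_alt by blast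
    obtain d1 where d1: "0 < d1"
      "\<And>s. s \<in> {0..T} \<Longrightarrow> dist s t < d1 \<Longrightarrow> dist (x s) (x t) < d0"
      using cont_x t d0(1) unfolding continuous_on_iff by blast
    let ?A = "\<lambda>s. n \<bullet> f (x s) - Lie_f f W (x s)"
    let ?B = "\<lambda>s. n v* g (x s) - Lie_g g W (x s)"
    have "continuous_on {0..T} ?A"
      by (intro continuous_intros continuous_on_comp cont_f p)
    moreover have "?A t = 0" by (simp add: n_def Lie_f_def)
    ultimately obtain d2 where d2: "0 < d2"
      "\<And>s. s \<in> {0..T} \<Longrightarrow> dist s t < d2 \<Longrightarrow> norm (?A s) < \<epsilon>2"
      using t eps(2) unfolding continuous_on_iff by (metis dist_0_norm dist_commute)
    have "continuous_on {0..T} ?B"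
      by (intro continuous_intros continuous_on_comp q
          bounded_bilinear.continuous_on[OF bounded_bilinear_vector_matrix_mult] cont_g)
    moreover have "?B t = 0" by (simp add: n_def Lie_g_def)
    ultimately obtain d3 where d3: "0 < d3"
      "\<And>s. s \<in> {0..T} \<Longrightarrow> dist s t < d3 \<Longrightarrow> norm (?B s) < \<epsilon>2"
      using t eps(2) unfolding continuous_on_iff by (metis dist_0_norm dist_commute)
    show "\<exists>d>0. \<forall>s\<in>{0..T}. norm (s - t) < d \<longrightarrow> norm (G s - G t - 0) \<le> e * norm (s - t)"
    proof (intro exI[of _ "min d1 (min d2 d3)"] conjI ballI impI)
      fix s assume s: "s \<in> {0..T}" "norm (s - t) < min d1 (min d2 d3)"
      have 1: "\<bar>W (x s) - W (x t) - n \<bullet> (x s - x t)\<bar> \<le> e / 2 * \<bar>s - t\<bar>"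
      proof -
        have "norm (x s - x t) < d0"
          using d1(2)[OF s(1)] s(2) by (simp add: dist_norm)
        then have "norm (W (x s) - W (x t) - n \<bullet> (x s - x t)) \<le> \<epsilon>1 * norm (x s - x t)"
          by (rule d0(2))
        also have "\<dots> \<le> \<epsilon>1 * ((M + 1) * \<bar>s - t\<bar>)"
          using x_lip[OF s(1) t] eps(1) by (intro mult_left_mono) (auto simp: algebra_simps)
        also have "\<dots> = e / 2 * \<bar>s - t\<bar>"
        proof -
          have "\<epsilon>1 * (M + 1) = e / 2" using M(1) by (simp add: \<epsilon>1_def field_simps)
          then show ?thesis by (metis mult.assoc)
        qed
        finally show ?thesis by simp
      qed
      let ?r = "\<lambda>\<tau>. n \<bullet> ?v \<tau> - ?w \<tau>"
      have nv: "(\<lambda>\<tau>. n \<bullet> ?v \<tau>) integrable_on {0..T}"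
        using integrable_linear[OF velocity_integrable bounded_linear_inner_right[of n]]
        by (simp add: o_def)
      have r_eq: "integral {0..b} ?r = n \<bullet> (x b - x 0) - integral {0..b} ?w" if b: "b \<in> {0..T}" for b
      proof -
        have *: "?v integrable_on {0..b}" "?w integrable_on {0..b}"
          "(\<lambda>\<tau>. n \<bullet> ?v \<tau>) integrable_on {0..b}"
          using b velocity_integrable w_int nv by (auto intro: integrable_on_subinterval)
        have "integral {0..b} (\<lambda>\<tau>. n \<bullet> ?v \<tau>) = n \<bullet> integral {0..b} ?v"
          using integral_linear[OF *(1) bounded_linear_inner_right[of n]] by (simp add: o_def)
        moreover have "integral {0..b} ?v = x b - x 0" using x_eq[OF b] by simp
        ultimately show ?thesis using integral_diff[OF *(3,2)] by simp
      qed
      have 2: "norm (integral {0..s} ?r - integral {0..t} ?r) \<le> e / 2 * \<bar>s - t\<bar>"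
      proof (rule norm_integral_diff_le[OF _ s(1) t])
        show "?r integrable_on {0..T}" by (rule integrable_diff[OF nv w_int])
        fix \<tau> assume \<tau>: "\<tau> \<in> {0..T}" "\<bar>\<tau> - t\<bar> \<le> \<bar>s - t\<bar>"
        then have "\<bar>\<tau> - t\<bar> < d2" "\<bar>\<tau> - t\<bar> < d3" using s(2) by auto
        then have AB: "norm (?A \<tau>) \<le> \<epsilon>2" "norm (?B \<tau>) \<le> \<epsilon>2"
          using d2(2)[OF \<tau>(1)] d3(2)[OF \<tau>(1)] by (auto simp: dist_norm less_imp_le)
        have "?r \<tau> = ?A \<tau> + ?B \<tau> \<bullet> u \<tau>"
          by (simp add: inner_add_right inner_diff_left dot_lmul_matrix)
        then have "norm (?r \<tau>) \<le> norm (?A \<tau>) + norm (?B \<tau>) * norm (u \<tau>)"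
          using Cauchy_Schwarz_ineq2[of "?B \<tau>" "u \<tau>"] by simp
        also have "\<dots> \<le> \<epsilon>2 + \<epsilon>2 * B"
          using AB bound[OF \<tau>(1)] eps(2) by (intro add_mono mult_mono) auto
        also have "\<dots> = e / 2"
        proof -
          have "\<epsilon>2 * (1 + B) = e / 2" using B_nonneg by (simp add: \<epsilon>2_def field_simps)
          then show ?thesis by (simp add: distrib_left)
        qed
        finally show "norm (?r \<tau>) \<le> e / 2" .
      qed
      have "G s - G t = (W (x s) - W (x t) - n \<bullet> (x s - x t))
          + (integral {0..s} ?r - integral {0..t} ?r)"
        unfolding r_eq[OF s(1)] r_eq[OF t] by (simp add: G_def inner_diff_right)
      then have "\<bar>G s - G t\<bar> \<le> e / 2 * \<bar>s - t\<bar> + e / 2 * \<bar>s - t\<bar>"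
        using 1 2 by (simp only: real_norm_def)
      then show "norm (G s - G t - 0) \<le> e * norm (s - t)"
        by simp
    qed (use d1 d2 d3 in auto)
  qed simp
  then obtain c where "\<And>t. t \<in> {0..T} \<Longrightarrow> G t = c"
    using has_derivative_zero_constant[of "{0..T}" G] by auto
  then have "G t = G 0" using assms(4) by auto
  then show ?thesis by (simp add: G_def)
qed

text \<open>Both curves lie in one compact part of \<open>D\<close>, on which \<open>f\<close> and
  \<open>g\<close> have global Lipschitz constants. With the control bounded, their distance
  satisfies the Gronwall inequality with zero initial value.\<close>

lemma unique:
  assumes y: "bounded_trajectory D f g u y T B" and "y 0 = x 0"
    and lf: "locally_lipschitz_on D f" and lg: "locally_lipschitz_on D g"
    and t: "t \<in> {0..T}"
  shows "y t = x t"
proof -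
  interpret y: bounded_trajectory D f g u y T B by fact
  define K where "K = x ` {0..T} \<union> y ` {0..T}"
  have K: "compact K" "K \<subseteq> D"
    using cont_x y.cont_x x_in y.x_in unfolding K_def
    by (auto intro!: compact_Un compact_continuous_image)
  obtain L1 where L1: "L1-lipschitz_on K f" by (rule locally_lipschitz_on_compactE[OF lf K])
  obtain L2 where L2: "L2-lipschitz_on K g" by (rule locally_lipschitz_on_compactE[OF lg K])
  have L: "0 \<le> L1" "0 \<le> L2" using L1 L2 lipschitz_on_nonneg by blast+
  obtain k where k: "0 \<le> k" "\<And>(A::real^'m^'n) v. norm (A *v v) \<le> norm A * norm v * k"
    using bounded_bilinear.nonneg_bounded[OF bounded_bilinear_matrix_vector_mult] by blast
  define C where "C = L1 + L2 * B * k"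
  define e where "e = (\<lambda>s. norm (x s - y s))"
  have C: "0 \<le> C" using L B_nonneg k by (simp add: C_def)
  have cont_e: "continuous_on {0..T} e"
    unfolding e_def by (intro continuous_intros cont_x y.cont_x)
  let ?v = "\<lambda>s. f (x s) + g (x s) *v u s" and ?w = "\<lambda>s. f (y s) + g (y s) *v u s"
  have "e t \<le> C * integral {0..t} e" if t: "t \<in> {0..T}" for t
  proof -
    have int: "?v integrable_on {0..t}" "?w integrable_on {0..t}"
      using t velocity_integrable y.velocity_integrable by (auto intro: integrable_on_subinterval)
    have "e t = norm (integral {0..t} ?v - integral {0..t} ?w)"
      unfolding e_def x_eq[OF t] y.x_eq[OF t] \<open>y 0 = x 0\<close> by simp
    also have "\<dots> = norm (integral {0..t} (\<lambda>s. ?v s - ?w s))"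
      using integral_diff[OF int] by simp
    also have "\<dots> \<le> integral {0..t} (\<lambda>s. C * e s)"
    proof (rule integral_norm_bound_integral)
      show "(\<lambda>s. ?v s - ?w s) integrable_on {0..t}" by (rule integrable_diff[OF int])
      show "(\<lambda>s. C * e s) integrable_on {0..t}"
        using cont_e t by (intro integrable_continuous_real continuous_intros)
          (auto intro: continuous_on_subset)
      fix s assume "s \<in> {0..t}"
      then have s: "s \<in> {0..T}" "x s \<in> K" "y s \<in> K" using t by (auto simp: K_def)
      have "?v s - ?w s = (f (x s) - f (y s)) + (g (x s) - g (y s)) *v u s"
        by (simp add: matrix_vector_mult_diff_rdistrib)
      then have "norm (?v s - ?w s) \<le> norm (f (x s) - f (y s)) + norm ((g (x s) - g (y s)) *v u s)"
        by (simp only: norm_triangle_ineq)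
      also have "\<dots> \<le> L1 * e s + L2 * e s * B * k"
      proof (rule add_mono)
        show "norm (f (x s) - f (y s)) \<le> L1 * e s"
          using lipschitz_onD[OF L1 s(2,3)] by (simp add: e_def dist_norm)
        have "norm (g (x s) - g (y s)) \<le> L2 * e s"
          using lipschitz_onD[OF L2 s(2,3)] by (simp add: e_def dist_norm)
        then have "norm (g (x s) - g (y s)) * norm (u s) * k \<le> L2 * e s * B * k"
          using bound[OF s(1)] k(1) L by (intro mult_right_mono mult_mono) (auto simp: e_def)
        then show "norm ((g (x s) - g (y s)) *v u s) \<le> L2 * e s * B * k"
          using k(2) order_trans by blast
      qed
      finally show "norm (?v s - ?w s) \<le> C * e s" by (simp add: C_def algebra_simps)
    qed
    finally show ?thesis by simp
  qed
  then have "e t = 0"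
    by (rule gronwall_zero[OF cont_e _ _ t C]) (auto simp: e_def)
  then show ?thesis by (simp add: e_def)
qed

end

subsection \<open>Admissible controls\<close>

text \<open>The part of \<open>admissible\<close> that does not mention the state; it is the
  condition on the control under which trajectories are unique.\<close>

definition ess_bounded_control :: "(real \<Rightarrow> real^'m) \<Rightarrow> bool" where
  "ess_bounded_control u \<longleftrightarrow> u \<in> borel_measurable (lebesgue_on {0..}) \<and>
     (\<forall>T>0. \<exists>B. AE t in lebesgue_on {0..T}. norm (u t) \<le> B)"

lemma ess_bounded_controlE:
  assumes "ess_bounded_control u" "0 \<le> T"
  obtains N u' B where "negligible N" "\<forall>t. t \<notin> N \<longrightarrow> u' t = u t"
    "u' \<in> borel_measurable (lebesgue_on {0..T})" "\<forall>t\<in>{0..T}. norm (u' t) \<le> B"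
proof -
  \<comment> \<open>The definition speaks of positive horizons only; \<open>T + 1\<close> also
    covers \<open>T = 0\<close>.\<close>
  have "T + 1 > 0" using assms(2) by simp
  then obtain B where B: "AE t in lebesgue_on {0..T+1}. norm (u t) \<le> B"
    using assms(1) unfolding ess_bounded_control_def by blast
  have "{0..T+1} \<in> sets lebesgue" by simp
  from iffD1[OF AE_lebesgue_on_iff_negligible[OF this] B]
  obtain N where N: "negligible N" "\<forall>t\<in>{0..T+1} - N. norm (u t) \<le> B"
    by (elim exE conjE)
  define u' where "u' = (\<lambda>t. if t \<in> N then 0 else u t)"
  have "u \<in> borel_measurable (lebesgue_on {0..T})"
    by (rule measurable_restrict_mono[OF conjunct1[OF assms(1)[unfolded ess_bounded_control_def]]]) auto
  moreover have "N \<inter> space (lebesgue_on {0..T}) \<in> sets (lebesgue_on {0..T})"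
    using negligible_imp_sets[OF N(1)] by (auto simp: sets_restrict_space)
  ultimately have "u' \<in> borel_measurable (lebesgue_on {0..T})"
    unfolding u'_def by (intro measurable_If_set) auto
  moreover have "norm (u' t) \<le> max 0 B" if "t \<in> {0..T}" for t
    using bspec[OF N(2), of t] that by (cases "t \<in> N") (auto simp: u'_def)
  ultimately show ?thesis
    by (intro that[of N u' "max 0 B"] N(1)) (auto simp: u'_def)
qed

section \<open>Time shifts and integrals of nonnegative functions\<close>

lemma measurable_shift:
  fixes u :: "real \<Rightarrow> real^'m"
  assumes "u \<in> borel_measurable (lebesgue_on {0..})" "0 \<le> T"
  shows "(\<lambda>t. u (T + t)) \<in> borel_measurable (lebesgue_on {0..})"
proof -
  \<comment> \<open>Extension by zero gives a measurable function on the whole line, where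
    translations are available.\<close>
  have "(\<lambda>t. indicat_real {0..} t *\<^sub>R u t) \<in> borel_measurable lebesgue"
    using assms(1) by (subst (asm) borel_measurable_restrict_space_iff) auto
  from borel_measurable_affine[OF this, of 1 T]
  have "(\<lambda>t. indicat_real {0..} (T + t) *\<^sub>R u (T + t)) \<in> borel_measurable lebesgue" by simp
  moreover have "(\<lambda>t::real. indicat_real {0..} t) \<in> borel_measurable lebesgue"
    by (intro borel_measurable_indicator) simp
  ultimately have "(\<lambda>t. indicat_real {0..} t *\<^sub>R (indicat_real {0..} (T + t) *\<^sub>R u (T + t)))
      \<in> borel_measurable lebesgue"
    by (rule borel_measurable_scaleR[rotated])
  also have "(\<lambda>t. indicat_real {0..} t *\<^sub>R (indicat_real {0..} (T + t) *\<^sub>R u (T + t))) =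
      (\<lambda>t. indicat_real {0..} t *\<^sub>R u (T + t))"
    using assms(2) by (auto simp: indicator_def)
  finally show ?thesis
    by (subst borel_measurable_restrict_space_iff) auto
qed

text \<open>A translate of a null set is null. With \<open>T = 0\<close> this also restricts a
  property to a smaller time set.\<close>

lemma AE_shift:
  assumes "AE t in lebesgue_on S. P t" "S \<in> sets lebesgue" "S' \<in> sets lebesgue"
    and "\<And>t. t \<in> S' \<Longrightarrow> T + t \<in> S"
  shows "AE t in lebesgue_on S'. P (T + t :: real)"
proof -
  from iffD1[OF AE_lebesgue_on_iff_negligible[OF assms(2)] assms(1)]
  obtain N where N: "negligible N" "\<forall>t\<in>S - N. P t"
    by (elim exE conjE)
  have "P (T + t)" if "t \<in> S' - (+) (- T) ` N" for t
  proof -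
    have "T + t \<notin> N" using that by (auto simp: image_iff)
    then show ?thesis using bspec[OF N(2), of "T + t"] assms(4)[of t] that by simp
  qed
  moreover have "negligible ((+) (- T) ` N)" by (rule negligible_translation[OF N(1)])
  ultimately show ?thesis
    by (intro iffD2[OF AE_lebesgue_on_iff_negligible[OF assms(3)]] exI conjI ballI)
qed

lemma ess_bounded_control_shift:
  assumes "ess_bounded_control u" "0 \<le> T"
  shows "ess_bounded_control (\<lambda>t. u (T + t))"
  unfolding ess_bounded_control_def
proof (intro conjI allI impI)
  show "(\<lambda>t. u (T + t)) \<in> borel_measurable (lebesgue_on {0..})"
    using measurable_shift assms unfolding ess_bounded_control_def by blast
  fix T' :: real assume "0 < T'"
  then have "T + T' > 0" using assms(2) by simp
  then obtain B where "AE t in lebesgue_on {0..T + T'}. norm (u t) \<le> B"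
    using assms(1) unfolding ess_bounded_control_def by blast
  then have "AE t in lebesgue_on {0..T'}. norm (u (T + t)) \<le> B"
    by (rule AE_shift) (use assms(2) in auto)
  then show "\<exists>B. AE t in lebesgue_on {0..T'}. norm (u (T + t)) \<le> B" by blast
qed

lemma nn_integral_shift:
  fixes F :: "real \<Rightarrow> ennreal"
  assumes "F \<in> borel_measurable (lebesgue_on {T..})"
  shows "(\<integral>\<^sup>+ t. F (T + t) \<partial>lebesgue_on {0..}) = (\<integral>\<^sup>+ t. F t \<partial>lebesgue_on {T..})"
proof -
  let ?G = "\<lambda>t. F t * indicator {T..} t"
  have G: "?G \<in> borel_measurable lebesgue"
    using assms by (subst (asm) borel_measurable_restrict_space_iff_ennreal) auto
  \<comment> \<open>Translation invariance, as the case of scaling factor 1 of the affine change of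
    variables.\<close>
  have leb: "lebesgue = distr lebesgue lebesgue (\<lambda>t. T + 1 * t)"
    using lebesgue_real_affine[of 1 T] by (simp add: density_1)
  have meas: "(\<lambda>t. T + 1 * t) \<in> lebesgue \<rightarrow>\<^sub>M lebesgue"
    using lebesgue_affine_measurable[of "\<lambda>_. 1" T] by simp
  have "(\<integral>\<^sup>+ t. F t \<partial>lebesgue_on {T..}) = (\<integral>\<^sup>+ t. ?G t \<partial>lebesgue)"
    by (subst nn_integral_restrict_space) auto
  also have "\<dots> = (\<integral>\<^sup>+ t. ?G t \<partial>distr lebesgue lebesgue (\<lambda>t. T + 1 * t))"
    using leb by metis
  also have "\<dots> = (\<integral>\<^sup>+ t. ?G (T + 1 * t) \<partial>lebesgue)"
    by (rule nn_integral_distr[OF meas]) (use G in simp)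
  also have "\<dots> = (\<integral>\<^sup>+ t. F (T + t) * indicator {0..} t \<partial>lebesgue)"
    by (intro nn_integral_cong) (auto simp: indicator_def)
  also have "\<dots> = (\<integral>\<^sup>+ t. F (T + t) \<partial>lebesgue_on {0..})"
    by (subst nn_integral_restrict_space) auto
  finally show ?thesis by simp
qed

lemma nn_integral_split:
  fixes F :: "real \<Rightarrow> ennreal"
  assumes "F \<in> borel_measurable (lebesgue_on {0..})" "0 \<le> T"
  shows "(\<integral>\<^sup>+ t. F t \<partial>lebesgue_on {0..}) =
    (\<integral>\<^sup>+ t. F t \<partial>lebesgue_on {0..T}) + (\<integral>\<^sup>+ t. F t \<partial>lebesgue_on {T..})"
proof -
  have meas: "(\<lambda>t. F t * indicator S t) \<in> borel_measurable lebesgue" if "S \<subseteq> {0..}" "S \<in> sets lebesgue" for S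
    using measurable_restrict_mono[OF assms(1) that(1)] that(2)
    by (subst (asm) borel_measurable_restrict_space_iff_ennreal) auto
  have "(\<integral>\<^sup>+ t. F t \<partial>lebesgue_on {0..}) = (\<integral>\<^sup>+ t. F t * indicator {0..} t \<partial>lebesgue)"
    by (subst nn_integral_restrict_space) auto
  \<comment> \<open>The half-open tail makes the two pieces disjoint; the endpoint is restored
    afterwards as a null set.\<close>
  also have "\<dots> = (\<integral>\<^sup>+ t. F t * indicator {0..T} t + F t * indicator {T<..} t \<partial>lebesgue)"
    using assms(2) by (intro nn_integral_cong) (auto simp: indicator_def)
  also have "\<dots> = (\<integral>\<^sup>+ t. F t * indicator {0..T} t \<partial>lebesgue) + (\<integral>\<^sup>+ t. F t * indicator {T<..} t \<partial>lebesgue)"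
    using assms(2) by (intro nn_integral_add meas) auto
  also have "(\<integral>\<^sup>+ t. F t * indicator {T<..} t \<partial>lebesgue) = (\<integral>\<^sup>+ t. F t * indicator {T..} t \<partial>lebesgue)"
  proof (rule nn_integral_cong_AE)
    have "AE t in lebesgue. t \<noteq> T"
      by (rule AE_I'[of "{T}"]) (auto simp: negligible_iff_null_sets[symmetric])
    then show "AE t in lebesgue. F t * indicator {T<..} t = F t * indicator {T..} t"
      by eventually_elim (auto simp: indicator_def)
  qed
  also have "(\<integral>\<^sup>+ t. F t * indicator {0..T} t \<partial>lebesgue) = (\<integral>\<^sup>+ t. F t \<partial>lebesgue_on {0..T})"
    by (subst nn_integral_restrict_space) auto
  also have "(\<integral>\<^sup>+ t. F t * indicator {T..} t \<partial>lebesgue) = (\<integral>\<^sup>+ t. F t \<partial>lebesgue_on {T..})"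
    by (subst nn_integral_restrict_space) auto
  finally show ?thesis .
qed

text \<open>Monotone convergence carries a bound from all finite horizons to the infinite
  one.\<close>

lemma nn_integral_atLeast_le:
  fixes F :: "real \<Rightarrow> ennreal"
  assumes F: "F \<in> borel_measurable (lebesgue_on {0..})"
    and le: "\<And>n. (\<integral>\<^sup>+ t. F t \<partial>lebesgue_on {0..real n}) \<le> c"
  shows "(\<integral>\<^sup>+ t. F t \<partial>lebesgue_on {0..}) \<le> c"
proof -
  have meas: "(\<lambda>t. F t * indicator {0..real n} t) \<in> borel_measurable lebesgue" for n
  proof -
    have "F \<in> borel_measurable (lebesgue_on {0..real n})"
      by (rule measurable_restrict_mono[OF F]) auto
    then show ?thesis by (subst (asm) borel_measurable_restrict_space_iff_ennreal) auto
  qed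
  have inc: "incseq (\<lambda>n t. F t * indicator {0..real n} t)"
    by (auto simp: incseq_def le_fun_def indicator_def)
  have "(\<integral>\<^sup>+ t. F t \<partial>lebesgue_on {0..}) = (\<integral>\<^sup>+ t. F t * indicator {0..} t \<partial>lebesgue)"
    by (subst nn_integral_restrict_space) auto
  also have "\<dots> = (\<integral>\<^sup>+ t. (SUP n. F t * indicator {0..real n} t) \<partial>lebesgue)"
  proof (rule nn_integral_cong)
    fix t :: real
    obtain n0 :: nat where n0: "t \<le> real n0" using real_arch_simple by blast
    have "(SUP n. F t * indicator {0..real n} t) = F t * indicator {0..} t"
    proof (rule antisym)
      show "(SUP n. F t * indicator {0..real n} t) \<le> F t * indicator {0..} t"
        by (rule SUP_least) (auto simp: indicator_def)
      show "F t * indicator {0..} t \<le> (SUP n. F t * indicator {0..real n} t)"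
        using n0 by (intro SUP_upper2[of n0]) (auto simp: indicator_def)
    qed
    then show "F t * indicator {0..} t = (SUP n. F t * indicator {0..real n} t)" by simp
  qed
  also have "\<dots> = (SUP n. \<integral>\<^sup>+ t. F t * indicator {0..real n} t \<partial>lebesgue)"
    by (rule nn_integral_monotone_convergence_SUP[OF inc meas])
  also have "\<dots> \<le> c"
  proof (rule SUP_least)
    fix n
    have "(\<integral>\<^sup>+ t. F t * indicator {0..real n} t \<partial>lebesgue) = (\<integral>\<^sup>+ t. F t \<partial>lebesgue_on {0..real n})"
      by (subst nn_integral_restrict_space) auto
    then show "(\<integral>\<^sup>+ t. F t * indicator {0..real n} t \<partial>lebesgue) \<le> c" using le by simp
  qed
  finally show ?thesis .
qed

lemma nn_integral_eq_integral_Icc: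
  fixes l :: "real \<Rightarrow> real"
  assumes "l absolutely_integrable_on {0..T}" "\<And>t. 0 \<le> l t"
  shows "(\<integral>\<^sup>+ t. ennreal (l t) \<partial>lebesgue_on {0..T}) = ennreal (integral {0..T} l)"
proof -
  have S: "{0..T} \<in> sets lebesgue" by simp
  have int: "integrable (lebesgue_on {0..T}) l"
    by (rule absolutely_integrable_imp_integrable[OF assms(1) S])
  show ?thesis
    using nn_integral_eq_integral[OF int] assms(2) lebesgue_integral_eq_integral[OF int S] by simp
qed

text \<open>After a change on a null set the function is nonnegative everywhere, hence absolutely
  integrable, and its gauge integral is a Lebesgue integral that vanishes. Applied later to the
  Hamiltonian along an optimal trajectory.\<close>

lemma integral_nonpos_imp_AE_eq_0:
  fixes w :: "real \<Rightarrow> real"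
  assumes w: "w integrable_on {0..T}" and "integral {0..T} w \<le> 0"
    and nonneg: "AE t in lebesgue_on {0..T}. 0 \<le> w t"
  shows "AE t in lebesgue_on {0..T}. w t = 0"
proof -
  have S: "{0..T} \<in> sets lebesgue" by simp
  from iffD1[OF AE_lebesgue_on_iff_negligible[OF S] nonneg]
  obtain N where N: "negligible N" "\<forall>t\<in>{0..T} - N. 0 \<le> w t" by (elim exE conjE)
  define w' where "w' = (\<lambda>t. if t \<in> N then 0 else w t)"
  have w': "w' integrable_on {0..T}"
    by (rule integrable_spike[OF w N(1)]) (auto simp: w'_def)
  have w'_nonneg: "0 \<le> w' t" if "t \<in> {0..T}" for t using N(2) that by (auto simp: w'_def)
  have "integral {0..T} w' = integral {0..T} w"
    by (rule integral_spike[OF N(1)]) (auto simp: w'_def)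
  then have "integral {0..T} w' = 0"
    using assms(2) integral_nonneg[OF w' w'_nonneg] by simp
  moreover have abs: "w' absolutely_integrable_on {0..T}"
    by (rule nonnegative_absolutely_integrable_1[OF w' w'_nonneg])
  have int: "integrable (lebesgue_on {0..T}) w'"
    by (rule absolutely_integrable_imp_integrable[OF abs S])
  ultimately have "integral\<^sup>L (lebesgue_on {0..T}) w' = 0"
    using lebesgue_integral_eq_integral[OF int S] by simp
  moreover have "AE t in lebesgue_on {0..T}. 0 \<le> w' t"
    by (rule AE_I2) (use w'_nonneg in simp)
  ultimately have "AE t in lebesgue_on {0..T}. w' t = 0"
    using integral_nonneg_eq_0_iff_AE[OF int] by blast
  from iffD1[OF AE_lebesgue_on_iff_negligible[OF S] this]
  obtain N' where N': "negligible N'" "\<forall>t\<in>{0..T} - N'. w' t = 0" by (elim exE conjE)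
  have "\<forall>t\<in>{0..T} - (N \<union> N'). w t = 0"
  proof
    fix t assume t: "t \<in> {0..T} - (N \<union> N')"
    then show "w t = 0" using bspec[OF N'(2), of t] by (simp add: w'_def)
  qed
  then show ?thesis
    using N(1) N'(1) by (intro iffD2[OF AE_lebesgue_on_iff_negligible[OF S]] exI conjI) auto
qed

section \<open>Classical solutions and controlled trajectories\<close>

lemma solution_on_continuous_on:
  assumes "solution_on D F I x"
  shows "continuous_on I x"
  using assms unfolding solution_on_def
  by (meson continuous_on_eq_continuous_within has_vector_derivative_continuous)

lemma solution_on_subset:
  assumes "solution_on D F I x" "I' \<subseteq> I"
  shows "solution_on D F I' x"
  using assms unfolding solution_on_def by (meson has_vector_derivative_within_subset subsetD)

lemma solution_on_has_integral:
  assumes "solution_on D F {0..t} x" "0 \<le> t"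
  shows "((\<lambda>s. F (x s)) has_integral (x t - x 0)) {0..t}"
  using assms unfolding solution_on_def by (intro fundamental_theorem_of_calculus) auto

locale control_system =
  fixes D :: "(real^'n) set" and f :: "real^'n \<Rightarrow> real^'n" and g :: "real^'n \<Rightarrow> real^'m^'n"
  assumes open_D: "open D"
    and lip_f: "locally_lipschitz_on UNIV f" and lip_g: "locally_lipschitz_on UNIV g"
begin

lemma lip_f_D: "locally_lipschitz_on D f" and lip_g_D: "locally_lipschitz_on D g"
  using lip_f lip_g locally_lipschitz_on_subset by blast+

lemma cont_f: "continuous_on D f" and cont_g: "continuous_on D g"
  using lip_f_D lip_g_D locally_lipschitz_on_imp_continuous_on by blast+

lemma trajectory_0: "trajectory D f g x0 u x \<Longrightarrow> x 0 = x0"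
  unfolding trajectory_def by force

lemma trajectory_in: "trajectory D f g x0 u x \<Longrightarrow> 0 \<le> t \<Longrightarrow> x t \<in> D"
  unfolding trajectory_def by blast

lemma trajectory_continuous:
  assumes "trajectory D f g x0 u x"
  shows "continuous_on {0..T} x"
proof (cases "0 \<le> T")
  case True
  let ?v = "\<lambda>s. f (x s) + g (x s) *v u s"
  have "?v integrable_on {0..T}"
    using assms True unfolding trajectory_def absolutely_integrable_on_def by blast
  then have "continuous_on {0..T} (\<lambda>t. x0 + integral {0..t} ?v)"
    by (intro continuous_intros indefinite_integral_continuous_1)
  moreover have "x0 + integral {0..t} ?v = x t" if "t \<in> {0..T}" for t
    using assms that unfolding trajectory_def by simp
  ultimately show ?thesis using continuous_on_eq by blast
qed simp

lemma trajectory_continuous_atLeast: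
  assumes "trajectory D f g x0 u x"
  shows "continuous_on {0..} x"
  unfolding continuous_on_eq_continuous_within
proof
  fix t :: real assume "t \<in> {0..}"
  then have "continuous (at t within {0..t + 1}) x"
    using trajectory_continuous[OF assms, of "t + 1"]
    by (simp add: continuous_on_eq_continuous_within)
  moreover have "at t within {0..t + 1} = at t within {0..}"
    by (rule at_within_nhd[of t "{..<t + 1}"]) auto
  ultimately show "continuous (at t within {0..}) x" by simp
qed

text \<open>The integral equation does not see the null set on which the control is altered, so the
  same curve serves the bounded representative.\<close>

lemma bounded_trajectoryI:
  assumes "trajectory D f g x0 u x" "negligible N" "\<forall>t. t \<notin> N \<longrightarrow> u' t = u t"
    and "u' \<in> borel_measurable (lebesgue_on {0..T})" "\<forall>t\<in>{0..T}. norm (u' t) \<le> B"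
    and "0 \<le> T"
  shows "bounded_trajectory D f g u' x T B"
proof
  show "x t = x 0 + integral {0..t} (\<lambda>s. f (x s) + g (x s) *v u' s)" if "t \<in> {0..T}" for t
  proof -
    have "integral {0..t} (\<lambda>s. f (x s) + g (x s) *v u' s) = integral {0..t} (\<lambda>s. f (x s) + g (x s) *v u s)"
      using assms(3) by (intro integral_spike[OF assms(2)]) auto
    then show ?thesis
      using assms(1) that trajectory_0[OF assms(1)] unfolding trajectory_def by simp
  qed
qed (use assms open_D cont_f cont_g trajectory_continuous[OF assms(1)] trajectory_in[OF assms(1)] in auto)

lemma trajectory_unique:
  assumes "ess_bounded_control u" "trajectory D f g x0 u x" "trajectory D f g x0 u y" "0 \<le> t"
  shows "y t = x t"
proof -
  obtain N u' B where u': "negligible N" "\<forall>t. t \<notin> N \<longrightarrow> u' t = u t"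
    "u' \<in> borel_measurable (lebesgue_on {0..t})" "\<forall>s\<in>{0..t}. norm (u' s) \<le> B"
    by (rule ess_bounded_controlE[OF assms(1,4)])
  interpret bounded_trajectory D f g u' x t B
    by (rule bounded_trajectoryI[OF assms(2) u' assms(4)])
  show ?thesis
    using unique[OF bounded_trajectoryI[OF assms(3) u' assms(4)] _ lip_f_D lip_g_D, of t]
      trajectory_0[OF assms(2)] trajectory_0[OF assms(3)] assms(4) by simp
qed

text \<open>Makes the choice in \<open>state\<close> harmless at nonnegative times, the only ones
  that \<open>admissible\<close> and \<open>J\<close> read.\<close>

lemma state_eq:
  assumes "ess_bounded_control u" "trajectory D f g x0 u x" "0 \<le> t"
  shows "state D f g x0 u t = x t"
proof -
  have "trajectory D f g x0 u (state D f g x0 u)"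
    unfolding state_def by (rule someI[of "trajectory D f g x0 u", OF assms(2)])
  from trajectory_unique[OF assms(1,2) this assms(3)] show ?thesis .
qed

lemma admissible_trajectory:
  assumes "admissible D f g K x0 u"
  shows "trajectory D f g x0 u (state D f g x0 u)"
proof -
  obtain x where x: "trajectory D f g x0 u x" using assms unfolding admissible_def by blast
  show ?thesis unfolding state_def by (rule someI[of "trajectory D f g x0 u", OF x])
qed

lemma admissible_ess_bounded:
  "admissible D f g K x0 u \<Longrightarrow> ess_bounded_control u"
  unfolding admissible_def ess_bounded_control_def by blast

lemma admissibleI:
  assumes "ess_bounded_control u" "trajectory D f g x0 u x"
    and "AE t in lebesgue_on {0..}. u t \<in> K (x t)"
  shows "admissible D f g K x0 u"
proof -
  have "AE t in lebesgue_on {0..}. u t \<in> K (state D f g x0 u t)"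
  proof (rule AE_mp[OF assms(3) AE_I2], rule impI)
    fix t :: real assume "t \<in> space (lebesgue_on {0..})" "u t \<in> K (x t)"
    then show "u t \<in> K (state D f g x0 u t)" using state_eq[OF assms(1,2)] by simp
  qed
  then show ?thesis using assms unfolding admissible_def ess_bounded_control_def by blast
qed

lemma J_eq:
  assumes "ess_bounded_control u" "trajectory D f g x0 u x"
  shows "J D f g Q R x0 u = (\<integral>\<^sup>+ t. ennreal (Q (x t) + 1/2 * (u t \<bullet> (R *v u t))) \<partial>lebesgue_on {0..})"
  unfolding J_def by (rule nn_integral_cong) (simp add: state_eq[OF assms])

lemma trajectory_shift:
  assumes x: "trajectory D f g x0 u x" and T: "0 \<le> T"
  shows "trajectory D f g (x T) (\<lambda>t. u (T + t)) (\<lambda>t. x (T + t))"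
  unfolding trajectory_def
proof (intro allI impI conjI)
  fix t :: real assume t: "0 \<le> t"
  let ?v = "\<lambda>s. f (x s) + g (x s) *v u s"
  have int: "?v absolutely_integrable_on {0..T + t}"
    using x t T unfolding trajectory_def by simp
  then have int': "?v absolutely_integrable_on {T..T + t}"
    using absolutely_integrable_on_subinterval[OF int, of T "T + t"] T t by auto
  have o: "(\<lambda>s. f (x (T + s)) + g (x (T + s)) *v u (T + s)) = ?v \<circ> (+) T"
    by (auto simp: o_def)
  show "x (T + t) \<in> D" using trajectory_in[OF x] t T by simp
  show "(\<lambda>s. f (x (T + s)) + g (x (T + s)) *v u (T + s)) absolutely_integrable_on {0..t}"
  proof -
    have "?v \<circ> (+) T integrable_on {0..t}" "(\<lambda>s. norm (?v s)) \<circ> (+) T integrable_on {0..t}"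
      using int' unfolding absolutely_integrable_on_def integrable_on_shift_Icc_real
      by (simp_all add: add.commute)
    then show ?thesis by (simp add: absolutely_integrable_on_def o_def)
  qed
  have "integral {0..t} (?v \<circ> (+) T) = integral {T..T + t} ?v"
    unfolding integral_shift_Icc_real by (simp add: add.commute)
  moreover have "integral {0..T + t} ?v - integral {0..T} ?v = integral {T..T + t} ?v"
    using int T t by (intro integral_diff_Icc) (auto simp: absolutely_integrable_on_def)
  moreover have "x (T + t) = x0 + integral {0..T + t} ?v" "x T = x0 + integral {0..T} ?v"
    using x t T unfolding trajectory_def by simp_all
  ultimately show "x (T + t) = x T + integral {0..t} (\<lambda>s. f (x (T + s)) + g (x (T + s)) *v u (T + s))"
    unfolding o by (simp add: algebra_simps)
qed

lemma running_cost_measurable: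
  fixes Q :: "real^'n \<Rightarrow> real" and R :: "real^'m^'m"
  assumes "ess_bounded_control u" "trajectory D f g x0 u x" "continuous_on UNIV Q"
  shows "(\<lambda>t. Q (x t) + 1/2 * (u t \<bullet> (R *v u t))) \<in> borel_measurable (lebesgue_on {0..})"
proof -
  have "continuous_on {0..} (\<lambda>t. Q (x t))"
    by (rule continuous_on_compose2[OF assms(3) trajectory_continuous_atLeast[OF assms(2)]]) auto
  then have Qx: "(\<lambda>t. Q (x t)) \<in> borel_measurable (lebesgue_on {0..})"
    by (rule continuous_imp_measurable_on_sets_lebesgue) simp
  have "continuous_on UNIV (\<lambda>v. v \<bullet> (R *v v))"
    by (intro continuous_intros bounded_linear.continuous_on[OF matrix_vector_mul_bounded_linear])
  then have "(\<lambda>t. u t \<bullet> (R *v u t)) \<in> borel_measurable (lebesgue_on {0..})"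
    by (rule borel_measurable_continuous_on[OF _ conjunct1[OF assms(1)[unfolded ess_bounded_control_def]]])
  from borel_measurable_times[OF borel_measurable_const[of "1/2"] this]
  show ?thesis by (rule borel_measurable_add[OF Qx])
qed

lemma running_cost_integrable:
  fixes Q :: "real^'n \<Rightarrow> real" and R :: "real^'m^'m"
  assumes u: "ess_bounded_control u" and x: "trajectory D f g x0 u x"
    and Q: "continuous_on UNIV Q" and T: "0 \<le> T"
  shows "(\<lambda>t. Q (x t) + 1/2 * (u t \<bullet> (R *v u t))) absolutely_integrable_on {0..T}"
proof -
  obtain N u' B where u': "negligible N" "\<forall>t. t \<notin> N \<longrightarrow> u' t = u t"
    "u' \<in> borel_measurable (lebesgue_on {0..T})" "\<forall>s\<in>{0..T}. norm (u' s) \<le> B"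
    by (rule ess_bounded_controlE[OF u T])
  have B: "0 \<le> B" using order_trans[OF norm_ge_zero bspec[OF u'(4), of 0]] T by simp
  obtain K where K: "0 \<le> K" "\<And>v. norm (R *v v) \<le> norm v * K"
    using bounded_linear.nonneg_bounded[OF matrix_vector_mul_bounded_linear[of R]] by blast
  have "continuous_on UNIV (\<lambda>v. v \<bullet> (R *v v))"
    by (intro continuous_intros bounded_linear.continuous_on[OF matrix_vector_mul_bounded_linear])
  then have m: "(\<lambda>t. u' t \<bullet> (R *v u' t)) \<in> borel_measurable (lebesgue_on {0..T})"
    using u'(3) by (rule borel_measurable_continuous_on)
  have "norm (u' t \<bullet> (R *v u' t)) \<le> B * (B * K)" if t: "t \<in> {0..T}" for t
  proof -
    have "norm (u' t \<bullet> (R *v u' t)) \<le> norm (u' t) * norm (R *v u' t)"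
      using Cauchy_Schwarz_ineq2 by simp
    also have "\<dots> \<le> norm (u' t) * (norm (u' t) * K)"
      using K(2) by (intro mult_left_mono) auto
    also have "\<dots> \<le> B * (B * K)"
      using bspec[OF u'(4) t] B K(1) by (intro mult_mono) auto
    finally show ?thesis .
  qed
  from bounded_measurable_integrable_on[OF m this]
  have "(\<lambda>t. u' t \<bullet> (R *v u' t)) absolutely_integrable_on {0..T}" by blast
  then have "(\<lambda>t. u t \<bullet> (R *v u t)) absolutely_integrable_on {0..T}"
    by (rule absolutely_integrable_spike[OF _ u'(1)]) (simp add: u'(2))
  then have "(\<lambda>t. (1/2) *\<^sub>R (u t \<bullet> (R *v u t))) absolutely_integrable_on {0..T}"
    by (simp add: absolutely_integrable_on_scaleR_iff del: real_scaleR_def)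
  moreover have "continuous_on {0..T} (\<lambda>t. Q (x t))"
    by (rule continuous_on_compose2[OF Q trajectory_continuous[OF x]]) auto
  then have "(\<lambda>t. Q (x t)) absolutely_integrable_on {0..T}"
    by (rule absolutely_integrable_continuous_real)
  ultimately show ?thesis using set_integral_add(1) by fastforce
qed

lemma trajectory_chain_rule:
  assumes u: "ess_bounded_control u" and x: "trajectory D f g x0 u x" and T: "0 \<le> T"
    and W: "\<And>z. z \<in> D \<Longrightarrow> W differentiable (at z)"
      "continuous_on D (Lie_f f W)" "continuous_on D (Lie_g g W)"
  shows "((\<lambda>s. Lie_f f W (x s) + Lie_g g W (x s) \<bullet> u s) has_integral (W (x T) - W x0)) {0..T}"
proof -
  obtain N u' B where u': "negligible N" "\<forall>t. t \<notin> N \<longrightarrow> u' t = u t"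
    "u' \<in> borel_measurable (lebesgue_on {0..T})" "\<forall>s\<in>{0..T}. norm (u' s) \<le> B"
    by (rule ess_bounded_controlE[OF u T])
  interpret bounded_trajectory D f g u' x T B
    by (rule bounded_trajectoryI[OF x u' T])
  have "((\<lambda>s. Lie_f f W (x s) + Lie_g g W (x s) \<bullet> u' s) has_integral (W (x T) - W x0)) {0..T}"
    using affine_integrable[OF W(2,3)] chain_rule[OF W, of T] T trajectory_0[OF x]
    by (simp add: has_integral_iff)
  then show ?thesis
    by (rule has_integral_spike[OF u'(1), rotated]) (simp add: u'(2))
qed

text \<open>Turns a feedback into an open-loop control. Along a solution the control is continuous
  in time, which gives measurability and boundedness on each finite horizon.\<close>

lemma closed_loop_trajectory:
  assumes \<phi>: "continuous_on D \<phi>" and x: "solution_on D (closed_loop f g \<phi>) {0..} x"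
  shows "trajectory D f g (x 0) (\<lambda>t. \<phi> (x t)) x" and "ess_bounded_control (\<lambda>t. \<phi> (x t))"
proof -
  have in_D: "x t \<in> D" if "0 \<le> t" for t using x that unfolding solution_on_def by simp
  have cont: "continuous_on {0..} x" by (rule solution_on_continuous_on[OF x])
  have cont_u: "continuous_on {0..} (\<lambda>t. \<phi> (x t))"
    using in_D by (intro continuous_on_compose2[OF \<phi> cont]) auto
  show "trajectory D f g (x 0) (\<lambda>t. \<phi> (x t)) x"
    unfolding trajectory_def
  proof (intro allI impI conjI)
    fix t :: real assume t: "0 \<le> t"
    show "x t \<in> D" using in_D t .
    have sub: "{0..t} \<subseteq> {0..}" by auto
    have "continuous_on {0..t} (\<lambda>s. f (x s) + g (x s) *v \<phi> (x s))"
    proof (intro continuous_intros bounded_bilinear.continuous_on[OF bounded_bilinear_matrix_vector_mult])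
      show "continuous_on {0..t} (\<lambda>s. f (x s))" "continuous_on {0..t} (\<lambda>s. g (x s))"
        using in_D by (auto intro!: continuous_on_compose2[OF cont_f continuous_on_subset[OF cont sub]]
            continuous_on_compose2[OF cont_g continuous_on_subset[OF cont sub]])
      show "continuous_on {0..t} (\<lambda>s. \<phi> (x s))" by (rule continuous_on_subset[OF cont_u sub])
    qed
    then show "(\<lambda>s. f (x s) + g (x s) *v \<phi> (x s)) absolutely_integrable_on {0..t}"
      by (rule absolutely_integrable_continuous_real)
    show "x t = x 0 + integral {0..t} (\<lambda>s. f (x s) + g (x s) *v \<phi> (x s))"
      using solution_on_has_integral[OF solution_on_subset[OF x sub] t]
      by (simp add: closed_loop_def has_integral_iff)
  qed
  show "ess_bounded_control (\<lambda>t. \<phi> (x t))"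
    unfolding ess_bounded_control_def
  proof (intro conjI allI impI)
    show "(\<lambda>t. \<phi> (x t)) \<in> borel_measurable (lebesgue_on {0..})"
      by (rule continuous_imp_measurable_on_sets_lebesgue[OF cont_u]) simp
    fix T :: real
    have "bounded ((\<lambda>t. \<phi> (x t)) ` {0..T})"
      by (intro compact_imp_bounded compact_continuous_image continuous_on_subset[OF cont_u]) auto
    then obtain B where "\<forall>t\<in>{0..T}. norm (\<phi> (x t)) \<le> B" unfolding bounded_iff by blast
    then show "\<exists>B. AE t in lebesgue_on {0..T}. norm (\<phi> (x t)) \<le> B"
      by (intro exI[of _ B] AE_I2) simp
  qed
qed

end

subsection \<open>Global existence for Lipschitz vector fields\<close>

lemma integral_has_vector_derivative_atLeast:
  fixes w :: "real \<Rightarrow> 'a::euclidean_space"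
  assumes "continuous_on {0..} w" "0 \<le> t"
  shows "((\<lambda>t. integral {0..t} w) has_vector_derivative w t) (at t within {0..})"
proof -
  have "continuous_on {0..t + 1} w" by (rule continuous_on_subset[OF assms(1)]) auto
  then have "((\<lambda>t. integral {0..t} w) has_vector_derivative w t) (at t within {0..t + 1})"
    using assms(2) by (intro integral_has_vector_derivative) auto
  moreover have "at t within {0..t + 1} = at t within {0..}"
    by (rule at_within_nhd[of t "{..<t + 1}"]) auto
  ultimately show ?thesis by simp
qed

text \<open>Picard iteration contracts in the norm weighted by \<open>exp (- c t)\<close> with \<open>c\<close> above the Lipschitz
  constant, hence the solution is obtained on the whole half line at once.\<close>

lemma picard_global:
  fixes F :: "'a::euclidean_space \<Rightarrow> 'a"
  assumes L: "L-lipschitz_on UNIV F" and M: "\<And>z. norm (F z) \<le> M"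
  obtains x where "x 0 = x0" "\<And>t. 0 \<le> t \<Longrightarrow> (x has_vector_derivative F (x t)) (at t within {0..})"
proof -
  \<comment> \<open>Chosen so that the contraction factor \<open>L / c\<close> is at most 1/2, also
    for \<open>L = 0\<close>.\<close>
  define c where "c = 2 * (L + 1)"
  have L0: "0 \<le> L" by (rule lipschitz_on_nonneg[OF L])
  have c: "0 < c" "L / c \<le> 1/2" using L0 by (auto simp: c_def field_simps)
  have cont_F: "continuous_on UNIV F" by (rule lipschitz_on_continuous_on[OF L])
  have M0: "0 \<le> M" using order_trans[OF norm_ge_zero M] .
  \<comment> \<open>The unknown \<open>y\<close> stands for the solution times
    \<open>exp (- (c * t))\<close>. A bounded field allows at most linear growth, so
    \<open>y\<close> lies in the complete space of bounded continuous functions;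
    \<open>max 0 t\<close> extends it by a constant to negative times.\<close>
  define w where "w y = (\<lambda>s. F (exp (c * s) *\<^sub>R y s))" for y :: "real \<Rightarrow> 'a"
  define P where "P y = (\<lambda>t. exp (- (c * max 0 t)) *\<^sub>R (x0 + integral {0..max 0 t} (w y)))"
    for y :: "real \<Rightarrow> 'a"
  have w_cont: "continuous_on S (w (apply_bcontfun y))" for y S
    unfolding w_def by (intro continuous_on_compose2[OF cont_F] continuous_intros) auto
  have w_int: "w (apply_bcontfun y) integrable_on {a..b}" for y a b
    by (rule integrable_continuous_real[OF w_cont])
  have P_bcontfun: "P (apply_bcontfun y) \<in> bcontfun" for y
  proof (rule bcontfun_normI)
    have "continuous_on {0..} (\<lambda>t. integral {0..t} (w (apply_bcontfun y)))"
      unfolding continuous_on_eq_continuous_within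
      by (auto intro: has_vector_derivative_continuous integral_has_vector_derivative_atLeast[OF w_cont])
    then have "continuous_on UNIV (\<lambda>t. integral {0..max 0 t} (w (apply_bcontfun y)))"
      by (rule continuous_on_compose2) (auto intro!: continuous_intros)
    then show "continuous_on UNIV (P (apply_bcontfun y))"
      unfolding P_def by (intro continuous_intros)
    fix t :: real
    define s where "s = max 0 t"
    have s: "0 \<le> s" by (simp add: s_def)
    have "norm (integral {0..s} (w (apply_bcontfun y))) \<le> integral {0..s} (\<lambda>_. M)"
      by (rule integral_norm_bound_integral[OF w_int]) (auto simp: w_def M)
    then have "norm (x0 + integral {0..s} (w (apply_bcontfun y))) \<le> norm x0 + M * s"
      using s by (intro order_trans[OF norm_triangle_ineq]) (simp add: mult.commute)
    then have "norm (P (apply_bcontfun y) t) \<le> exp (- (c * s)) * (norm x0 + M * s)"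
      unfolding P_def s_def[symmetric] by simp
    also have "\<dots> = exp (- (c * s)) * norm x0 + M * (s * exp (- (c * s)))"
      by (simp add: algebra_simps)
    also have "\<dots> \<le> 1 * norm x0 + M * (1 / c)"
    proof (intro add_mono mult_right_mono mult_left_mono)
      show "exp (- (c * s)) \<le> 1" using c s by simp
      \<comment> \<open>The exponential weight beats the linear growth uniformly in
        \<open>s\<close>.\<close>
      have "c * s \<le> exp (c * s)" using exp_ge_add_one_self[of "c * s"] by linarith
      then show "s * exp (- (c * s)) \<le> 1 / c" using c by (simp add: exp_minus field_simps)
    qed (use M0 s in auto)
    finally show "norm (P (apply_bcontfun y) t) \<le> norm x0 + M / c" by simp
  qed
  define \<Phi> where "\<Phi> y = Bcontfun (P (apply_bcontfun y))" for y
  have \<Phi>: "apply_bcontfun (\<Phi> y) = P (apply_bcontfun y)" for y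
    unfolding \<Phi>_def by (rule Bcontfun_inverse[OF P_bcontfun])
  have "dist (\<Phi> y) (\<Phi> z) \<le> 1/2 * dist y z" for y z
  proof (rule dist_bound)
    fix t :: real
    define s where "s = max 0 t"
    have s: "0 \<le> s" by (simp add: s_def)
    let ?w = "\<lambda>\<tau>. w (apply_bcontfun y) \<tau> - w (apply_bcontfun z) \<tau>"
    have "norm (integral {0..s} ?w) \<le> integral {0..s} (\<lambda>\<tau>. L * dist y z * exp (c * \<tau>))"
    proof (rule integral_norm_bound_integral)
      show "?w integrable_on {0..s}" by (intro integrable_diff w_int)
      show "(\<lambda>\<tau>. L * dist y z * exp (c * \<tau>)) integrable_on {0..s}"
        by (intro integrable_continuous_real continuous_intros)
      fix \<tau>
      have "norm (?w \<tau>) \<le> L * dist (exp (c * \<tau>) *\<^sub>R y \<tau>) (exp (c * \<tau>) *\<^sub>R z \<tau>)"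
        unfolding w_def using lipschitz_onD[OF L UNIV_I UNIV_I] by (metis dist_norm)
      also have "\<dots> = L * (exp (c * \<tau>) * dist (y \<tau>) (z \<tau>))"
        by (simp add: dist_norm scaleR_diff_right[symmetric])
      also have "\<dots> \<le> L * (exp (c * \<tau>) * dist y z)"
        by (intro mult_left_mono dist_bounded L0) simp
      finally show "norm (?w \<tau>) \<le> L * dist y z * exp (c * \<tau>)" by (simp add: mult_ac)
    qed
    also have "\<dots> = L * dist y z * ((exp (c * s) - 1) / c)"
    proof -
      have "((\<lambda>\<tau>. exp (c * \<tau>)) has_integral (exp (c * s) / c - exp (c * 0) / c)) {0..s}"
        using c s by (intro fundamental_theorem_of_calculus)
          (auto intro!: derivative_eq_intros simp: has_real_derivative_iff_has_vector_derivative[symmetric])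
      then show ?thesis
        by (simp add: integral_unique diff_divide_distrib)
    qed
    finally have le: "norm (integral {0..s} ?w) \<le> L * dist y z * ((exp (c * s) - 1) / c)" .
    have "dist (\<Phi> y t) (\<Phi> z t) = exp (- (c * s)) * norm (integral {0..s} ?w)"
      unfolding \<Phi> P_def s_def[symmetric] dist_norm scaleR_diff_right[symmetric]
      by (simp add: integral_diff[OF w_int w_int])
    also have "\<dots> \<le> exp (- (c * s)) * (L * dist y z * ((exp (c * s) - 1) / c))"
      using le by (intro mult_left_mono) auto
    also have "\<dots> = L / c * dist y z * (1 - exp (- (c * s)))"
      using c(1) by (simp add: exp_minus field_simps)
    also have "\<dots> \<le> L / c * dist y z * 1"
      using L0 c(1) by (intro mult_left_mono) auto
    also have "\<dots> \<le> 1/2 * dist y z"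
      using c(2) by (intro order_trans[OF _ mult_right_mono[OF c(2)]]) auto
    finally show "dist (\<Phi> y t) (\<Phi> z t) \<le> 1/2 * dist y z" .
  qed
  then obtain y where y: "\<Phi> y = y"
    using banach_fix_type[of "1/2" \<Phi>] by auto
  define x where "x = (\<lambda>t. x0 + integral {0..t} (w (apply_bcontfun y)))"
  have x_eq: "x t = exp (c * t) *\<^sub>R y t" if "0 \<le> t" for t
  proof -
    have "y t = exp (- (c * t)) *\<^sub>R x t"
      using fun_cong[OF \<Phi>[of y], of t] that unfolding y by (simp add: P_def x_def)
    then show ?thesis by (simp add: exp_minus)
  qed
  show ?thesis
  proof (rule that)
    show "x 0 = x0" by (simp add: x_def)
    fix t :: real assume t: "0 \<le> t"
    have "(x has_vector_derivative w (apply_bcontfun y) t) (at t within {0..})"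
      unfolding x_def
      using has_vector_derivative_add[OF has_vector_derivative_const
          integral_has_vector_derivative_atLeast[OF w_cont t]] by simp
    then show "(x has_vector_derivative F (x t)) (at t within {0..})"
      using x_eq[OF t] by (simp add: w_def)
  qed
qed

subsection \<open>Lyapunov's direct method\<close>

text \<open>The origin is not an isolated point, so the sign off the origin passes to the limit. It
  supplies the sign of the running cost at 0, which is not assumed.\<close>

lemma continuous_nonneg_at_0:
  fixes q :: "real^'n \<Rightarrow> real"
  assumes "open D" "0 \<in> D" "continuous_on D q" "\<And>z. z \<in> D \<Longrightarrow> z \<noteq> 0 \<Longrightarrow> 0 < q z"
  shows "0 \<le> q 0"
proof (rule ccontr)
  assume "\<not> 0 \<le> q 0"
  then obtain d where d: "0 < d" "\<And>z. z \<in> D \<Longrightarrow> dist z 0 < d \<Longrightarrow> dist (q z) (q 0) < - q 0"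
    using assms(2,3) unfolding continuous_on_iff by (metis neg_0_less_iff_less not_le)
  obtain e where e: "0 < e" "ball 0 e \<subseteq> D" using assms(1,2) open_contains_ball by blast
  define z :: "real^'n" where "z = (min d e / 2) *\<^sub>R axis undefined 1"
  have "norm z = min d e / 2" using d(1) e(1) by (simp add: z_def)
  then have "z \<in> D" "dist z 0 < d" "z \<noteq> 0" using d(1) e by auto
  with d(2)[of z] assms(4)[of z] show False by (auto simp: dist_real_def)
qed

locale lyapunov_function =
  fixes D :: "(real^'n) set" and F :: "real^'n \<Rightarrow> real^'n" and V q :: "real^'n \<Rightarrow> real"
  assumes open_D: "open D" and zero_in: "0 \<in> D"
    and F_lip: "locally_lipschitz_on D F"
    and F_0: "F 0 = 0" and V_0: "V 0 = 0"
    and V_pos: "\<And>z. z \<in> D \<Longrightarrow> z \<noteq> 0 \<Longrightarrow> 0 < V z"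
    and V_diff: "\<And>z. z \<in> D \<Longrightarrow> V differentiable (at z)"
    and q_cont: "continuous_on D q" and q_pos: "\<And>z. z \<in> D \<Longrightarrow> z \<noteq> 0 \<Longrightarrow> 0 < q z"
    and decrease: "\<And>z. z \<in> D \<Longrightarrow> gradient V z \<bullet> F z \<le> - q z"
begin

lemma V_cont: "continuous_on D V"
  using V_diff by (meson continuous_at_imp_continuous_on differentiable_imp_continuous_within)

lemma V_nonneg: "z \<in> D \<Longrightarrow> 0 \<le> V z"
  using V_pos[of z] V_0 by (cases "z = 0") auto

lemma q_nonneg: "z \<in> D \<Longrightarrow> 0 \<le> q z"
  using continuous_nonneg_at_0[OF open_D zero_in q_cont q_pos] q_pos[of z] by (cases "z = 0") auto

text \<open>\<open>V\<close> along the solution plus \<open>c * t\<close> is nonincreasing.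
  Stability takes \<open>c = 0\<close>; attraction takes for \<open>c\<close> the minimum of
  \<open>q\<close> on an annulus.\<close>

lemma V_decrease:
  assumes x: "solution_on D F I x" and "{a..b} \<subseteq> I" "a \<le> b"
    and c: "\<And>t. t \<in> {a..b} \<Longrightarrow> c \<le> q (x t)"
  shows "V (x b) + c * (b - a) \<le> V (x a)"
proof -
  have x': "solution_on D F {a..b} x" by (rule solution_on_subset[OF x assms(2)])
  define \<phi> where "\<phi> = (\<lambda>t. V (x t) + c * t)"
  have der: "(\<phi> has_real_derivative (gradient V (x t) \<bullet> F (x t) + c)) (at t within {a..b})"
    if t: "t \<in> {a..b}" for t
  proof -
    have "(x has_derivative (\<lambda>h. h *\<^sub>R F (x t))) (at t within {a..b})" "x t \<in> D"
      using x' t unfolding solution_on_def has_vector_derivative_def by auto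
    from has_derivative_compose[OF this(1) has_derivative_gradient[OF V_diff[OF this(2)]]]
    have "((\<lambda>t. V (x t)) has_real_derivative gradient V (x t) \<bullet> F (x t)) (at t within {a..b})"
      by (simp add: has_field_derivative_def mult_commute_abs)
    then show ?thesis
      unfolding \<phi>_def by (auto intro!: derivative_eq_intros)
  qed
  have "\<phi> b \<le> \<phi> a"
  proof (rule DERIV_nonpos_imp_decreasing_open[of a b \<phi>, OF \<open>a \<le> b\<close>])
    show "continuous_on {a..b} \<phi>" by (rule DERIV_continuous_on[OF der])
    fix t assume t: "a < t" "t < b"
    then have "(\<phi> has_real_derivative (gradient V (x t) \<bullet> F (x t) + c)) (at t)"
      using der[of t] at_within_Icc_at[of a t b] by auto
    moreover have "gradient V (x t) \<bullet> F (x t) + c \<le> 0"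
      using decrease[of "x t"] c[of t] x' t unfolding solution_on_def by force
    ultimately show "\<exists>y. (\<phi> has_real_derivative y) (at t) \<and> y \<le> 0" by blast
  qed
  then show ?thesis by (simp add: \<phi>_def algebra_simps)
qed

text \<open>The curve is only required to solve the equation as long as it has stayed in the ball, so that
  the lemma also applies to solutions for a modified vector field.\<close>

lemma trapped_in_ball:
  assumes r: "0 < r" "cball 0 r \<subseteq> D"
  obtains \<delta> where "0 < \<delta>" "\<And>a x t. continuous_on {a..} x \<Longrightarrow> norm (x a) < \<delta> \<Longrightarrow>
    (\<And>b. a \<le> b \<Longrightarrow> (\<forall>s\<in>{a..b}. norm (x s) \<le> r) \<Longrightarrow> solution_on D F {a..b} x) \<Longrightarrow>
    a \<le> t \<Longrightarrow> norm (x t) < r"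
proof -
  have sphere_D: "sphere 0 r \<subseteq> D" using r(2) by auto
  have "r *\<^sub>R axis undefined 1 \<in> sphere (0::real^'n) r" using r(1) by simp
  then have "sphere (0::real^'n) r \<noteq> {}" by blast
  then obtain z0 where z0: "z0 \<in> sphere 0 r" "\<And>z. z \<in> sphere 0 r \<Longrightarrow> V z0 \<le> V z"
    using continuous_attains_inf[OF compact_sphere _ continuous_on_subset[OF V_cont sphere_D]] by blast
  \<comment> \<open>The height of the barrier: starting with \<open>V\<close> below its minimum on
    the sphere, a curve along which \<open>V\<close> decreases cannot reach the sphere.\<close>
  define m where "m = V z0"
  have m: "0 < m" using z0(1) r(1) sphere_D V_pos[of z0] unfolding m_def by force
  obtain d where d: "0 < d" "\<And>z. z \<in> D \<Longrightarrow> dist z 0 < d \<Longrightarrow> dist (V z) (V 0) < m"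
    using V_cont zero_in m unfolding continuous_on_iff by blast
  show ?thesis
  proof (rule that[of "min d r"])
    show "0 < min d r" using d(1) r(1) by simp
    fix a t and x :: "real \<Rightarrow> real^'n"
    assume cont: "continuous_on {a..} x" and xa: "norm (x a) < min d r" and t: "a \<le> t"
      and sol: "\<And>b. a \<le> b \<Longrightarrow> (\<forall>s\<in>{a..b}. norm (x s) \<le> r) \<Longrightarrow> solution_on D F {a..b} x"
    show "norm (x t) < r"
    proof (rule ccontr)
      assume "\<not> norm (x t) < r"
      have cont_n: "continuous_on {a..t} (\<lambda>s. norm (x s))"
        by (intro continuous_on_norm continuous_on_subset[OF cont]) auto
      let ?A = "{a..t} \<inter> (\<lambda>s. norm (x s)) -` {r..}"
      have "closed ?A" by (rule continuous_closed_preimage[OF cont_n]) auto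
      then have "compact ({a..t} \<inter> ?A)" by (intro compact_Int_closed) auto
      then have "compact ?A" by (simp add: Int_absorb1)
      moreover have "t \<in> ?A" using \<open>\<not> norm (x t) < r\<close> t by simp
      ultimately obtain b where b: "b \<in> ?A" "\<And>s. s \<in> ?A \<Longrightarrow> b \<le> s"
        using compact_attains_inf[of ?A] by blast
      \<comment> \<open>At the first time \<open>b\<close> of norm at least \<open>r\<close> the
        norm is exactly \<open>r\<close>. So the curve is in the closed ball up to and including
        \<open>b\<close>, and the equation may be used there.\<close>
      have "\<exists>s\<ge>a. s \<le> b \<and> norm (x s) = r"
      proof (rule IVT')
        show "continuous_on {a..b} (\<lambda>s. norm (x s))"
          by (rule continuous_on_subset[OF cont_n]) (use b(1) in auto)
      qed (use xa b(1) in auto)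
      then obtain s where "a \<le> s" "s \<le> b" "norm (x s) = r" by blast
      moreover from this have "b \<le> s" using b by auto
      ultimately have nb: "norm (x b) = r" by simp
      have "norm (x s) \<le> r" if "s \<in> {a..b}" for s
        using b(2)[of s] that nb b(1) by (cases "s = b") force+
      then have sol': "solution_on D F {a..b} x" using sol[of b] b(1) by simp
      have "V (x b) + 0 * (b - a) \<le> V (x a)"
        using b(1) sol' q_nonneg by (intro V_decrease[OF sol']) (auto simp: solution_on_def)
      moreover have "V (x a) < m"
      proof -
        have "x a \<in> D" using xa r(2) by auto
        from d(2)[OF this] xa show ?thesis by (auto simp: V_0 dist_real_def)
      qed
      moreover have "m \<le> V (x b)" unfolding m_def using nb by (intro z0(2)) simp
      ultimately show False by simp
    qed
  qed
qed

lemma radius: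
  assumes "0 < \<epsilon>"
  obtains r where "0 < r" "r \<le> \<epsilon>" "cball 0 r \<subseteq> D"
proof -
  obtain e where e: "0 < e" "cball 0 e \<subseteq> D" using open_D zero_in open_contains_cball by blast
  have "cball 0 (min e \<epsilon>) \<subseteq> cball (0::real^'n) e" by auto
  then show ?thesis using that[of "min e \<epsilon>"] e assms by auto
qed

text \<open>Precomposing \<open>F\<close> with the projection onto a ball makes it bounded and
  globally Lipschitz. The global solution of the modified equation is trapped in the ball, where the
  projection is the identity.\<close>

lemma local_existence:
  obtains \<delta> where "0 < \<delta>" "\<And>x0. norm x0 < \<delta> \<Longrightarrow> \<exists>x. solution_on D F {0..} x \<and> x 0 = x0"
proof -
  obtain r where r: "0 < r" "cball 0 r \<subseteq> D" by (rule radius[OF zero_less_one])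
  obtain \<delta> where \<delta>: "0 < \<delta>" "\<And>a x t. continuous_on {a..} x \<Longrightarrow> norm (x a) < \<delta> \<Longrightarrow>
    (\<And>b. a \<le> b \<Longrightarrow> (\<forall>s\<in>{a..b}. norm (x s) \<le> r) \<Longrightarrow> solution_on D F {a..b} x) \<Longrightarrow>
    a \<le> t \<Longrightarrow> norm (x t) < r"
    using trapped_in_ball[OF r] by metis
  define P where "P = closest_point (cball (0::real^'n) r)"
  have ne: "cball (0::real^'n) r \<noteq> {}" using r(1) by simp
  have P_in: "P z \<in> cball 0 r" for z unfolding P_def by (rule closest_point_in_set) (use ne in auto)
  have P_id: "P z = z" if "z \<in> cball 0 r" for z unfolding P_def using that by (rule closest_point_self)
  have P_lip: "1-lipschitz_on UNIV P"
    using closest_point_lipschitz[OF convex_cball closed_cball ne]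
    by (intro lipschitz_onI) (auto simp: P_def)
  obtain L where L: "L-lipschitz_on (cball 0 r) F"
    by (rule locally_lipschitz_on_compactE[OF F_lip compact_cball r(2)])
  have lip: "(L * 1)-lipschitz_on UNIV (\<lambda>z. F (P z))"
    by (rule lipschitz_on_compose2[OF P_lip lipschitz_on_subset[OF L]]) (use P_in in auto)
  have "bounded (F ` cball 0 r)"
    by (intro compact_imp_bounded compact_continuous_image compact_cball lipschitz_on_continuous_on[OF L])
  then obtain M where M: "\<And>z. z \<in> cball 0 r \<Longrightarrow> norm (F z) \<le> M" unfolding bounded_iff by blast
  show ?thesis
  proof (rule that[OF \<delta>(1)])
    fix x0 :: "real^'n" assume x0: "norm x0 < \<delta>"
    obtain x where x: "x 0 = x0" "\<And>t. 0 \<le> t \<Longrightarrow> (x has_vector_derivative F (P (x t))) (at t within {0..})"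
      using picard_global[OF lip, of M x0] M[OF P_in] by blast
    have sol: "solution_on D F I x" if "I \<subseteq> {0..}" "\<forall>s\<in>I. norm (x s) \<le> r" for I
      unfolding solution_on_def
    proof
      fix t assume t: "t \<in> I"
      then have "x t \<in> cball 0 r" using that(2) by simp
      moreover then have "(x has_vector_derivative F (x t)) (at t within {0..})"
        using x(2)[of t] t that(1) P_id[of "x t"] by auto
      ultimately show "x t \<in> D \<and> (x has_vector_derivative F (x t)) (at t within I)"
        using r(2) that(1) has_vector_derivative_within_subset by blast
    qed
    have "norm (x t) < r" if "0 \<le> t" for t
    proof (rule \<delta>(2)[of 0 x t])
      show "continuous_on {0..} x"
        unfolding continuous_on_eq_continuous_within
        using x(2) has_vector_derivative_continuous by (metis atLeast_iff)
    qed (use x(1) x0 that sol in auto)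
    then have "solution_on D F {0..} x" by (intro sol) (auto intro: less_imp_le)
    with x(1) show "\<exists>x. solution_on D F {0..} x \<and> x 0 = x0" by blast
  qed
qed

text \<open>The starting time \<open>a\<close> is arbitrary because attraction restarts the argument
  once the solution has come close to the origin.\<close>

lemma stable:
  assumes "0 < \<epsilon>"
  obtains \<delta> where "0 < \<delta>"
    "\<And>x a t. solution_on D F {0..} x \<Longrightarrow> 0 \<le> a \<Longrightarrow> norm (x a) < \<delta> \<Longrightarrow> a \<le> t \<Longrightarrow> norm (x t) < \<epsilon>"
proof -
  obtain r where r: "0 < r" "r \<le> \<epsilon>" "cball 0 r \<subseteq> D" by (rule radius[OF assms])
  obtain \<delta> where \<delta>: "0 < \<delta>" "\<And>a x t. continuous_on {a..} x \<Longrightarrow> norm (x a) < \<delta> \<Longrightarrow>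
    (\<And>b. a \<le> b \<Longrightarrow> (\<forall>s\<in>{a..b}. norm (x s) \<le> r) \<Longrightarrow> solution_on D F {a..b} x) \<Longrightarrow>
    a \<le> t \<Longrightarrow> norm (x t) < r"
    using trapped_in_ball[OF r(1,3)] by metis
  show ?thesis
  proof (rule that[OF \<delta>(1)])
    fix x a t assume x: "solution_on D F {0..} x" and a: "0 \<le> a" "norm (x a) < \<delta>" "a \<le> t"
    have "norm (x t) < r"
    proof (rule \<delta>(2)[of a x t])
      show "continuous_on {a..} x"
        by (rule continuous_on_subset[OF solution_on_continuous_on[OF x]]) (use a in auto)
      show "solution_on D F {a..b} x" for b
        by (rule solution_on_subset[OF x]) (use a in auto)
    qed (use a in auto)
    then show "norm (x t) < \<epsilon>" using r(2) by simp
  qed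
qed

text \<open>A solution that avoided a neighbourhood of 0 would remain in a compact annulus, where
  \<open>q\<close> has a positive minimum, and \<open>V\<close> would become negative. One entry
  into the neighbourhood suffices by stability.\<close>

lemma attractive:
  obtains \<delta> where "0 < \<delta>"
    "\<And>x. solution_on D F {0..} x \<Longrightarrow> norm (x 0) < \<delta> \<Longrightarrow> (x \<longlongrightarrow> 0) at_top"
proof -
  obtain r where r: "0 < r" "cball 0 r \<subseteq> D" by (rule radius[OF zero_less_one])
  obtain \<delta> where \<delta>: "0 < \<delta>"
    "\<And>x a t. solution_on D F {0..} x \<Longrightarrow> 0 \<le> a \<Longrightarrow> norm (x a) < \<delta> \<Longrightarrow> a \<le> t \<Longrightarrow> norm (x t) < r"
    using stable[OF r(1)] by metis
  show ?thesis
  proof (rule that[OF \<delta>(1)])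
    fix x assume x: "solution_on D F {0..} x" and x0: "norm (x 0) < \<delta>"
    have x_r: "norm (x t) < r" if "0 \<le> t" for t using \<delta>(2)[OF x _ x0 that] by simp
    show "(x \<longlongrightarrow> 0) at_top"
      unfolding tendsto_iff
    proof (intro allI impI)
      fix \<epsilon> :: real assume "0 < \<epsilon>"
      then obtain \<eta> where \<eta>: "0 < \<eta>"
        "\<And>x a t. solution_on D F {0..} x \<Longrightarrow> 0 \<le> a \<Longrightarrow> norm (x a) < \<eta> \<Longrightarrow> a \<le> t \<Longrightarrow> norm (x t) < \<epsilon>"
        using stable by metis
      have "\<exists>a\<ge>0. norm (x a) < \<eta>"
      proof (rule ccontr)
        assume far: "\<not> (\<exists>a\<ge>0. norm (x a) < \<eta>)"
        let ?K = "cball (0::real^'n) r - ball 0 \<eta>"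
        have x_K: "x t \<in> ?K" if "0 \<le> t" for t
          using far x_r[OF that] that by (auto simp: not_less)
        have "compact ?K" by (intro compact_diff compact_cball open_ball)
        moreover have "?K \<noteq> {}" using x_K[of 0] by blast
        moreover have "continuous_on ?K q" by (rule continuous_on_subset[OF q_cont]) (use r(2) in auto)
        ultimately obtain z0 where z0: "z0 \<in> ?K" "\<And>z. z \<in> ?K \<Longrightarrow> q z0 \<le> q z"
          using continuous_attains_inf[of ?K q] by blast
        have "z0 \<in> D" "z0 \<noteq> 0" using z0(1) r(2) \<eta>(1) by auto
        then have q0: "0 < q z0" by (rule q_pos)
        \<comment> \<open>By this time the guaranteed decrease is \<open>V (x 0) + 1\<close>, more
          than is available.\<close>
        define t where "t = (V (x 0) + 1) / q z0"
        have V0: "0 \<le> V (x 0)" using x by (intro V_nonneg) (simp add: solution_on_def)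
        have t: "0 \<le> t" using V0 q0 by (simp add: t_def)
        have "V (x t) + q z0 * (t - 0) \<le> V (x 0)"
          using t x_K z0(2) by (intro V_decrease[OF x]) auto
        moreover have "q z0 * (t - 0) = V (x 0) + 1" using q0 by (simp add: t_def)
        moreover have "0 \<le> V (x t)" using x t by (intro V_nonneg) (simp add: solution_on_def)
        ultimately show False by linarith
      qed
      then obtain a where a: "0 \<le> a" "norm (x a) < \<eta>" by blast
      show "eventually (\<lambda>t. dist (x t) 0 < \<epsilon>) at_top"
        using eventually_ge_at_top[of a] by eventually_elim (simp add: \<eta>(2)[OF x a])
    qed
  qed
qed

theorem asymptotically_stable: "asymptotically_stable_origin D F"
  unfolding asymptotically_stable_origin_def
proof (intro conjI allI impI zero_in F_0)
  show "\<exists>\<delta>>0. \<forall>x0. norm x0 < \<delta> \<longrightarrow> (\<exists>x. solution_on D F {0..} x \<and> x 0 = x0)"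
    using local_existence by metis
  show "\<exists>\<delta>>0. \<forall>x. solution_on D F {0..} x \<and> norm (x 0) < \<delta> \<longrightarrow> (\<forall>t\<ge>0. norm (x t) < \<epsilon>)"
    if \<epsilon>: "0 < \<epsilon>" for \<epsilon>
    using stable[OF \<epsilon>] by (metis order_refl)
  show "\<exists>\<delta>>0. \<forall>x. solution_on D F {0..} x \<and> norm (x 0) < \<delta> \<longrightarrow> (x \<longlongrightarrow> 0) at_top"
    using attractive by metis
qed

end

subsection \<open>The safe optimal feedback\<close>

locale safe_optimal_control = control_system D f g
  for D :: "(real^'n) set" and f :: "real^'n \<Rightarrow> real^'n" and g :: "real^'n \<Rightarrow> real^'m^'n" +
  fixes h :: "real^'n \<Rightarrow> real" and k :: nat and a b :: "nat \<Rightarrow> ereal"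
    and \<alpha> :: "nat \<Rightarrow> real \<Rightarrow> real" and Q :: "real^'n \<Rightarrow> real" and R :: "real^'m^'m"
    and V :: "real^'n \<Rightarrow> real"
  assumes hocbf: "hocbf D f g h k a b \<alpha>"
    and lip_Lfk: "locally_lipschitz_on D (Lie_f_iter f k h)"
    and lip_Lgh: "locally_lipschitz_on D (Lie_g g (Lie_f_iter f (k - 1) h))"
    and lip_psi: "\<And>i. i < k \<Longrightarrow> locally_lipschitz_on D (psi f h \<alpha> i)"
    and lip_rest: "locally_lipschitz_on D (alpha_rest f h \<alpha> k)"
    and zero_safe: "0 \<in> safe_set D f h \<alpha> k"
    and Q_C1: "Ck_on 1 UNIV Q" and Q_pos: "\<And>x. x \<noteq> 0 \<Longrightarrow> 0 < Q x"
    and R_sym: "transpose R = R" and R_pos: "\<And>v. v \<noteq> 0 \<Longrightarrow> v \<bullet> (R *v v) > 0"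
    and V_smooth: "smooth_on D V" and V_0: "V 0 = 0"
    and V_pos: "\<And>x. x \<in> D \<Longrightarrow> x \<noteq> 0 \<Longrightarrow> V x > 0"
    and value_attained: "\<And>x0. x0 \<in> safe_set D f h \<alpha> k \<Longrightarrow>
      \<exists>u. is_arg_min (J D f g Q R x0) (admissible D f g (K_cbf f g h \<alpha> k) x0) u
        \<and> J D f g Q R x0 u = ennreal (V x0)"
    and hjb: "\<And>x. x \<in> D \<Longrightarrow>
      \<exists>u. is_arg_min (\<lambda>u. Lie_f f V x + Lie_g g V x \<bullet> u + 1/2 * (u \<bullet> (R *v u)) + Q x)
            (\<lambda>u. u \<in> K_cbf f g h \<alpha> k x) u
        \<and> Lie_f f V x + Lie_g g V x \<bullet> u + 1/2 * (u \<bullet> (R *v u)) + Q x = 0"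
begin

abbreviation K where "K \<equiv> K_cbf f g h \<alpha> k"
abbreviation us where "us \<equiv> u_safe f g h \<alpha> k R V"
abbreviation safe where "safe \<equiv> safe_set D f h \<alpha> k"
abbreviation F where "F \<equiv> closed_loop f g us"
abbreviation cost where "cost x u \<equiv> Q x + 1/2 * (u \<bullet> (R *v u))"
abbreviation hamiltonian where
  "hamiltonian x u \<equiv> Lie_f f V x + Lie_g g V x \<bullet> u + 1/2 * (u \<bullet> (R *v u)) + Q x"
abbreviation c where "c \<equiv> Lie_g g (Lie_f_iter f (k - 1) h)"
abbreviation d where "d x \<equiv> Lie_f_iter f k h x + alpha_rest f h \<alpha> k x"

lemma safe_iff: "x \<in> safe \<longleftrightarrow> x \<in> D \<and> (\<forall>i<k. 0 \<le> psi f h \<alpha> i x)"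
proof
  assume x: "x \<in> safe"
  have "0 \<le> psi f h \<alpha> i x" if "i < k" for i
  proof -
    have "Suc i \<in> {1..k}" using that by simp
    with x have "x \<in> {x\<in>D. psi f h \<alpha> (Suc i - 1) x \<ge> 0}" unfolding safe_set_def by blast
    then show ?thesis by simp
  qed
  \<comment> \<open>Positivity of \<open>k\<close> matters: an intersection over no indices would
    not be confined to \<open>D\<close>.\<close>
  moreover have "1 \<in> {1..k}" using hocbf_pos[OF hocbf] by simp
  with x have "x \<in> D" unfolding safe_set_def by blast
  ultimately show "x \<in> D \<and> (\<forall>i<k. 0 \<le> psi f h \<alpha> i x)" by blast
next
  assume "x \<in> D \<and> (\<forall>i<k. 0 \<le> psi f h \<alpha> i x)"
  then show "x \<in> safe" unfolding safe_set_def by auto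
qed

lemma zero_in_D: "0 \<in> D" and safe_subset: "safe \<subseteq> D"
  using zero_safe safe_iff by blast+

lemma K_iff: "x \<in> D \<Longrightarrow> u \<in> K x \<longleftrightarrow> 0 \<le> c x \<bullet> u + d x"
  by (simp add: K_cbf_def C_s_eq[OF open_D hocbf] add.commute)

lemma R_nonneg: "0 \<le> v \<bullet> (R *v v)"
  using R_pos[of v] by (cases "v = 0") auto

lemma Q_cont: "continuous_on UNIV Q"
proof -
  have "Q differentiable (at x)" for x using Q_C1 by simp
  then show ?thesis
    by (intro continuous_at_imp_continuous_on ballI differentiable_imp_continuous_within) simp
qed

lemma Q_nonneg: "0 \<le> Q x"
  using continuous_nonneg_at_0[OF open_UNIV UNIV_I Q_cont Q_pos] Q_pos[of x]
  by (cases "x = 0") auto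

lemma cost_nonneg: "0 \<le> cost x u"
  using Q_nonneg[of x] R_nonneg[of u] by simp

lemma V_nonneg: "x \<in> D \<Longrightarrow> 0 \<le> V x"
  using V_pos[of x] V_0 by (cases "x = 0") auto

lemma V_C2: "Ck_on (Suc (Suc 0)) D V"
  using V_smooth unfolding smooth_on_def by blast

lemma V_diff: "x \<in> D \<Longrightarrow> V differentiable (at x)"
  using V_C2 by simp

lemma lip_gradient_V: "locally_lipschitz_on D (gradient V)"
  by (rule Ck_on_imp_gradient_locally_lipschitz_on[OF open_D V_C2])

lemma lip_LgV: "locally_lipschitz_on D (Lie_g g V)"
  unfolding Lie_g_def
  by (rule bounded_bilinear.locally_lipschitz_on_bilinear[OF bounded_bilinear_vector_matrix_mult
        lip_gradient_V lip_g_D])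

lemma cont_LgV: "continuous_on D (Lie_g g V)"
  by (rule locally_lipschitz_on_imp_continuous_on[OF lip_LgV])

lemma cont_LfV: "continuous_on D (Lie_f f V)"
  unfolding Lie_f_def
  by (intro continuous_on_inner cont_f locally_lipschitz_on_imp_continuous_on[OF lip_gradient_V])

section \<open>The multiplier and the optimality conditions\<close>

lemma c_neq_0: "x \<in> D \<Longrightarrow> c x \<noteq> 0"
  by (rule hocbf_Lie_g_iter_neq_0[OF hocbf])

lemma c_Rinv_c_pos: "x \<in> D \<Longrightarrow> 0 < c x \<bullet> (matrix_inv R *v c x)"
  by (rule positive_definite_matrix_inv(2)[OF R_pos c_neq_0])

text \<open>\<open>e\<close> is the constraint value at the unconstrained minimizer of the
  Hamiltonian.\<close>

lemma multiplier_cases: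
  assumes "x \<in> D"
  shows "multiplier f g h \<alpha> k R V x =
    (let e = d x - c x \<bullet> (matrix_inv R *v Lie_g g V x) in
      if e < 0 then - (e / (c x \<bullet> (matrix_inv R *v c x))) else 0)"
proof -
  have C: "C_s f g h \<alpha> k x (- (matrix_inv R *v Lie_g g V x)) =
      d x - c x \<bullet> (matrix_inv R *v Lie_g g V x)"
    unfolding C_s_eq[OF open_D hocbf assms] by simp
  have e: "Lie_f_iter f k h x - c x \<bullet> (matrix_inv R *v Lie_g g V x) + alpha_rest f h \<alpha> k x =
      d x - c x \<bullet> (matrix_inv R *v Lie_g g V x)"
    by simp
  show ?thesis unfolding multiplier_def Let_def C e ..
qed

text \<open>Since the denominator is positive, the case distinction is a positive part. This form
  shows both the sign of the multiplier and its Lipschitz continuity across the switching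
  surface.\<close>

lemma multiplier_eq:
  assumes "x \<in> D"
  shows "multiplier f g h \<alpha> k R V x =
    max 0 (- (d x - c x \<bullet> (matrix_inv R *v Lie_g g V x)) * inverse (c x \<bullet> (matrix_inv R *v c x)))"
proof -
  have "(if e < 0 then - (e / p) else 0) = max 0 (- e * inverse p)" if "0 < p" for e p :: real
    using that by (simp add: max_def divide_inverse[symmetric] zero_le_divide_iff divide_le_0_iff)
  from this[OF c_Rinv_c_pos[OF assms]] show ?thesis
    unfolding multiplier_cases[OF assms] Let_def .
qed

text \<open>The gradient of the Hamiltonian in the control is a multiple of the constraint
  normal.\<close>

lemma stationary:
  "Lie_g g V x + R *v us x = multiplier f g h \<alpha> k R V x *\<^sub>R c x"
proof -
  have "R *v us x = - (R *v (matrix_inv R *v (Lie_g g V x - multiplier f g h \<alpha> k R V x *\<^sub>R c x)))"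
    by (simp add: u_safe_def vector_matrix_mult_diff_distrib
        linear_neg[OF matrix_vector_mul_linear])
  then show ?thesis by (simp add: positive_definite_matrix_inv(1)[OF R_pos])
qed

lemma constraint_us:
  "c x \<bullet> us x + d x = d x - c x \<bullet> (matrix_inv R *v Lie_g g V x)
    + multiplier f g h \<alpha> k R V x * (c x \<bullet> (matrix_inv R *v c x))"
  by (simp add: u_safe_def matrix_vector_mult_diff_distrib matrix_vector_mult_scaleR
      inner_diff_right algebra_simps)

text \<open>The multiplier raises the constraint value from \<open>e\<close> to the positive part of
  \<open>e\<close>: a violated constraint becomes active, a satisfied one keeps multiplier
  0.\<close>

lemma slack:
  assumes "x \<in> D"
  shows "multiplier f g h \<alpha> k R V x = 0 \<or> c x \<bullet> us x + d x = 0" and "0 \<le> c x \<bullet> us x + d x"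
proof -
  have *: "e + (if e < 0 then - (e / p) else 0) * p = (if e < 0 then 0 else e)" if "0 < p" for e p :: real
    using that by simp
  have "c x \<bullet> us x + d x = (let e = d x - c x \<bullet> (matrix_inv R *v Lie_g g V x) in if e < 0 then 0 else e)"
    unfolding constraint_us multiplier_cases[OF assms] Let_def by (rule *[OF c_Rinv_c_pos[OF assms]])
  then show "multiplier f g h \<alpha> k R V x = 0 \<or> c x \<bullet> us x + d x = 0" "0 \<le> c x \<bullet> us x + d x"
    by (simp_all only: multiplier_cases[OF assms] Let_def split: if_splits) auto
qed

lemma us_in_K: "x \<in> D \<Longrightarrow> us x \<in> K x"
  using slack(2) by (simp add: K_iff)

lemma hamiltonian_gap:
  assumes x: "x \<in> D" and u: "u \<in> K x"
  shows "hamiltonian x (us x) + 1/2 * ((u - us x) \<bullet> (R *v (u - us x))) \<le> hamiltonian x u"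
proof -
  have "0 \<le> multiplier f g h \<alpha> k R V x" by (simp add: multiplier_eq[OF x])
  from quadratic_program_gap[OF R_sym stationary this slack(1)[OF x]] u
  show ?thesis by (fastforce simp: K_iff[OF x])
qed

text \<open>Some feasible control attains the minimum 0. Its minimality bounds the value at
  \<open>us\<close> from below, and the gap inequality bounds it from above.\<close>

lemma hamiltonian_us:
  assumes x: "x \<in> D"
  shows "hamiltonian x (us x) = 0"
proof -
  obtain u where u: "is_arg_min (hamiltonian x) (\<lambda>u. u \<in> K x) u" "hamiltonian x u = 0"
    using hjb[OF x] by blast
  have "0 \<le> hamiltonian x (us x)"
    using u us_in_K[OF x] unfolding is_arg_min_def by (metis not_le)
  moreover have "hamiltonian x (us x) \<le> 0"
    using hamiltonian_gap[OF x, of u] u R_nonneg[of "u - us x"] unfolding is_arg_min_def by linarith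
  ultimately show ?thesis by simp
qed

lemma hamiltonian_nonneg: "x \<in> D \<Longrightarrow> u \<in> K x \<Longrightarrow> 0 \<le> hamiltonian x u"
  using hamiltonian_gap[of x u] hamiltonian_us[of x] R_nonneg[of "u - us x"] by linarith

text \<open>The gap is positive definite, so no second minimizer exists. This is what identifies an
  optimal control with the feedback.\<close>

lemma hamiltonian_eq_0_iff: "x \<in> D \<Longrightarrow> u \<in> K x \<Longrightarrow> hamiltonian x u = 0 \<Longrightarrow> u = us x"
  using hamiltonian_gap[of x u] hamiltonian_us[of x] R_pos[of "u - us x"] by force

text \<open>Besides bilinear operations the formula contains only a positive part, which is
  Lipschitz, and a reciprocal, which is locally Lipschitz because its argument stays
  positive.\<close>

lemma lip_us: "locally_lipschitz_on D us"
proof -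
  note bilinear = bounded_bilinear.locally_lipschitz_on_bilinear
  have Rinv: "locally_lipschitz_on D (\<lambda>x. matrix_inv R *v G x)" if "locally_lipschitz_on D G" for G
    by (rule bounded_linear.locally_lipschitz_on_linear[OF matrix_vector_mul_bounded_linear that])
  have "locally_lipschitz_on D (\<lambda>x. inverse (c x \<bullet> (matrix_inv R *v c x)))"
    by (rule locally_lipschitz_on_compose[OF _ locally_lipschitz_on_inverse])
      (auto intro!: bilinear[OF bounded_bilinear_inner] lip_Lgh Rinv c_Rinv_c_pos simp del: One_nat_def)
  moreover have "locally_lipschitz_on D (\<lambda>x. - (d x - c x \<bullet> (matrix_inv R *v Lie_g g V x)))"
    by (intro locally_lipschitz_on_minus locally_lipschitz_on_diff locally_lipschitz_on_add lip_Lfk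
        lip_rest bilinear[OF bounded_bilinear_inner] lip_Lgh Rinv lip_LgV)
  ultimately have "locally_lipschitz_on D
      (\<lambda>x. - (d x - c x \<bullet> (matrix_inv R *v Lie_g g V x)) * inverse (c x \<bullet> (matrix_inv R *v c x)))"
    by (intro bilinear[OF bounded_bilinear_mult])
  from locally_lipschitz_on_compose[OF this locally_lipschitz_on_max_0]
  have "locally_lipschitz_on D (multiplier f g h \<alpha> k R V)"
    by (subst locally_lipschitz_on_cong[OF multiplier_eq]) simp_all
  then have "locally_lipschitz_on D
      (\<lambda>x. - (matrix_inv R *v (Lie_g g V x - multiplier f g h \<alpha> k R V x *\<^sub>R c x)))"
    by (intro locally_lipschitz_on_minus Rinv locally_lipschitz_on_diff lip_LgV
        bilinear[OF bounded_bilinear_scaleR] lip_Lgh)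
  then show ?thesis by (simp add: u_safe_def[abs_def])
qed

lemma cont_us: "continuous_on D us"
  by (rule locally_lipschitz_on_imp_continuous_on[OF lip_us])

lemma lip_F: "locally_lipschitz_on D F"
  unfolding closed_loop_def
  by (intro locally_lipschitz_on_add lip_f_D lip_g_D lip_us
      bounded_bilinear.locally_lipschitz_on_bilinear[OF bounded_bilinear_matrix_vector_mult])

subsection \<open>Forward invariance\<close>

text \<open>The chain equation solved for the Lie derivative. At the last index the next member is
  replaced by \<open>d\<close>, the control-free part of the constraint.\<close>

lemma Lie_psi:
  assumes "i < k"
  shows "Lie_f f (psi f h \<alpha> i) x =
    (if Suc i < k then psi f h \<alpha> (Suc i) x else d x) - \<alpha> (Suc i) (psi f h \<alpha> i x)"
proof (cases "Suc i < k")
  case False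
  then have "k = Suc i" using assms by simp
  then show ?thesis by (simp add: alpha_rest_def)
qed simp

lemma cont_psi: "i < k \<Longrightarrow> continuous_on D (psi f h \<alpha> i)"
  by (rule locally_lipschitz_on_imp_continuous_on[OF lip_psi])

text \<open>Continuity is read off the chain: the next member, or \<open>d\<close>, is continuous by
  hypothesis, and so is the class K term. The control coefficient is 0 or, at the end,
  \<open>c\<close>.\<close>

lemma cont_Lie_psi:
  assumes "i < k"
  shows "continuous_on D (Lie_f f (psi f h \<alpha> i))" and "continuous_on D (Lie_g g (psi f h \<alpha> i))"
proof -
  have "continuous_on (K_domain (a (Suc i)) (b (Suc i))) (\<alpha> (Suc i))"
    using hocbf_chainD(1)[OF hocbf assms] unfolding class_K_def by blast
  from continuous_on_compose2[OF this cont_psi[OF assms]]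
  have 1: "continuous_on D (\<lambda>x. \<alpha> (Suc i) (psi f h \<alpha> i x))"
    using hocbf_chainD(3)[OF hocbf assms] by blast
  have 2: "continuous_on D (\<lambda>x. if Suc i < k then psi f h \<alpha> (Suc i) x else d x)"
  proof (cases "Suc i < k")
    case True
    then show ?thesis using cont_psi[OF True] by simp
  next
    case False
    then show ?thesis
      using continuous_on_add[OF locally_lipschitz_on_imp_continuous_on[OF lip_Lfk]
          locally_lipschitz_on_imp_continuous_on[OF lip_rest]] by simp
  qed
  have "Lie_f f (psi f h \<alpha> i) = (\<lambda>x. (if Suc i < k then psi f h \<alpha> (Suc i) x else d x)
      - \<alpha> (Suc i) (psi f h \<alpha> i x))"
    by (rule ext) (rule Lie_psi[OF assms])
  then show "continuous_on D (Lie_f f (psi f h \<alpha> i))"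
    using continuous_on_diff[OF 2 1] by simp
  show "continuous_on D (Lie_g g (psi f h \<alpha> i))"
  proof (cases "Suc i < k")
    case True
    have "continuous_on D (\<lambda>_. 0 :: real^'m)" by (rule continuous_on_const)
    then show ?thesis
      by (rule continuous_on_eq) (simp add: Lie_g_psi_eq_0[OF open_D hocbf True])
  next
    case False
    then have "k - 1 = i" using assms by simp
    with Lie_g_psi_last[OF open_D hocbf]
    have "c x = Lie_g g (psi f h \<alpha> i) x" if "x \<in> D" for x using that by metis
    then show ?thesis
      by (rule continuous_on_eq[OF locally_lipschitz_on_imp_continuous_on[OF lip_Lgh]])
  qed
qed

text \<open>Where \<open>psi f h \<alpha> i\<close> is negative, its rate is the next member, or the
  constraint value at the last index, minus a negative class K term. With that quantity nonnegative,
  the comparison lemma applies.\<close>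

lemma bounded_trajectory_safe:
  assumes traj: "bounded_trajectory D f g u x T B" and N: "negligible N"
    and u: "\<And>t. t \<in> {0..T} - N \<Longrightarrow> u t \<in> K (x t)" and x0: "x 0 \<in> safe" and t: "t \<in> {0..T}"
  shows "x t \<in> safe"
proof -
  interpret tr: bounded_trajectory D f g u x T B by fact
  have step: "0 \<le> psi f h \<alpha> i (x t)"
    if i: "i < k" and next_nonneg: "\<And>s. Suc i < k \<Longrightarrow> s \<in> {0..T} \<Longrightarrow> 0 \<le> psi f h \<alpha> (Suc i) (x s)"
      and t: "t \<in> {0..T}" for i t
  proof (rule integral_comparison_nonneg[OF _ _ _ _ N _ t])
    show "continuous_on {0..T} (\<lambda>s. psi f h \<alpha> i (x s))"
      by (rule tr.continuous_on_comp[OF cont_psi[OF i]])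
    show "(\<lambda>s. Lie_f f (psi f h \<alpha> i) (x s) + Lie_g g (psi f h \<alpha> i) (x s) \<bullet> u s) integrable_on {0..T}"
      by (rule tr.affine_integrable[OF cont_Lie_psi[OF i]])
    show "psi f h \<alpha> i (x s) = psi f h \<alpha> i (x 0) +
        integral {0..s} (\<lambda>s. Lie_f f (psi f h \<alpha> i) (x s) + Lie_g g (psi f h \<alpha> i) (x s) \<bullet> u s)"
      if "s \<in> {0..T}" for s
      by (rule tr.chain_rule[OF psi_differentiable[OF open_D hocbf i] cont_Lie_psi[OF i] that])
    show "0 \<le> psi f h \<alpha> i (x 0)" using x0 i unfolding safe_iff by blast
    fix s assume s: "s \<in> {0..T} - N" "psi f h \<alpha> i (x s) < 0"
    then have xs: "x s \<in> D" using tr.x_in by simp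
    have neg: "\<alpha> (Suc i) (psi f h \<alpha> i (x s)) < 0"
      by (rule class_K_neg[OF hocbf_chainD(1)[OF hocbf i]
          bspec[OF hocbf_chainD(3)[OF hocbf i] xs] s(2)])
    show "0 \<le> Lie_f f (psi f h \<alpha> i) (x s) + Lie_g g (psi f h \<alpha> i) (x s) \<bullet> u s"
    proof (cases "Suc i < k")
      case True
      then have "0 \<le> psi f h \<alpha> (Suc i) (x s)" using next_nonneg s(1) by blast
      then show ?thesis using neg by (simp add: Lie_g_psi_eq_0[OF open_D hocbf True xs])
    next
      case False
      then have k: "k = Suc i" using i by simp
      have "0 \<le> C_s f g h \<alpha> k (x s) (u s)" using u[OF s(1)] by (simp add: K_cbf_def)
      then show ?thesis using neg by (simp add: C_s_def system_deriv_def k)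
    qed
  qed
  have "0 \<le> psi f h \<alpha> i (x t)" if "i < k" "t \<in> {0..T}" for i t
    using that
  \<comment> \<open>The induction descends from the last chain member, where the constraint itself
    supplies the sign.\<close>
  proof (induction "k - Suc i" arbitrary: i t)
    case 0
    show ?case by (rule step) (use 0 in auto)
  next
    case (Suc j)
    show ?case
      by (rule step[OF Suc.prems(1) _ Suc.prems(2)], rule Suc.hyps(1)) (use Suc.hyps(2) in auto)
  qed
  then show ?thesis using tr.x_in[OF t] t unfolding safe_iff by blast
qed

lemma forward_invariant_safe: "forward_invariant D F safe"
  unfolding forward_invariant_def
proof (intro allI impI ballI, elim conjE)
  fix I x t
  assume I: "is_interval I" "0 \<in> I" "I \<subseteq> {0..}" and sol: "solution_on D F I x" and x0: "x 0 \<in> safe"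
    and t: "t \<in> I"
  have t0: "0 \<le> t" using I(3) t by auto
  have "{0..t} \<subseteq> I"
  proof
    fix s assume "s \<in> {0..t}"
    then show "s \<in> I" using mem_is_interval_1_I[OF I(1,2) t] by simp
  qed
  from solution_on_subset[OF sol this] have sol': "solution_on D F {0..t} x" .
  have in_D: "x s \<in> D" if "s \<in> {0..t}" for s using sol' that unfolding solution_on_def by blast
  have cont: "continuous_on {0..t} x" by (rule solution_on_continuous_on[OF sol'])
  have cont_u: "continuous_on {0..t} (\<lambda>s. us (x s))"
    by (rule continuous_on_compose2[OF cont_us cont]) (use in_D in auto)
  have "bounded ((\<lambda>s. us (x s)) ` {0..t})"
    by (intro compact_imp_bounded compact_continuous_image cont_u compact_Icc)
  then obtain B where B: "\<forall>s\<in>{0..t}. norm (us (x s)) \<le> B" unfolding bounded_iff by blast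
  have "bounded_trajectory D f g (\<lambda>s. us (x s)) x t B"
  proof
    show "(\<lambda>s. us (x s)) \<in> borel_measurable (lebesgue_on {0..t})"
      by (rule continuous_imp_measurable_on_sets_lebesgue[OF cont_u]) simp
    fix s assume s: "s \<in> {0..t}"
    have "solution_on D F {0..s} x" by (rule solution_on_subset[OF sol']) (use s in auto)
    from solution_on_has_integral[OF this] s
    show "x s = x 0 + integral {0..s} (\<lambda>s. f (x s) + g (x s) *v us (x s))"
      by (simp add: closed_loop_def has_integral_iff)
  qed (use open_D cont_f cont_g t0 B cont in_D in auto)
  from bounded_trajectory_safe[OF this negligible_empty _ x0, of t]
  show "x t \<in> safe" using us_in_K in_D t0 by simp
qed

text \<open>Dynamic programming restarts the problem at an intermediate state, and the value
  function is known to be attained at safe states only.\<close>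

lemma admissible_safe:
  assumes adm: "admissible D f g K x0 u" and x0: "x0 \<in> safe" and t: "0 \<le> t"
  shows "state D f g x0 u t \<in> safe"
proof -
  let ?x = "state D f g x0 u"
  note x = admissible_trajectory[OF adm] and eb = admissible_ess_bounded[OF adm]
  obtain N u' B where u': "negligible N" "\<forall>t. t \<notin> N \<longrightarrow> u' t = u t"
    "u' \<in> borel_measurable (lebesgue_on {0..t})" "\<forall>s\<in>{0..t}. norm (u' s) \<le> B"
    by (rule ess_bounded_controlE[OF eb t])
  have S: "{0..} \<in> sets (lebesgue :: real measure)" by simp
  have "AE t in lebesgue_on {0..}. u t \<in> K (?x t)" using adm unfolding admissible_def by blast
  from iffD1[OF AE_lebesgue_on_iff_negligible[OF S] this]
  obtain N' where N': "negligible N'" "\<forall>t\<in>{0..} - N'. u t \<in> K (?x t)" by (elim exE conjE)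
  have tr: "bounded_trajectory D f g u' ?x t B" by (rule bounded_trajectoryI[OF x u' t])
  have "negligible (N \<union> N')" using u'(1) N'(1) by simp
  from bounded_trajectory_safe[OF tr this, of t]
  show ?thesis using u'(2) N'(2) x0 t trajectory_0[OF x] by auto
qed

subsection \<open>Optimality\<close>

lemma closed_loop_admissible:
  assumes x: "solution_on D F {0..} x"
  shows "admissible D f g K (x 0) (\<lambda>t. us (x t))"
proof (rule admissibleI[OF closed_loop_trajectory(2,1)[OF cont_us x]])
  have "us (x t) \<in> K (x t)" if "t \<in> {0..}" for t
    using x that us_in_K unfolding solution_on_def by blast
  then show "AE t in lebesgue_on {0..}. us (x t) \<in> K (x t)" by (intro AE_I2) simp
qed

text \<open>Up to any finite time the cost is exactly the loss in \<open>V\<close>, which is at most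
  the initial value as \<open>V\<close> stays nonnegative. Convergence of the state to the origin
  does not enter.\<close>

lemma closed_loop_cost_le:
  assumes x: "solution_on D F {0..} x"
  shows "J D f g Q R (x 0) (\<lambda>t. us (x t)) \<le> ennreal (V (x 0))"
proof -
  note tr = closed_loop_trajectory[OF cont_us x]
  let ?l = "\<lambda>t. cost (x t) (us (x t))"
  have "(\<integral>\<^sup>+ t. ennreal (?l t) \<partial>lebesgue_on {0..real n}) \<le> ennreal (V (x 0))" for n
  proof -
    have in_D: "x t \<in> D" if "0 \<le> t" for t using trajectory_in[OF tr(1) that] .
    have "((\<lambda>s. Lie_f f V (x s) + Lie_g g V (x s) \<bullet> us (x s)) has_integral
        (V (x (real n)) - V (x 0))) {0..real n}"
      by (rule trajectory_chain_rule[OF tr(2,1) _ V_diff cont_LfV cont_LgV]) auto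
    then have "((\<lambda>s. - ?l s) has_integral (V (x (real n)) - V (x 0))) {0..real n}"
    proof (rule has_integral_eq[rotated])
      fix s assume "s \<in> {0..real n}"
      then have "hamiltonian (x s) (us (x s)) = 0" by (intro hamiltonian_us in_D) simp
      then show "Lie_f f V (x s) + Lie_g g V (x s) \<bullet> us (x s) = - ?l s" by linarith
    qed
    from integral_unique[OF has_integral_neg[OF this]]
    have "integral {0..real n} ?l = V (x 0) - V (x (real n))" by (simp add: add.commute)
    also have "\<dots> \<le> V (x 0)" using V_nonneg[OF in_D, of "real n"] by simp
    finally have "integral {0..real n} ?l \<le> V (x 0)" .
    then show ?thesis
      using nn_integral_eq_integral_Icc[OF running_cost_integrable[OF tr(2,1) Q_cont, of "real n" R] cost_nonneg]
      by (simp add: ennreal_leI)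
  qed
  then show ?thesis
    unfolding J_eq[OF tr(2,1)]
    by (intro nn_integral_atLeast_le measurable_compose[OF running_cost_measurable[OF tr(2,1) Q_cont]])
      auto
qed

lemma value_le_cost:
  assumes "x0 \<in> safe" "admissible D f g K x0 u"
  shows "ennreal (V x0) \<le> J D f g Q R x0 u"
  using value_attained[OF assms(1)] assms(2) unfolding is_arg_min_def by (metis not_le)

lemma closed_loop_optimal:
  assumes "solution_on D F {0..} x" "x 0 \<in> safe"
  shows "is_arg_min (J D f g Q R (x 0)) (admissible D f g K (x 0)) (\<lambda>t. us (x t))"
  unfolding is_arg_min_def
  using closed_loop_admissible[OF assms(1)] closed_loop_cost_le[OF assms(1)]
    value_le_cost[OF assms(2)] by (metis leD order_trans)

text \<open>Dynamic programming: the tail of an optimal control is admissible from \<open>x T\<close> and hence costs at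
  least \<open>V (x T)\<close>.\<close>

lemma optimal_cost_to_go:
  assumes x0: "x0 \<in> safe" and adm: "admissible D f g K x0 u"
    and opt: "J D f g Q R x0 u = ennreal (V x0)" and T: "0 \<le> T"
  shows "integral {0..T} (\<lambda>t. cost (state D f g x0 u t) (u t)) + V (state D f g x0 u T) \<le> V x0"
proof -
  define x where "x = state D f g x0 u"
  have tr: "trajectory D f g x0 u x" unfolding x_def by (rule admissible_trajectory[OF adm])
  note eb = admissible_ess_bounded[OF adm]
  let ?l = "\<lambda>t. cost (x t) (u t)"
  have xT: "x T \<in> safe" unfolding x_def by (rule admissible_safe[OF adm x0 T])
  note tr' = trajectory_shift[OF tr T] and eb' = ess_bounded_control_shift[OF eb T]
  have "AE t in lebesgue_on {0..}. u t \<in> K (x t)" using adm unfolding admissible_def x_def by blast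
  then have "AE t in lebesgue_on {0..}. u (T + t) \<in> K (x (T + t))"
    by (rule AE_shift) (use T in auto)
  then have "admissible D f g K (x T) (\<lambda>t. u (T + t))"
    by (rule admissibleI[OF eb' tr'])
  from value_le_cost[OF xT this]
  have V_le: "ennreal (V (x T)) \<le> (\<integral>\<^sup>+ t. ennreal (?l (T + t)) \<partial>lebesgue_on {0..})"
    unfolding J_eq[OF eb' tr'] .
  have meas: "(\<lambda>t. ennreal (?l t)) \<in> borel_measurable (lebesgue_on {0..})"
    by (intro measurable_compose[OF running_cost_measurable[OF eb tr Q_cont]]) simp
  then have "(\<lambda>t. ennreal (?l t)) \<in> borel_measurable (lebesgue_on {T..})"
    by (rule measurable_restrict_mono) (use T in auto)
  note shift = nn_integral_shift[OF this]
  note int = running_cost_integrable[OF eb tr Q_cont T, of R]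
  have int_nonneg: "0 \<le> integral {0..T} ?l"
    using cost_nonneg int by (intro integral_nonneg) (auto simp: absolutely_integrable_on_def)
  have VT: "0 \<le> V (x T)" using V_nonneg xT safe_subset by blast
  have "ennreal (integral {0..T} ?l + V (x T)) = ennreal (integral {0..T} ?l) + ennreal (V (x T))"
    by (rule ennreal_plus[OF int_nonneg VT])
  also have "\<dots> \<le> (\<integral>\<^sup>+ t. ennreal (?l t) \<partial>lebesgue_on {0..T}) + (\<integral>\<^sup>+ t. ennreal (?l t) \<partial>lebesgue_on {T..})"
    using V_le nn_integral_eq_integral_Icc[OF int cost_nonneg]
    unfolding shift by (intro add_mono) simp_all
  also have "\<dots> = J D f g Q R x0 u"
    unfolding J_eq[OF eb tr] nn_integral_split[OF meas T] ..
  finally have "ennreal (integral {0..T} ?l + V (x T)) \<le> ennreal (V x0)" unfolding opt .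
  moreover have "0 \<le> V x0" using V_nonneg x0 safe_subset by blast
  ultimately show ?thesis unfolding x_def by (simp only: ennreal_le_iff)
qed

text \<open>By the chain rule the integral of the Hamiltonian is the change of \<open>V\<close> plus
  the cost spent, which dynamic programming bounds by 0. Feasibility makes the integrand
  nonnegative, so it vanishes almost everywhere.\<close>

lemma optimal_control_eq_us:
  assumes x0: "x0 \<in> safe" and adm: "admissible D f g K x0 u"
    and opt: "J D f g Q R x0 u = ennreal (V x0)" and T: "0 \<le> T"
  shows "AE t in lebesgue_on {0..T}. u t = us (state D f g x0 u t)"
proof -
  define x where "x = state D f g x0 u"
  have tr: "trajectory D f g x0 u x" unfolding x_def by (rule admissible_trajectory[OF adm])
  note eb = admissible_ess_bounded[OF adm]
  let ?l = "\<lambda>t. cost (x t) (u t)" and ?H = "\<lambda>t. hamiltonian (x t) (u t)"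
  have int_l: "?l integrable_on {0..T}"
    using running_cost_integrable[OF eb tr Q_cont T, of R] by (simp add: absolutely_integrable_on_def)
  have "((\<lambda>s. (Lie_f f V (x s) + Lie_g g V (x s) \<bullet> u s) + ?l s) has_integral
      (V (x T) - V x0 + integral {0..T} ?l)) {0..T}"
    by (intro has_integral_add trajectory_chain_rule[OF eb tr T V_diff cont_LfV cont_LgV]
        integrable_integral int_l)
  then have H: "(?H has_integral (V (x T) - V x0 + integral {0..T} ?l)) {0..T}"
    by (simp add: add_ac)
  have K: "AE t in lebesgue_on {0..T}. u t \<in> K (x t)"
  proof -
    have "AE t in lebesgue_on {0..}. u t \<in> K (x t)" using adm unfolding admissible_def x_def by blast
    from AE_shift[OF this, of "{0..T}" 0] show ?thesis by simp
  qed
  have in_D: "x t \<in> D" if "t \<in> {0..T}" for t using trajectory_in[OF tr] that by simp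
  have "AE t in lebesgue_on {0..T}. ?H t = 0"
  proof (rule integral_nonpos_imp_AE_eq_0)
    show "?H integrable_on {0..T}" using H by blast
    show "integral {0..T} ?H \<le> 0"
      using optimal_cost_to_go[OF x0 adm opt T] integral_unique[OF H] unfolding x_def by simp
    show "AE t in lebesgue_on {0..T}. 0 \<le> ?H t"
    proof (rule AE_mp[OF K AE_I2], rule impI)
      fix t assume "t \<in> space (lebesgue_on {0..T})" "u t \<in> K (x t)"
      then show "0 \<le> ?H t" using in_D by (intro hamiltonian_nonneg) simp_all
    qed
  qed
  then have "AE t in lebesgue_on {0..T}. ?H t = 0 \<and> u t \<in> K (x t)" using K by (rule AE_conjI)
  then show ?thesis
    unfolding x_def[symmetric]
  proof (rule AE_mp[OF _ AE_I2], intro impI)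
    fix t assume "t \<in> space (lebesgue_on {0..T})" "?H t = 0 \<and> u t \<in> K (x t)"
    then show "u t = us (x t)" using in_D by (intro hamiltonian_eq_0_iff) simp_all
  qed
qed

text \<open>The bound on \<open>V\<close> is recorded for the case of the origin, where it pins the
  trajectory down.\<close>

lemma optimal_solution:
  assumes x0: "x0 \<in> safe"
  obtains x where "solution_on D F {0..} x" "x 0 = x0" "\<forall>t\<ge>0. V (x t) \<le> V x0"
proof -
  obtain u where u: "admissible D f g K x0 u" "J D f g Q R x0 u = ennreal (V x0)"
    using value_attained[OF x0] unfolding is_arg_min_def by blast
  define x where "x = state D f g x0 u"
  have tr: "trajectory D f g x0 u x" unfolding x_def by (rule admissible_trajectory[OF u(1)])
  note eb = admissible_ess_bounded[OF u(1)]
  have in_D: "x t \<in> D" if "0 \<le> t" for t using trajectory_in[OF tr that] .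
  have cont: "continuous_on {0..} x"
    by (rule trajectory_continuous_atLeast[OF tr])
  have cont_F: "continuous_on {0..} (\<lambda>t. F (x t))"
    by (rule continuous_on_compose2[OF locally_lipschitz_on_imp_continuous_on[OF lip_F] cont])
      (use in_D in auto)
  \<comment> \<open>Replacing the control by the feedback off a null set leaves the integral
    unchanged and makes the integrand continuous, so the curve is differentiable. The null set may
    depend on \<open>t\<close>.\<close>
  have x_eq: "x t = x0 + integral {0..t} (\<lambda>s. F (x s))" if t: "0 \<le> t" for t
  proof -
    have S: "{0..t} \<in> sets lebesgue" by simp
    from iffD1[OF AE_lebesgue_on_iff_negligible[OF S] optimal_control_eq_us[OF x0 u t]]
    obtain N where N: "negligible N" "\<forall>s\<in>{0..t} - N. u s = us (x s)"
      unfolding x_def by (elim exE conjE)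
    have "integral {0..t} (\<lambda>s. f (x s) + g (x s) *v u s) = integral {0..t} (\<lambda>s. F (x s))"
      using N(2) by (intro integral_spike[OF N(1)]) (simp add: closed_loop_def)
    then show ?thesis using tr t unfolding trajectory_def by simp
  qed
  show ?thesis
  proof (rule that)
    show "x 0 = x0" by (rule trajectory_0[OF tr])
    show "solution_on D F {0..} x"
      unfolding solution_on_def
    proof (intro ballI conjI)
      fix t :: real assume "t \<in> {0..}"
      then have t: "0 \<le> t" by simp
      show "x t \<in> D" by (rule in_D[OF t])
      have "((\<lambda>t. x0 + integral {0..t} (\<lambda>s. F (x s))) has_vector_derivative F (x t)) (at t within {0..})"
        using has_vector_derivative_add[OF has_vector_derivative_const
            integral_has_vector_derivative_atLeast[OF cont_F t]] by simp
      then show "(x has_vector_derivative F (x t)) (at t within {0..})"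
        by (rule has_vector_derivative_transform[rotated 2]) (use t x_eq in auto)
    qed
    show "\<forall>t\<ge>0. V (x t) \<le> V x0"
    proof (intro allI impI)
      fix t :: real assume t: "0 \<le> t"
      have "0 \<le> integral {0..t} (\<lambda>s. cost (x s) (u s))"
        using running_cost_integrable[OF eb tr Q_cont t, of R] cost_nonneg
        by (intro integral_nonneg) (simp_all add: absolutely_integrable_on_def)
      with optimal_cost_to_go[OF x0 u t] show "V (x t) \<le> V x0" unfolding x_def by linarith
    qed
  qed
qed

section \<open>Asymptotic stability of the closed loop\<close>

lemma F_0: "F 0 = 0"
proof -
  obtain x where x: "solution_on D F {0..} x" "x 0 = 0" "\<forall>t\<ge>0. V (x t) \<le> V 0"
    by (rule optimal_solution[OF zero_safe])
  have zero: "x t = 0" if "0 \<le> t" for t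
  proof (rule ccontr)
    assume "x t \<noteq> 0"
    moreover have "x t \<in> D" using x(1) that unfolding solution_on_def by simp
    ultimately show False using V_pos[of "x t"] x(3) that V_0 by force
  qed
  \<comment> \<open>An interior time, so that the derivative is two-sided and hence unique.\<close>
  have "(x has_vector_derivative F (x 1)) (at 1 within {0..})"
    using x(1) unfolding solution_on_def by simp
  moreover have "at (1::real) within {0..} = at 1"
    by (rule at_within_interior) simp
  ultimately have "(x has_vector_derivative F 0) (at 1)" using zero[of 1] by simp
  moreover have "(x has_vector_derivative 0) (at 1)"
    by (rule has_vector_derivative_transform_within_open[OF has_vector_derivative_const[of 0],
          of "{0<..}"]) (simp_all add: zero)
  ultimately show ?thesis by (rule vector_derivative_unique_at)
qed

text \<open>The vanishing Hamiltonian gives \<open>V\<close> the rate minus the running cost, at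
  most \<open>- Q\<close>, on all of \<open>D\<close> and not only on the safe set.\<close>

lemma origin_asymptotically_stable: "asymptotically_stable_origin D F"
proof -
  interpret lyapunov_function D F V Q
  proof
    show "continuous_on D Q" by (rule continuous_on_subset[OF Q_cont]) simp
    fix z assume z: "z \<in> D"
    have "gradient V z \<bullet> F z = Lie_f f V z + Lie_g g V z \<bullet> us z"
      by (simp add: closed_loop_def inner_add_right Lie_f_def Lie_g_inner)
    then show "gradient V z \<bullet> F z \<le> - Q z"
      using hamiltonian_us[OF z] R_nonneg[of "us z"] by linarith
  qed (use open_D zero_in_D lip_F F_0 V_0 V_pos V_diff Q_pos in auto)
  show ?thesis by (rule asymptotically_stable)
qed

end

theorem theorem4:
  fixes D :: "(real^'n) set"
    and f :: "real^'n \<Rightarrow> real^'n"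
    and g :: "real^'n \<Rightarrow> real^'m^'n"
    and h :: "real^'n \<Rightarrow> real"
    and k :: nat
    and a b :: "nat \<Rightarrow> ereal"
    and \<alpha> :: "nat \<Rightarrow> real \<Rightarrow> real"
    and Q :: "real^'n \<Rightarrow> real"
    and R :: "real^'m^'m"
    and V :: "real^'n \<Rightarrow> real"
  assumes "open D"
    and "locally_lipschitz_on UNIV f"
    and "locally_lipschitz_on UNIV g"
    and "hocbf D f g h k a b \<alpha>"
    and "locally_lipschitz_on D (Lie_f_iter f k h)"
    and "locally_lipschitz_on D (Lie_g g (Lie_f_iter f (k - 1) h))"
    and "\<And>i. i < k \<Longrightarrow> locally_lipschitz_on D (psi f h \<alpha> i)"
    and "\<And>i. i \<in> {1..k} \<Longrightarrow> locally_lipschitz_on (K_domain (a i) (b i)) (\<alpha> i)"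
    and "locally_lipschitz_on D (alpha_rest f h \<alpha> k)"
    and "0 \<in> safe_set D f h \<alpha> k"
    and "Ck_on 1 UNIV Q"
    and "\<And>x. x \<noteq> 0 \<Longrightarrow> Q x > 0"
    and "transpose R = R"
    and "\<And>v. v \<noteq> 0 \<Longrightarrow> v \<bullet> (R *v v) > 0"
    and "smooth_on D V"
    and "V 0 = 0"
    and "\<And>x. x \<in> D \<Longrightarrow> x \<noteq> 0 \<Longrightarrow> V x > 0"
    and "\<And>x0. x0 \<in> safe_set D f h \<alpha> k \<Longrightarrow>
      \<exists>u. is_arg_min (J D f g Q R x0) (admissible D f g (K_cbf f g h \<alpha> k) x0) u
        \<and> J D f g Q R x0 u = ennreal (V x0)"
    and "\<And>x. x \<in> D \<Longrightarrow>
      \<exists>u. is_arg_min (\<lambda>u. Lie_f f V x + Lie_g g V x \<bullet> u + 1/2 * (u \<bullet> (R *v u)) + Q x)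
            (\<lambda>u. u \<in> K_cbf f g h \<alpha> k x) u
        \<and> Lie_f f V x + Lie_g g V x \<bullet> u + 1/2 * (u \<bullet> (R *v u)) + Q x = 0"
  shows "(\<forall>x\<in>D. u_safe f g h \<alpha> k R V x \<in> K_cbf f g h \<alpha> k x)
       \<and> forward_invariant D (closed_loop f g (u_safe f g h \<alpha> k R V)) (safe_set D f h \<alpha> k)
       \<and> locally_lipschitz_on D (u_safe f g h \<alpha> k R V)
       \<and> (\<forall>x0\<in>interior (safe_set D f h \<alpha> k).
      (\<exists>x. solution_on D (closed_loop f g (u_safe f g h \<alpha> k R V)) {0..} x \<and> x 0 = x0) \<and>
      (\<forall>x. solution_on D (closed_loop f g (u_safe f g h \<alpha> k R V)) {0..} x \<and> x 0 = x0 \<longrightarrow>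
         is_arg_min (J D f g Q R x0) (admissible D f g (K_cbf f g h \<alpha> k) x0)
           (\<lambda>t. u_safe f g h \<alpha> k R V (x t))))
       \<and> asymptotically_stable_origin D (closed_loop f g (u_safe f g h \<alpha> k R V))"
proof -
  interpret safe_optimal_control D f g h k a b \<alpha> Q R V
    by (unfold_locales; (rule assms; assumption?)?)
  show ?thesis
  proof (intro conjI ballI allI impI)
    show "us x \<in> K x" if "x \<in> D" for x by (rule us_in_K[OF that])
    show "forward_invariant D F safe" by (rule forward_invariant_safe)
    show "locally_lipschitz_on D us" by (rule lip_us)
    show "asymptotically_stable_origin D F" by (rule origin_asymptotically_stable)
    fix x0 assume "x0 \<in> interior safe"
    then have x0: "x0 \<in> safe" using interior_subset by blast
    show "\<exists>x. solution_on D F {0..} x \<and> x 0 = x0" using optimal_solution[OF x0] by metis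
    fix x assume "solution_on D F {0..} x \<and> x 0 = x0"
    then show "is_arg_min (J D f g Q R x0) (admissible D f g K x0) (\<lambda>t. us (x t))"
      using closed_loop_optimal x0 by metis
  qed
qed

end
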